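(* For a dominant integral weight $\lambda$ and any $\lambda$-chain $\{\beta_i\}_{i\in I}$, the character $\chi(\lambda)$ of the irreducible representation $V_\lambda$ with highest weight $\lambda$ is given by $$\chi(\lambda)=\sum_J e^{\mu(J)},$$ where the sum is over the admissible subsets $J$ of the index set $I$.
   Context: Root system. Let $V$ be a finite-dimensional real vector space with a nondegenerate symmetric bilinear form $\langle\cdot,\cdot\rangle$, and let $\Phi\subset V$ be the set of real roots of a complex symmetrizable Kac-Moody algebra $\mathfrak{g}$, with simple roots $\alpha_1,\ldots,\alpha_r$. Put $\alpha^\vee=2\alpha/\langle\alpha,\alpha\rangle$ for $\alpha\in\Phi$ and $s_\alpha(v)=v-\langle v,\alpha^\vee\rangle\alpha$; for $k\in\mathbb{Z}$ put $s_{\alpha,k}(v)=s_\alpha(v)+k\alpha$. Let $W\subset GL(V)$ be the Weyl group generated by the $s_\alpha$, $\alpha\in\Phi$, with length function $\ell$ with respect to the simple reflections $s_p=s_{\alpha_p}$. Thus: $\alpha_1,\dots,\alpha_r$ are linearly independent; $\langle\alpha_p,\alpha_p\rangle>0$; $\langle\alpha_p,\alpha_q^\vee\rangle\in\mathbb{Z}_{\le0}$ for $p\ne q$; and $\Phi=\bigcup_p W\alpha_p$. $\Phi^+$ is the set of roots in the nonnegative span of the simple roots, and $\Phi=\Phi^+\sqcup(-\Phi^+)$. In the Bruhat order on $W$, $w\lessdot ws_\alpha$ (covering relation, $\alpha\in\Phi^+$) means $\ell(ws_\alpha)=\ell(w)+1$. The integral weights are $\Lambda=\{v\in V\mid\langle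 v,\alpha_p^\vee\rangle\in\mathbb{Z},\ p=1,\dots,r\}$; a weight $\lambda\in\Lambda$ is dominant if $\langle\lambda,\alpha^\vee\rangle\ge0$ for all $\alpha\in\Phi^+$. Characters. Fix a linear map $\mathrm{ht}:V\to\mathbb{R}$ with $\mathrm{ht}(\alpha_p)=1$ for all $p$. $R$ is the ring of formal sums $\sum_{\nu\in\Lambda}c_\nu e^\nu$, $c_\nu\in\mathbb{Z}$, such that for every $h\in\mathbb{R}$ only finitely many $\nu$ with $\mathrm{ht}(\nu)>h$ have $c_\nu\neq0$, with $e^\mu e^\nu=e^{\mu+\nu}$. Let $\rho\in\Lambda$ satisfy $\langle\rho,\alpha_p^\vee\rangle=1$ for all $p$. By the Kac-Weyl formula, the character of the irreducible integrable $\mathfrak{g}$-module $V_\lambda$ of highest weight $\lambda$ is $$\chi(\lambda)=\frac{\sum_{w\in W}(-1)^{\ell(w)}e^{w(\lambda+\rho)-\rho}}{\sum_{w\in W}(-1)^{\ell(w)}e^{w(\rho)-\rho}}\in R.$$ $\lambda$-chains. A $\lambda$-chain is a family $\{\beta_i\}_{i\in I}$ of positive roots indexed by a totally ordered set $I$ such that: (1) for each $\alpha\in\Phi^+$, $\#\{i\in I\mid\beta_i=\alpha\}=\langle\lambda,\alpha^\vee\rangle$; (2) for any roots $\alpha,\beta,\gamma\in\Phi$ with $\alpha\ne\pm\beta$ and $\gamma^\vee=\alpha^\vee+k\beta^\vee$ for some integer $k$, and any $i\in I$ with $\beta_i=\beta$, one has $N_i(\gamma)=N_i(\alpha)+kN_i(\beta)$.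 Here, for $\alpha\in\Phi^+$, $N_i(\alpha)=\#\{j<i\mid\beta_j=\alpha\}$ and $N_i(-\alpha)=1-N_i(\alpha)$. Admissible subsets. A finite (possibly empty) subset $J=\{j_1<\dots<j_l\}\subseteq I$ is admissible if $$1\lessdot s_{\beta_{j_1}}\lessdot s_{\beta_{j_1}}s_{\beta_{j_2}}\lessdot\cdots\lessdot s_{\beta_{j_1}}\cdots s_{\beta_{j_l}}.$$ With $k_i=\#\{j<i\mid\beta_j=\beta_i\}$, the weight of $J$ is $\mu(J)=s_{\beta_{j_1},k_{j_1}}\cdots s_{\beta_{j_l},k_{j_l}}(\lambda)$. *)

theory Defs
  imports "HOL-Analysis.Analysis"
begin

section \<open>Reflections and symmetrizable Kac--Moody root data\<close>

definition coroot :: "('v::real_vector \<Rightarrow> 'v \<Rightarrow> real) \<Rightarrow> 'v \<Rightarrow> 'v" where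
  "coroot form a = (2 / form a a) *\<^sub>R a"

definition root_refl :: "('v::real_vector \<Rightarrow> 'v \<Rightarrow> real) \<Rightarrow> 'v \<Rightarrow> 'v \<Rightarrow> 'v" where
  "root_refl form a v = v - form v (coroot form a) *\<^sub>R a"

definition aff_refl :: "('v::real_vector \<Rightarrow> 'v \<Rightarrow> real) \<Rightarrow> 'v \<Rightarrow> int \<Rightarrow> 'v \<Rightarrow> 'v" where
  "aff_refl form a k v = root_refl form a v + of_int k *\<^sub>R a"

text \<open>The space \<open>V\<close> is the whole type \<open>'v\<close>, and the simple roots are \<open>simple 1, \<dots>, simple r\<close>.
  The second family of inequalities says that the numbers \<open>\<langle>\<alpha>\<^sub>p, \<alpha>\<^sub>q\<^sup>\<or>\<rangle>\<close> form a symmetrizable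
  generalized Cartan matrix; every such matrix is allowed, of finite type or not.\<close>

locale symmetrizable_root_datum =
  fixes form :: "'v::real_vector \<Rightarrow> 'v \<Rightarrow> real"
    and r :: nat
    and simple :: "nat \<Rightarrow> 'v"
  assumes finite_dim: "\<exists>B::'v set. finite B \<and> span B = UNIV"
    and bilinear_form: "bilinear form"
    and form_sym: "form x y = form y x"
    and form_nondegenerate: "(\<And>y. form x y = 0) \<Longrightarrow> x = 0"
    and simple_inj: "inj_on simple {1..r}"
    and simple_independent: "independent (simple ` {1..r})"
    and simple_pos: "p \<in> {1..r} \<Longrightarrow> form (simple p) (simple p) > 0"
    and cartan_integer: "\<lbrakk>p \<in> {1..r}; q \<in> {1..r}; p \<noteq> q\<rbrakk> \<Longrightarrow>
      form (simple p) (coroot form (simple q)) \<in> \<int>"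
    and cartan_nonpos: "\<lbrakk>p \<in> {1..r}; q \<in> {1..r}; p \<noteq> q\<rbrakk> \<Longrightarrow>
      form (simple p) (coroot form (simple q)) \<le> 0"

section \<open>Weyl group, real roots, weights\<close>

text \<open>\<open>refl_prod form [b\<^sub>1, \<dots>, b\<^sub>l]\<close> is the product of the reflections in \<open>b\<^sub>1, \<dots>, b\<^sub>l\<close> in this
  order, that is, the map applying the reflection in \<open>b\<^sub>l\<close> first.\<close>

definition refl_prod :: "('v::real_vector \<Rightarrow> 'v \<Rightarrow> real) \<Rightarrow> 'v list \<Rightarrow> 'v \<Rightarrow> 'v" where
  "refl_prod form bs = foldr (\<lambda>b w. root_refl form b \<circ> w) bs id"

text \<open>The real roots are the Weyl group orbits of the simple roots, so the Weyl group is first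
  introduced through the simple reflections (which are involutions, whence no inverses are needed).
  That this is the group generated by the reflections in all real roots is
  \<open>weyl_group_eq_all_reflections\<close> below.\<close>

definition weyl_group ::
    "('v::real_vector \<Rightarrow> 'v \<Rightarrow> real) \<Rightarrow> nat \<Rightarrow> (nat \<Rightarrow> 'v) \<Rightarrow> ('v \<Rightarrow> 'v) set" where
  "weyl_group form r simple = {refl_prod form (map simple ps) | ps. set ps \<subseteq> {1..r}}"

definition weyl_length ::
    "('v::real_vector \<Rightarrow> 'v \<Rightarrow> real) \<Rightarrow> nat \<Rightarrow> (nat \<Rightarrow> 'v) \<Rightarrow> ('v \<Rightarrow> 'v) \<Rightarrow> nat" where
  "weyl_length form r simple w =
     (LEAST n. \<exists>ps. set ps \<subseteq> {1..r} \<and> length ps = n \<and> w = refl_prod form (map simple ps))"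

definition real_roots ::
    "('v::real_vector \<Rightarrow> 'v \<Rightarrow> real) \<Rightarrow> nat \<Rightarrow> (nat \<Rightarrow> 'v) \<Rightarrow> 'v set" where
  "real_roots form r simple = {w (simple p) | w p. w \<in> weyl_group form r simple \<and> p \<in> {1..r}}"

definition pos_roots ::
    "('v::real_vector \<Rightarrow> 'v \<Rightarrow> real) \<Rightarrow> nat \<Rightarrow> (nat \<Rightarrow> 'v) \<Rightarrow> 'v set" where
  "pos_roots form r simple = {a \<in> real_roots form r simple.
     \<exists>c. (\<forall>p\<in>{1..r}. c p \<ge> 0) \<and> a = (\<Sum>p\<in>{1..r}. c p *\<^sub>R simple p)}"

definition bruhat_cover ::
    "('v::real_vector \<Rightarrow> 'v \<Rightarrow> real) \<Rightarrow> nat \<Rightarrow> (nat \<Rightarrow> 'v) \<Rightarrow> ('v \<Rightarrow> 'v) \<Rightarrow> ('v \<Rightarrow> 'v) \<Rightarrow> bool" where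
  "bruhat_cover form r simple w u \<longleftrightarrow>
     w \<in> weyl_group form r simple \<and>
     (\<exists>a\<in>pos_roots form r simple. u = w \<circ> root_refl form a) \<and>
     weyl_length form r simple u = weyl_length form r simple w + 1"

definition weights ::
    "('v::real_vector \<Rightarrow> 'v \<Rightarrow> real) \<Rightarrow> nat \<Rightarrow> (nat \<Rightarrow> 'v) \<Rightarrow> 'v set" where
  "weights form r simple = {v. \<forall>p\<in>{1..r}. form v (coroot form (simple p)) \<in> \<int>}"

definition dominant ::
    "('v::real_vector \<Rightarrow> 'v \<Rightarrow> real) \<Rightarrow> nat \<Rightarrow> (nat \<Rightarrow> 'v) \<Rightarrow> 'v \<Rightarrow> bool" where
  "dominant form r simple v \<longleftrightarrow>
     v \<in> weights form r simple \<and> (\<forall>a\<in>pos_roots form r simple. form v (coroot form a) \<ge> 0)"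

section \<open>The ring of formal characters\<close>

text \<open>The formal sum \<open>\<Sum>\<^sub>\<nu> c\<^sub>\<nu> e\<^sup>\<nu>\<close> is represented by its coefficient function \<open>\<nu> \<mapsto> c\<^sub>\<nu>\<close>.\<close>

definition char_ring ::
    "('v::real_vector \<Rightarrow> 'v \<Rightarrow> real) \<Rightarrow> nat \<Rightarrow> (nat \<Rightarrow> 'v) \<Rightarrow> ('v \<Rightarrow> real) \<Rightarrow> ('v \<Rightarrow> int) set" where
  "char_ring form r simple ht =
     {f. (\<forall>\<nu>. f \<nu> \<noteq> 0 \<longrightarrow> \<nu> \<in> weights form r simple) \<and> (\<forall>h. finite {\<nu>. ht \<nu> > h \<and> f \<nu> \<noteq> 0})}"

text \<open>Extends \<open>e\<^sup>\<mu> e\<^sup>\<nu> = e\<^sup>\<mu>\<^sup>+\<^sup>\<nu>\<close>. For elements of the ring the index set of the sum is finite, because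
  both factors have supports of bounded height.\<close>

definition char_mult :: "('v::real_vector \<Rightarrow> int) \<Rightarrow> ('v \<Rightarrow> int) \<Rightarrow> 'v \<Rightarrow> int" where
  "char_mult f g \<nu> = (\<Sum>\<mu>\<in>{\<mu>. f \<mu> \<noteq> 0 \<and> g (\<nu> - \<mu>) \<noteq> 0}. f \<mu> * g (\<nu> - \<mu>))"

text \<open>\<open>a / b\<close> in the ring; used for a \<open>b\<close> with leading term \<open>e\<^sup>0\<close>, which is a unit.\<close>

definition char_divide ::
    "('v::real_vector \<Rightarrow> 'v \<Rightarrow> real) \<Rightarrow> nat \<Rightarrow> (nat \<Rightarrow> 'v) \<Rightarrow> ('v \<Rightarrow> real) \<Rightarrow>
     ('v \<Rightarrow> int) \<Rightarrow> ('v \<Rightarrow> int) \<Rightarrow> 'v \<Rightarrow> int" where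
  "char_divide form r simple ht a b = (THE f. f \<in> char_ring form r simple ht \<and> char_mult f b = a)"

text \<open>The possibly infinite sum \<open>\<Sum>\<^sub>x\<^sub>\<in>\<^sub>X c\<^sub>x e\<^bsup>m x\<^esup>\<close>. It is meaningful if the family is summable in the
  following sense, which makes every coefficient a finite sum and puts the total in the ring.\<close>

definition formal_sum :: "('x \<Rightarrow> int) \<Rightarrow> ('x \<Rightarrow> 'v) \<Rightarrow> 'x set \<Rightarrow> 'v \<Rightarrow> int" where
  "formal_sum c m X \<nu> = (\<Sum>x\<in>{x \<in> X. m x = \<nu>}. c x)"

definition formally_summable ::
    "('v::real_vector \<Rightarrow> 'v \<Rightarrow> real) \<Rightarrow> nat \<Rightarrow> (nat \<Rightarrow> 'v) \<Rightarrow> ('v \<Rightarrow> real) \<Rightarrow>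
     ('x \<Rightarrow> 'v) \<Rightarrow> 'x set \<Rightarrow> bool" where
  "formally_summable form r simple ht m X \<longleftrightarrow>
     (\<forall>x\<in>X. m x \<in> weights form r simple) \<and> (\<forall>h. finite {x \<in> X. ht (m x) > h})"

text \<open>Kac--Weyl character formula.\<close>

definition kac_weyl_alternant ::
    "('v::real_vector \<Rightarrow> 'v \<Rightarrow> real) \<Rightarrow> nat \<Rightarrow> (nat \<Rightarrow> 'v) \<Rightarrow> 'v \<Rightarrow> 'v \<Rightarrow> 'v \<Rightarrow> int" where
  "kac_weyl_alternant form r simple \<rho> v =
     formal_sum (\<lambda>w. (-1) ^ weyl_length form r simple w) (\<lambda>w. w v - \<rho>) (weyl_group form r simple)"

definition irr_character ::
    "('v::real_vector \<Rightarrow> 'v \<Rightarrow> real) \<Rightarrow> nat \<Rightarrow> (nat \<Rightarrow> 'v) \<Rightarrow> ('v \<Rightarrow> real) \<Rightarrow> 'v \<Rightarrow> 'v \<Rightarrow> 'v \<Rightarrow> int" where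
  "irr_character form r simple ht \<rho> lam =
     char_divide form r simple ht
       (kac_weyl_alternant form r simple \<rho> (lam + \<rho>))
       (kac_weyl_alternant form r simple \<rho> \<rho>)"

section \<open>\<open>\<lambda>\<close>-chains and admissible subsets\<close>

definition chain_count ::
    "('v::real_vector \<Rightarrow> 'v \<Rightarrow> real) \<Rightarrow> nat \<Rightarrow> (nat \<Rightarrow> 'v) \<Rightarrow>
     'i::linorder set \<Rightarrow> ('i \<Rightarrow> 'v) \<Rightarrow> 'i \<Rightarrow> 'v \<Rightarrow> int" where
  "chain_count form r simple I \<beta> i a =
     (if a \<in> pos_roots form r simple then int (card {j \<in> I. j < i \<and> \<beta> j = a})
      else 1 - int (card {j \<in> I. j < i \<and> \<beta> j = - a}))"

text \<open>Finiteness is required explicitly in the first condition because \<open>card\<close> of an infinite set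
  is 0.\<close>

definition lambda_chain ::
    "('v::real_vector \<Rightarrow> 'v \<Rightarrow> real) \<Rightarrow> nat \<Rightarrow> (nat \<Rightarrow> 'v) \<Rightarrow> 'v \<Rightarrow>
     'i::linorder set \<Rightarrow> ('i \<Rightarrow> 'v) \<Rightarrow> bool" where
  "lambda_chain form r simple lam I \<beta> \<longleftrightarrow>
     (\<forall>i\<in>I. \<beta> i \<in> pos_roots form r simple) \<and>
     (\<forall>a\<in>pos_roots form r simple.
        finite {i \<in> I. \<beta> i = a} \<and> real (card {i \<in> I. \<beta> i = a}) = form lam (coroot form a)) \<and>
     (\<forall>a\<in>real_roots form r simple. \<forall>b\<in>real_roots form r simple. \<forall>c\<in>real_roots form r simple.
      \<forall>k::int. \<forall>i\<in>I.
        a \<noteq> b \<and> a \<noteq> - b \<and> coroot form c = coroot form a + of_int k *\<^sub>R coroot form b \<and> \<beta> i = b \<longrightarrow>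
        chain_count form r simple I \<beta> i c =
          chain_count form r simple I \<beta> i a + k * chain_count form r simple I \<beta> i b)"

definition admissible ::
    "('v::real_vector \<Rightarrow> 'v \<Rightarrow> real) \<Rightarrow> nat \<Rightarrow> (nat \<Rightarrow> 'v) \<Rightarrow>
     'i::linorder set \<Rightarrow> ('i \<Rightarrow> 'v) \<Rightarrow> 'i set \<Rightarrow> bool" where
  "admissible form r simple I \<beta> J \<longleftrightarrow>
     finite J \<and> J \<subseteq> I \<and>
     (let js = sorted_list_of_set J in
      \<forall>m<length js. bruhat_cover form r simple
        (refl_prod form (map \<beta> (take m js))) (refl_prod form (map \<beta> (take (Suc m) js))))"

definition chain_level :: "'i::linorder set \<Rightarrow> ('i \<Rightarrow> 'v) \<Rightarrow> 'i \<Rightarrow> int" where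
  "chain_level I \<beta> i = int (card {j \<in> I. j < i \<and> \<beta> j = \<beta> i})"

definition subset_weight ::
    "('v::real_vector \<Rightarrow> 'v \<Rightarrow> real) \<Rightarrow> 'v \<Rightarrow>
     'i::linorder set \<Rightarrow> ('i \<Rightarrow> 'v) \<Rightarrow> 'i set \<Rightarrow> 'v" where
  "subset_weight form lam I \<beta> J =
     foldr (\<lambda>j. aff_refl form (\<beta> j) (chain_level I \<beta> j)) (sorted_list_of_set J) lam"

section \<open>Consistency with the usual descriptions\<close>

lemma refl_prod_Nil [simp]: "refl_prod form [] = id"
  and refl_prod_Cons [simp]: "refl_prod form (b # bs) = root_refl form b \<circ> refl_prod form bs"
  by (simp_all add: refl_prod_def)

lemma refl_prod_append: "refl_prod form (as @ bs) = refl_prod form as \<circ> refl_prod form bs"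
  by (induction as) (auto simp: o_assoc)

lemma char_mult_exp:
  fixes \<mu> \<nu> :: "'v::real_vector"
  shows "char_mult (\<lambda>x. if x = \<mu> then 1 else 0) (\<lambda>x. if x = \<nu> then 1 else 0)
    = (\<lambda>x. if x = \<mu> + \<nu> then 1 else 0)"
proof
  fix x
  have "{y. (if y = \<mu> then 1 else 0) \<noteq> (0::int) \<and> (if x - y = \<nu> then 1 else 0) \<noteq> (0::int)}
    = (if x = \<mu> + \<nu> then {\<mu>} else {})"
    by (auto simp: algebra_simps)
  then show "char_mult (\<lambda>x. if x = \<mu> then 1 else 0) (\<lambda>x. if x = \<nu> then 1 else 0) x
    = (if x = \<mu> + \<nu> then 1 else 0)"
    by (simp add: char_mult_def)
qed

lemma formal_sum_in_char_ring:
  assumes "formally_summable form r simple ht m X"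
  shows "formal_sum c m X \<in> char_ring form r simple ht"
proof -
  have *: "\<exists>x\<in>X. m x = \<nu>" if "formal_sum c m X \<nu> \<noteq> 0" for \<nu>
  proof (rule ccontr)
    assume "\<not> (\<exists>x\<in>X. m x = \<nu>)"
    then have empty: "{x \<in> X. m x = \<nu>} = {}" by blast
    show False using that unfolding formal_sum_def empty by simp
  qed
  have "finite {\<nu>. ht \<nu> > h \<and> formal_sum c m X \<nu> \<noteq> 0}" for h
  proof (rule finite_subset)
    show "{\<nu>. ht \<nu> > h \<and> formal_sum c m X \<nu> \<noteq> 0} \<subseteq> m ` {x \<in> X. ht (m x) > h}"
      using * by blast
    show "finite (m ` {x \<in> X. ht (m x) > h})"
      using assms by (simp add: formally_summable_def)
  qed
  then show ?thesis
    using * assms unfolding char_ring_def formally_summable_def by blast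
qed

context symmetrizable_root_datum
begin

lemma form_bilin:
  "form (x + y) z = form x z + form y z" "form x (y + z) = form x y + form x z"
  "form (x - y) z = form x z - form y z" "form x (y - z) = form x y - form x z"
  "form (c *\<^sub>R x) y = c * form x y" "form x (c *\<^sub>R y) = c * form x y"
  using bilinear_form
  by (simp_all add: bilinear_ladd bilinear_radd bilinear_lsub bilinear_rsub bilinear_lmul bilinear_rmul)

lemma form_coroot_self: "form a a \<noteq> 0 \<Longrightarrow> form a (coroot form a) = 2"
  by (simp add: coroot_def form_bilin)

lemma refl_involution:
  assumes "form a a \<noteq> 0"
  shows "root_refl form a (root_refl form a v) = v"
proof -
  have "form (root_refl form a v) (coroot form a) = - form v (coroot form a)"
    using form_coroot_self[OF assms] by (simp add: root_refl_def form_bilin)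
  then show ?thesis
    by (simp add: root_refl_def[of form a "root_refl form a v"]) (simp add: root_refl_def)
qed

lemma refl_isometry:
  assumes "form a a \<noteq> 0"
  shows "form (root_refl form a x) (root_refl form a y) = form x y"
proof -
  have *: "form v (coroot form a) = 2 / form a a * form v a" for v
    by (simp add: coroot_def form_bilin)
  have "form a y = form y a"
    by (rule form_sym)
  then show ?thesis
    using assms unfolding root_refl_def * form_bilin by (simp add: field_simps)
qed

lemma refl_diff_scale: "root_refl form a (x - c *\<^sub>R y) = root_refl form a x - c *\<^sub>R root_refl form a y"
  by (simp add: root_refl_def form_bilin algebra_simps)

lemma simple_nonisotropic: "p \<in> {1..r} \<Longrightarrow> form (simple p) (simple p) \<noteq> 0"
  using simple_pos by force

lemma id_in_weyl_group: "id \<in> weyl_group form r simple"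
  unfolding weyl_group_def by (force intro: exI[of _ "[]"])

lemma weyl_group_comp:
  assumes "w \<in> weyl_group form r simple" "u \<in> weyl_group form r simple"
  shows "w \<circ> u \<in> weyl_group form r simple"
proof -
  obtain ps qs where "set ps \<subseteq> {1..r}" "w = refl_prod form (map simple ps)"
      "set qs \<subseteq> {1..r}" "u = refl_prod form (map simple qs)"
    using assms unfolding weyl_group_def by blast
  then have "set (ps @ qs) \<subseteq> {1..r}" "w \<circ> u = refl_prod form (map simple (ps @ qs))"
    by (auto simp: refl_prod_append)
  then show ?thesis
    unfolding weyl_group_def by blast
qed

lemma simple_refl_in_weyl_group: "p \<in> {1..r} \<Longrightarrow> root_refl form (simple p) \<in> weyl_group form r simple"
  unfolding weyl_group_def by (force intro: exI[of _ "[p]"])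

lemma refl_image_eq_conj:
  assumes "set ps \<subseteq> {1..r}"
  shows "\<exists>u\<in>weyl_group form r simple.
    refl_prod form (map simple ps) \<circ> u = id \<and> u \<circ> refl_prod form (map simple ps) = id \<and>
    (\<forall>b. root_refl form (refl_prod form (map simple ps) b) = refl_prod form (map simple ps) \<circ> root_refl form b \<circ> u)"
  using assms
proof (induction ps)
  case Nil
  show ?case by (rule bexI[OF _ id_in_weyl_group]) simp
next
  case (Cons p ps)
  let ?s = "root_refl form (simple p)" and ?w = "refl_prod form (map simple ps)"
  obtain u where u: "u \<in> weyl_group form r simple" "?w \<circ> u = id" "u \<circ> ?w = id"
      "\<And>b. root_refl form (?w b) = ?w \<circ> root_refl form b \<circ> u"
    using Cons.IH Cons.prems by (metis insert_subset list.simps(15))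
  have p: "p \<in> {1..r}" using Cons.prems by simp
  note ni = simple_nonisotropic[OF p]
  have conj: "root_refl form (?s b) = ?s \<circ> root_refl form b \<circ> ?s" for b
  proof
    fix v
    have eq: "form v (coroot form (?s b)) = form (?s v) (coroot form b)"
      using refl_isometry[OF ni, of "?s v" b] refl_isometry[OF ni, of b b]
      by (simp add: coroot_def form_bilin refl_involution[OF ni])
    show "root_refl form (?s b) v = (?s \<circ> root_refl form b \<circ> ?s) v"
      using eq by (simp add: root_refl_def[of form "?s b"] root_refl_def[of form b] refl_diff_scale
          refl_involution[OF ni])
  qed
  have ss: "?s \<circ> ?s = id"
    by (auto simp: refl_involution[OF ni])
  show ?case
  proof (intro bexI[of _ "u \<circ> ?s"] conjI allI)
    show "u \<circ> ?s \<in> weyl_group form r simple"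
      by (intro weyl_group_comp u simple_refl_in_weyl_group p)
    show "refl_prod form (map simple (p # ps)) \<circ> (u \<circ> ?s) = id"
      using u(2) ss by (simp add: fun_eq_iff)
    show "(u \<circ> ?s) \<circ> refl_prod form (map simple (p # ps)) = id"
      using u(3) ss by (simp add: fun_eq_iff)
    show "root_refl form (refl_prod form (map simple (p # ps)) b) =
        refl_prod form (map simple (p # ps)) \<circ> root_refl form b \<circ> (u \<circ> ?s)" for b
      using u(4) conj by (simp add: o_assoc)
  qed
qed

lemma weyl_group_inverse:
  assumes "w \<in> weyl_group form r simple"
  shows "\<exists>u\<in>weyl_group form r simple. w \<circ> u = id \<and> u \<circ> w = id"
  using assms refl_image_eq_conj unfolding weyl_group_def by blast

lemma refl_in_weyl_group:
  assumes "a \<in> real_roots form r simple"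
  shows "root_refl form a \<in> weyl_group form r simple"
proof -
  obtain ps p where *: "a = refl_prod form (map simple ps) (simple p)" "set ps \<subseteq> {1..r}" "p \<in> {1..r}"
    using assms unfolding real_roots_def weyl_group_def by blast
  then have "refl_prod form (map simple ps) \<in> weyl_group form r simple"
    unfolding weyl_group_def by blast
  then show ?thesis
    using refl_image_eq_conj[OF *(2)] * simple_refl_in_weyl_group weyl_group_comp by metis
qed

lemma simple_in_real_roots: "p \<in> {1..r} \<Longrightarrow> simple p \<in> real_roots form r simple"
  unfolding real_roots_def using id_in_weyl_group id_apply by (metis (mono_tags, lifting) mem_Collect_eq)

theorem weyl_group_eq_all_reflections:
  "weyl_group form r simple = {refl_prod form bs | bs. set bs \<subseteq> real_roots form r simple}"
proof (intro equalityI subsetI)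
  fix w assume "w \<in> weyl_group form r simple"
  then obtain ps where "set ps \<subseteq> {1..r}" "w = refl_prod form (map simple ps)"
    unfolding weyl_group_def by blast
  then show "w \<in> {refl_prod form bs | bs. set bs \<subseteq> real_roots form r simple}"
    using simple_in_real_roots by (force intro!: exI[of _ "map simple ps"])
next
  fix w assume "w \<in> {refl_prod form bs | bs. set bs \<subseteq> real_roots form r simple}"
  then obtain bs where "set bs \<subseteq> real_roots form r simple" "w = refl_prod form bs" by blast
  then show "w \<in> weyl_group form r simple"
  proof (induction bs arbitrary: w)
    case Nil
    then show ?case using id_in_weyl_group by (simp only: refl_prod_Nil)
  next
    case (Cons b bs)
    have "root_refl form b \<in> weyl_group form r simple"
      using Cons.prems(1) by (intro refl_in_weyl_group) simp
    moreover have "refl_prod form bs \<in> weyl_group form r simple"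
      using Cons.prems(1) by (intro Cons.IH) simp_all
    ultimately show ?case
      using weyl_group_comp unfolding Cons.prems(2) refl_prod_Cons by blast
  qed
qed

end

end

(*
  Fix a simple root a = \<alpha>\<^sub>p and follow an admissible subset J along the chain. The folded path crosses
  or touches hyperplanes of a only at its events, the indices i whose root is sent to a or -a by the
  product of the earlier reflections in J. By the lifting property of the Bruhat order the path
  changes from moving up to moving down in the direction of a only by folding at an event, while a
  change from down to up (a turn) happens at other folds. Hence the turns cut the events into
  segments with exactly one fold each, except that the last segment may have none, and moving the
  fold within its segment keeps J admissible. By the chain condition the weight of J depends on the
  numbers of events before and after the fold in every segment.

  Reversing all segments, with an additional event at the end of the path, is an involution that
  reflects weights by s\<^sub>p, so the sum over J is W-invariant. Reversing them without the additional
  event, for paths that end moving down, is an involution that keeps the final Weyl group element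
  and acts on weights by the dot action of s\<^sub>p. Every nonempty J ends moving down for some p, which
  can be chosen by the final element; so in the product with the Weyl denominator all contributions
  cancel except those of the empty set.
*)
theory Submission
  imports Defs "HOL-Library.Extended"
begin

text \<open>At an event the current linear part sends the root to +-\<alpha>_p, so folding there
  multiplies that linear part by s_p on the left. Moving such a fold thus replaces the path, for a
  while, by its mirror image under s_p. Mirroring keeps events, and it keeps a cover whose two
  elements lie on the same side of \<alpha>_p. At a turn the old and the new path have both made the
  fold of their segment and coincide; hence the segments can be reversed independently.

  The chain condition says that the count \<open>N\<close> is compatible with folding. Therefore the
  pairing of the final weight with the coroot of \<alpha>_p is the signed number of unfolded events,
  minus 1 if the path ends on the negative side. This 1 is what separates the two involutions: it is
  either the sign of the additional event at the end, or the number <\<rho>, \<alpha>_p^v> = 1 that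
  turns s_p into its dot action.

  The group and the chain may be infinite, and the order of the chain need not have successors. So
  inductions run over the finitely many folds before a given time, and sums are controlled by
  heights: every fold lowers the height of the weight by at least 1.\<close>

declare One_nat_def [simp del]

section \<open>The Weyl group as a Coxeter group: lengths, positive roots, Bruhat covers\<close>

context symmetrizable_root_datum
begin

abbreviation W where "W \<equiv> weyl_group form r simple"
abbreviation len where "len \<equiv> weyl_length form r simple"
abbreviation roots where "roots \<equiv> real_roots form r simple"
abbreviation proots where "proots \<equiv> pos_roots form r simple"
abbreviation pair where "pair v a \<equiv> form v (coroot form a)"
abbreviation refl where "refl \<equiv> root_refl form"
abbreviation srefl where "srefl p \<equiv> root_refl form (simple p)"
abbreviation wd where "wd ps \<equiv> refl_prod form (map simple ps)"

subsection \<open>Linear maps preserving the form\<close>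

lemma form_zero [simp]: "form 0 x = 0" "form x 0 = 0"
  using form_bilin(5)[of 0 x x] form_bilin(6)[of x 0 x] by simp_all

lemma form_minus: "form (- x) y = - form x y" "form x (- y) = - form x y"
  using form_bilin(5)[of "-1" x y] form_bilin(6)[of x "-1" y] by simp_all

lemma form_sum: "form (\<Sum>i\<in>A. f i) y = (\<Sum>i\<in>A. form (f i) y)"
  by (induction A rule: infinite_finite_induct) (auto simp: form_bilin)

lemma coroot_minus: "coroot form (- a) = - coroot form a"
  by (simp add: coroot_def form_minus)

lemma pair_minus: "pair v (- a) = - pair v a"
  by (simp add: coroot_minus form_minus)

lemma refl_minus_root: "refl (- a) = refl a"
  by (simp add: fun_eq_iff root_refl_def pair_minus)

lemma refl_linear: "linear (refl a)"
  by (rule linearI) (simp_all add: root_refl_def form_bilin algebra_simps)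

lemma W_linear: "w \<in> W \<Longrightarrow> linear w"
proof -
  assume "w \<in> W"
  then obtain ps where w: "w = wd ps" by (auto simp: weyl_group_def)
  show "linear w" unfolding w
  proof (induction ps)
    case Nil then show ?case by (simp add: linear_ident id_def)
  next
    case (Cons p ps)
    then have "linear (srefl p \<circ> wd ps)" by (intro linear_compose refl_linear)
    then show ?case unfolding list.map refl_prod_Cons .
  qed
qed

lemma W_isometry: "w \<in> W \<Longrightarrow> form (w x) (w y) = form x y"
proof -
  assume "w \<in> W"
  then obtain ps where w: "w = wd ps" "set ps \<subseteq> {1..r}" by (auto simp: weyl_group_def)
  show ?thesis using w(2) unfolding w(1)
    by (induction ps) (auto simp: refl_isometry simple_nonisotropic)
qed

lemma pair_W: "w \<in> W \<Longrightarrow> pair (w x) (w y) = pair x y"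
  by (simp add: coroot_def form_bilin W_isometry)

lemma coroot_W: "w \<in> W \<Longrightarrow> coroot form (w a) = w (coroot form a)"
  by (simp add: coroot_def W_isometry W_linear linear_scale)

lemma refl_W: "w \<in> W \<Longrightarrow> refl (w a) (w v) = w (refl a v)"
  by (simp add: root_refl_def pair_W W_linear linear_diff linear_scale)

lemma refl_W_comp: "w \<in> W \<Longrightarrow> refl (w a) \<circ> w = w \<circ> refl a"
  by (simp add: fun_eq_iff refl_W)

lemma bij_W: "w \<in> W \<Longrightarrow> bij w"
  using weyl_group_inverse o_bij by metis

lemma inv_W: "w \<in> W \<Longrightarrow> inv w \<in> W"
  using weyl_group_inverse inv_unique_comp by metis

lemma inv_W_inv: "w \<in> W \<Longrightarrow> inv (inv w) = w"
  using bij_W inv_inv_eq by blast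

lemma W_inv_app [simp]: "w \<in> W \<Longrightarrow> inv w (w x) = x" "w \<in> W \<Longrightarrow> w (inv w x) = x"
  using bij_W by (auto simp: bij_def surj_f_inv_f)

lemma W_inj: "w \<in> W \<Longrightarrow> w x = w y \<longleftrightarrow> x = y"
  using W_inv_app(1) by metis

lemma root_not_isotropic: "a \<in> roots \<Longrightarrow> form a a > 0"
  using W_isometry simple_pos by (auto simp: real_roots_def)

lemma root_nonzero: "a \<in> roots \<Longrightarrow> a \<noteq> 0"
  using root_not_isotropic by force

lemma pair_self [simp]: "a \<in> roots \<Longrightarrow> pair a a = 2"
  using root_not_isotropic form_coroot_self by force

lemma refl_self [simp]: "a \<in> roots \<Longrightarrow> refl a a = - a"
  by (simp add: root_refl_def algebra_simps scaleR_2)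

lemma refl_refl [simp]: "a \<in> roots \<Longrightarrow> refl a (refl a v) = v"
  using root_not_isotropic refl_involution by force

lemma refl_refl_comp [simp]: "a \<in> roots \<Longrightarrow> refl a \<circ> refl a = id"
  by (simp add: fun_eq_iff)

lemma W_roots: "w \<in> W \<Longrightarrow> a \<in> roots \<Longrightarrow> w a \<in> roots"
proof -
  assume w: "w \<in> W" and "a \<in> roots"
  then obtain u p where "u \<in> W" "p \<in> {1..r}" "a = u (simple p)" by (auto simp: real_roots_def)
  then have "w \<circ> u \<in> W" "w a = (w \<circ> u) (simple p)" using w weyl_group_comp by auto
  then show ?thesis using \<open>p \<in> {1..r}\<close> unfolding real_roots_def by blast
qed

lemma uminus_roots: "a \<in> roots \<Longrightarrow> - a \<in> roots"
  using W_roots[OF refl_in_weyl_group, of a a] by simp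

lemma W_uminus: "w \<in> W \<Longrightarrow> w (- x) = - w x"
  by (simp add: W_linear linear_neg)

lemma wd_in_W: "set ps \<subseteq> {1..r} \<Longrightarrow> wd ps \<in> W"
  unfolding weyl_group_def by blast

lemma srefl_srefl [simp]:
  "p \<in> {1..r} \<Longrightarrow> srefl p (srefl p v) = v" "p \<in> {1..r} \<Longrightarrow> srefl p \<circ> srefl p = id"
  using refl_refl[OF simple_in_real_roots] refl_refl_comp[OF simple_in_real_roots] by blast+

subsection \<open>Coordinates with respect to the simple roots\<close>

text \<open>The simple roots need not span \<open>V\<close>, so a dual basis is determined only on
  their span. Any linear extension serves, since signs and integrality are read off on
  \<open>rspan\<close>.\<close>

definition coord :: "nat \<Rightarrow> 'v \<Rightarrow> real" where
  "coord p = (SOME g. linear g \<and> (\<forall>q\<in>{1..r}. g (simple q) = (if q = p then 1 else 0)))"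

lemma coord_spec:
  assumes "p \<in> {1..r}"
  shows "linear (coord p) \<and> (\<forall>q\<in>{1..r}. coord p (simple q) = (if q = p then 1 else 0))"
proof -
  obtain g :: "'v \<Rightarrow> real" where "linear g"
      "\<forall>x\<in>simple ` {1..r}. g x = (if x = simple p then 1 else 0)"
    using linear_independent_extend[OF simple_independent, of "\<lambda>x. if x = simple p then 1 else 0"] by blast
  then have "linear g \<and> (\<forall>q\<in>{1..r}. g (simple q) = (if q = p then 1 else 0))"
    using simple_inj assms by (simp add: inj_on_eq_iff)
  then show ?thesis unfolding coord_def by (rule someI[where P = "\<lambda>g. linear g \<and> (\<forall>q\<in>{1..r}. g (simple q) = (if q = p then 1 else 0))"])
qed

lemma coord_simple: "p \<in> {1..r} \<Longrightarrow> q \<in> {1..r} \<Longrightarrow> coord p (simple q) = (if q = p then 1 else 0)"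
  and coord_linear: "p \<in> {1..r} \<Longrightarrow> linear (coord p)"
  using coord_spec by auto

lemma coord_bilin:
  assumes "p \<in> {1..r}"
  shows "coord p (x + y) = coord p x + coord p y" "coord p (x - y) = coord p x - coord p y"
    "coord p (c *\<^sub>R x) = c * coord p x" "coord p (- x) = - coord p x" "coord p 0 = 0"
  using coord_linear[OF assms] by (simp_all add: linear_add linear_diff linear_scale linear_neg linear_0)

lemma coord_sum:
  assumes "q \<in> {1..r}"
  shows "coord q (\<Sum>p\<in>{1..r}. c p *\<^sub>R simple p) = c q"
proof -
  have "coord q (\<Sum>p\<in>{1..r}. c p *\<^sub>R simple p) = (\<Sum>p\<in>{1..r}. c p * coord q (simple p))"
    by (simp add: linear_sum[OF coord_linear[OF assms]] coord_bilin[OF assms])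
  also have "\<dots> = (\<Sum>p\<in>{1..r}. if p = q then c p else 0)"
    by (rule sum.cong) (auto simp: coord_simple[OF assms])
  also have "\<dots> = c q" using assms by simp
  finally show ?thesis .
qed

definition rspan :: "'v set" where
  "rspan = {v. v = (\<Sum>p\<in>{1..r}. coord p v *\<^sub>R simple p)}"

lemma rspan_sum: "(\<Sum>p\<in>{1..r}. c p *\<^sub>R simple p) \<in> rspan"
  unfolding rspan_def by (auto simp: coord_sum intro!: sum.cong)

lemma rspanD: "v \<in> rspan \<Longrightarrow> v = (\<Sum>p\<in>{1..r}. coord p v *\<^sub>R simple p)"
  by (simp add: rspan_def)

lemma rspan_eqI: "x \<in> rspan \<Longrightarrow> y \<in> rspan \<Longrightarrow> (\<And>p. p \<in> {1..r} \<Longrightarrow> coord p x = coord p y) \<Longrightarrow> x = y"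
proof -
  assume a: "x \<in> rspan" "y \<in> rspan" "\<And>p. p \<in> {1..r} \<Longrightarrow> coord p x = coord p y"
  have "(\<Sum>p\<in>{1..r}. coord p x *\<^sub>R simple p) = (\<Sum>p\<in>{1..r}. coord p y *\<^sub>R simple p)"
    by (rule sum.cong) (simp_all add: a(3))
  then show "x = y" using rspanD[OF a(1)] rspanD[OF a(2)] by metis
qed

lemma rspan_scale: "x \<in> rspan \<Longrightarrow> c *\<^sub>R x \<in> rspan"
proof -
  assume "x \<in> rspan"
  then have "c *\<^sub>R x = c *\<^sub>R (\<Sum>p\<in>{1..r}. coord p x *\<^sub>R simple p)"
    using rspanD by metis
  also have "\<dots> = (\<Sum>p\<in>{1..r}. (c * coord p x) *\<^sub>R simple p)"
    by (simp add: scaleR_sum_right)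
  finally show ?thesis by (simp add: rspan_sum)
qed

lemma rspan_add: "x \<in> rspan \<Longrightarrow> y \<in> rspan \<Longrightarrow> x + y \<in> rspan"
proof -
  assume "x \<in> rspan" "y \<in> rspan"
  then have "x + y = (\<Sum>p\<in>{1..r}. coord p x *\<^sub>R simple p) + (\<Sum>p\<in>{1..r}. coord p y *\<^sub>R simple p)"
    by (intro arg_cong2[where f = "(+)"] rspanD)
  also have "\<dots> = (\<Sum>p\<in>{1..r}. (coord p x + coord p y) *\<^sub>R simple p)"
    by (simp add: scaleR_add_left sum.distrib)
  finally show ?thesis by (simp add: rspan_sum)
qed

lemma rspan_diff: "x \<in> rspan \<Longrightarrow> y \<in> rspan \<Longrightarrow> x - y \<in> rspan"
  using rspan_add[of x "(-1) *\<^sub>R y"] rspan_scale[of y "-1"] by simp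

lemma rspan_simple: "p \<in> {1..r} \<Longrightarrow> simple p \<in> rspan"
proof -
  assume p: "p \<in> {1..r}"
  have "(\<Sum>q\<in>{1..r}. (if q = p then 1 else 0) *\<^sub>R simple q) = (\<Sum>q\<in>{1..r}. if q = p then simple q else 0)"
    by (rule sum.cong) auto
  also have "\<dots> = simple p" using p by simp
  finally show ?thesis using rspan_sum by metis
qed

definition nonneg :: "'v \<Rightarrow> bool" where
  "nonneg v \<longleftrightarrow> v \<in> rspan \<and> (\<forall>p\<in>{1..r}. coord p v \<ge> 0)"

lemma proots_iff: "a \<in> proots \<longleftrightarrow> a \<in> roots \<and> nonneg a"
proof
  assume "a \<in> proots"
  then obtain c where "a \<in> roots" "\<forall>p\<in>{1..r}. c p \<ge> 0" "a = (\<Sum>p\<in>{1..r}. c p *\<^sub>R simple p)"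
    by (auto simp: pos_roots_def)
  then show "a \<in> roots \<and> nonneg a" unfolding nonneg_def using rspan_sum coord_sum by auto
next
  assume "a \<in> roots \<and> nonneg a"
  then have "a \<in> roots \<and> (\<forall>p\<in>{1..r}. coord p a \<ge> 0) \<and> a = (\<Sum>p\<in>{1..r}. coord p a *\<^sub>R simple p)"
    using rspanD unfolding nonneg_def by metis
  then show "a \<in> proots" unfolding pos_roots_def by (intro CollectI) metis
qed

lemma nonneg_add: "nonneg x \<Longrightarrow> nonneg y \<Longrightarrow> nonneg (x + y)"
  by (auto simp: nonneg_def rspan_add coord_bilin)

lemma nonneg_scale: "nonneg x \<Longrightarrow> c \<ge> 0 \<Longrightarrow> nonneg (c *\<^sub>R x)"
  by (auto simp: nonneg_def rspan_scale coord_bilin)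

lemma nonneg_antisym: "nonneg x \<Longrightarrow> nonneg (- x) \<Longrightarrow> x = 0"
proof -
  assume a: "nonneg x" "nonneg (- x)"
  have "0 \<in> rspan" using rspan_scale[of x 0] a by (auto simp: nonneg_def)
  moreover have "coord p x = 0" if "p \<in> {1..r}" for p
    using a that by (force simp: nonneg_def coord_bilin)
  ultimately show "x = 0" using a by (intro rspan_eqI) (auto simp: nonneg_def coord_bilin)
qed

lemma nonneg_simple: "p \<in> {1..r} \<Longrightarrow> nonneg (simple p)"
  by (auto simp: nonneg_def rspan_simple coord_simple)

text \<open>The root lattice. Integral coordinates exclude proper multiples of simple roots, give
  every positive root height at least 1, and leave finitely many positive roots below a given
  height.\<close>

definition lattice :: "'v set" where
  "lattice = {v \<in> rspan. \<forall>p\<in>{1..r}. coord p v \<in> \<int>}"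

lemma pair_simple_Ints: "p \<in> {1..r} \<Longrightarrow> q \<in> {1..r} \<Longrightarrow> pair (simple p) (simple q) \<in> \<int>"
  using cartan_integer pair_self[OF simple_in_real_roots] by (cases "p = q") auto

lemma pair_lattice_simple: "v \<in> lattice \<Longrightarrow> q \<in> {1..r} \<Longrightarrow> pair v (simple q) \<in> \<int>"
proof -
  assume v: "v \<in> lattice" and q: "q \<in> {1..r}"
  have "pair v (simple q) = pair (\<Sum>p\<in>{1..r}. coord p v *\<^sub>R simple p) (simple q)"
    using v by (intro arg_cong2[where f = form] rspanD) (auto simp: lattice_def)
  also have "\<dots> = (\<Sum>p\<in>{1..r}. coord p v * pair (simple p) (simple q))"
    by (simp add: form_sum form_bilin)
  also have "\<dots> \<in> \<int>" using v q by (intro Ints_sum Ints_mult pair_simple_Ints) (auto simp: lattice_def)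
  finally show ?thesis .
qed

lemma coord_srefl:
  "q \<in> {1..r} \<Longrightarrow> p \<in> {1..r} \<Longrightarrow> coord q (srefl p v) = coord q v - (if p = q then pair v (simple p) else 0)"
  by (simp add: root_refl_def coord_bilin coord_simple)

lemma rspan_srefl: "p \<in> {1..r} \<Longrightarrow> v \<in> rspan \<Longrightarrow> srefl p v \<in> rspan"
  by (simp add: root_refl_def rspan_diff rspan_scale rspan_simple)

lemma W_lattice: "w \<in> W \<Longrightarrow> v \<in> lattice \<Longrightarrow> w v \<in> lattice"
proof -
  assume "w \<in> W" and v: "v \<in> lattice"
  then obtain ps where w: "w = wd ps" "set ps \<subseteq> {1..r}" by (auto simp: weyl_group_def)
  show ?thesis using w(2) unfolding w(1)
  proof (induction ps)
    case Nil then show ?case using v by simp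
  next
    case (Cons p ps)
    then have "wd ps v \<in> lattice" "p \<in> {1..r}" by auto
    then show ?case using pair_lattice_simple[of "wd ps v" p]
      by (auto simp: lattice_def rspan_srefl coord_srefl)
  qed
qed

lemma roots_lattice: "a \<in> roots \<Longrightarrow> a \<in> lattice"
proof -
  assume "a \<in> roots"
  then obtain w p where *: "w \<in> W" "p \<in> {1..r}" "a = w (simple p)" by (auto simp: real_roots_def)
  have "simple p \<in> lattice" using * by (auto simp: lattice_def rspan_simple coord_simple)
  then show ?thesis using * W_lattice by simp
qed

lemma pair_roots_Ints: "a \<in> roots \<Longrightarrow> b \<in> roots \<Longrightarrow> pair a b \<in> \<int>"
proof -
  assume a: "a \<in> roots" and "b \<in> roots"
  then obtain w p where *: "w \<in> W" "p \<in> {1..r}" "b = w (simple p)" by (auto simp: real_roots_def)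
  have "pair a b = pair (w (inv w a)) (w (simple p))" using * by simp
  also have "\<dots> = pair (inv w a) (simple p)" by (rule pair_W[OF *(1)])
  also have "\<dots> \<in> \<int>" by (rule pair_lattice_simple[OF W_lattice[OF inv_W[OF *(1)] roots_lattice[OF a]] *(2)])
  finally show ?thesis .
qed

text \<open>The coefficient c is an integer, and pulling back by \<open>inv w\<close> exhibits 1 as
  c times an integer coordinate of a root.\<close>

lemma roots_multiple_simple:
  assumes "c *\<^sub>R simple p \<in> roots" "p \<in> {1..r}"
  shows "c = 1 \<or> c = -1"
proof -
  obtain w q where *: "w \<in> W" "q \<in> {1..r}" "c *\<^sub>R simple p = w (simple q)"
    using assms(1) by (auto simp: real_roots_def)
  have c: "c \<in> \<int>" using roots_lattice[OF assms(1)] assms(2)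
    by (simp add: lattice_def coord_bilin coord_simple split: if_splits)
  have "simple q = inv w (c *\<^sub>R simple p)" by (simp only: *(3) W_inv_app[OF *(1)])
  also have "\<dots> = c *\<^sub>R inv w (simple p)" using *(1) by (simp add: W_linear inv_W linear_scale)
  finally have eq1: "1 = c * coord q (inv w (simple p))"
    using *(2) coord_simple[of q q] by (simp add: coord_bilin)
  have "coord q (inv w (simple p)) \<in> \<int>"
    using W_roots[OF inv_W[OF *(1)] simple_in_real_roots[OF assms(2)]] roots_lattice *(2)
    by (auto simp: lattice_def)
  then obtain m where m: "coord q (inv w (simple p)) = of_int m" by (metis Ints_cases)
  moreover obtain n where n: "c = of_int n" using c by (metis Ints_cases)
  ultimately have "real_of_int 1 = of_int (n * m)" using eq1 by simp
  then have "n * m = 1" using of_int_eq_iff by metis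
  then show ?thesis using zmult_eq_1_iff n by auto
qed

subsection \<open>Length\<close>

lemma len_wd_le: "set ps \<subseteq> {1..r} \<Longrightarrow> len (wd ps) \<le> length ps"
  unfolding weyl_length_def by (rule Least_le) blast

lemma reduced_word:
  assumes "w \<in> W"
  obtains ps where "set ps \<subseteq> {1..r}" "length ps = len w" "w = wd ps"
proof -
  have "\<exists>n ps. set ps \<subseteq> {1..r} \<and> length ps = n \<and> w = wd ps" using assms by (auto simp: weyl_group_def)
  from LeastI_ex[OF this] show ?thesis using that unfolding weyl_length_def by blast
qed

lemma len_comp: "w \<in> W \<Longrightarrow> u \<in> W \<Longrightarrow> len (w \<circ> u) \<le> len w + len u"
proof -
  assume "w \<in> W" "u \<in> W"
  then obtain ps qs where *: "set ps \<subseteq> {1..r}" "length ps = len w" "w = wd ps"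
     "set qs \<subseteq> {1..r}" "length qs = len u" "u = wd qs" by (metis reduced_word)
  have "len (wd (ps @ qs)) \<le> length (ps @ qs)" using * by (intro len_wd_le) auto
  then show ?thesis using * by (simp add: refl_prod_append)
qed

lemma len_id [simp]: "len id = 0"
  using len_wd_le[of "[]"] by simp

lemma len_eq_0: "w \<in> W \<Longrightarrow> len w = 0 \<longleftrightarrow> w = id"
  by (metis len_id length_0_conv list.simps(8) reduced_word refl_prod_Nil)

lemma len_srefl_le: "p \<in> {1..r} \<Longrightarrow> len (srefl p) \<le> 1"
  using len_wd_le[of "[p]"] by simp

lemma srefl_right_cancel [simp]: "p \<in> {1..r} \<Longrightarrow> w \<circ> srefl p \<circ> srefl p = w"
  by (simp add: comp_assoc)

lemma srefl_left_cancel [simp]: "p \<in> {1..r} \<Longrightarrow> srefl p \<circ> (srefl p \<circ> w) = w"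
  by (simp flip: comp_assoc)

lemma len_right:
  assumes "p \<in> {1..r}" "w \<in> W"
  shows "len (w \<circ> srefl p) \<le> len w + 1" "len w \<le> len (w \<circ> srefl p) + 1"
proof -
  note s = simple_refl_in_weyl_group[OF assms(1)] len_srefl_le[OF assms(1)]
  show "len (w \<circ> srefl p) \<le> len w + 1" using len_comp[OF assms(2) s(1)] s(2) by linarith
  show "len w \<le> len (w \<circ> srefl p) + 1"
    using len_comp[OF weyl_group_comp[OF assms(2) s(1)] s(1)] s(2) assms(1) by simp
qed

lemma len_left:
  assumes "p \<in> {1..r}" "w \<in> W"
  shows "len (srefl p \<circ> w) \<le> len w + 1" "len w \<le> len (srefl p \<circ> w) + 1"
proof -
  note s = simple_refl_in_weyl_group[OF assms(1)] len_srefl_le[OF assms(1)]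
  show "len (srefl p \<circ> w) \<le> len w + 1" using len_comp[OF s(1) assms(2)] s(2) by linarith
  show "len w \<le> len (srefl p \<circ> w) + 1"
    using len_comp[OF s(1) weyl_group_comp[OF s(1) assms(2)]] s(2) assms(1) by simp
qed

end

context symmetrizable_root_datum
begin

subsection \<open>Rank two\<close>

text \<open>The swap of the arguments makes \<open>q\<close> the last letter, whatever the length.
  No trailing \<open>p\<close> then sends \<alpha>_p to -\<alpha>_p at the start.\<close>

fun altw :: "nat \<Rightarrow> nat \<Rightarrow> nat \<Rightarrow> nat list" where
  "altw p q 0 = []"
| "altw p q (Suc k) = altw q p k @ [q]"

lemma altw_Cons: "altw p q (Suc k) = (if even k then q else p) # altw p q k"
  by (induction k arbitrary: p q) auto

lemma length_altw [simp]: "length (altw p q k) = k"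
  by (induction k arbitrary: p q) auto

lemma set_altw: "set (altw p q k) \<subseteq> {p, q}"
  by (induction k arbitrary: p q) auto

lemma altw_add: "\<exists>xs. set xs \<subseteq> {p, q} \<and> altw p q (k + m) = xs @ altw p q m"
proof (induction m arbitrary: p q)
  case 0 then show ?case using set_altw by auto
next
  case (Suc m)
  then obtain xs where "set xs \<subseteq> {q, p}" "altw q p (k + m) = xs @ altw q p m" by blast
  then show ?case by (intro exI[of _ xs]) auto
qed

lemma alternating_word:
  "set xs \<subseteq> {p, q} \<Longrightarrow> distinct_adj xs \<Longrightarrow> (xs \<noteq> [] \<Longrightarrow> last xs = q) \<Longrightarrow> xs = altw p q (length xs)"
proof (induction xs arbitrary: p q rule: rev_induct)
  case Nil then show ?case by simp
next
  case (snoc x xs)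
  have "xs = altw q p (length xs)"
    using snoc.prems by (intro snoc.IH) (auto simp: distinct_adj_append_iff dest: last_in_set)
  then show ?case using snoc.prems(3) by simp
qed

lemma not_distinct_adj: "\<not> distinct_adj us \<Longrightarrow> \<exists>xs x ys. us = xs @ [x, x] @ ys"
proof (induction us rule: induct_list012)
  case (3 x y zs)
  show ?case
  proof (cases "x = y")
    case True then show ?thesis by (intro exI[of _ "[]"]) auto
  next
    case False
    then obtain xs z ys where "y # zs = xs @ [z, z] @ ys" using 3 by auto
    then show ?thesis by (intro exI[of _ "x # xs"]) auto
  qed
qed auto

lemma srefl_diff_diff:
  assumes "p \<in> {1..r}"
  shows "srefl p (v - c *\<^sub>R simple p - d *\<^sub>R b)
    = v - (pair v (simple p) - c - d * pair b (simple p)) *\<^sub>R simple p - d *\<^sub>R b"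
proof -
  have "srefl p (v - c *\<^sub>R simple p - d *\<^sub>R b)
    = v - d *\<^sub>R b - (c *\<^sub>R simple p + (pair v (simple p) - c * 2 - d * pair b (simple p)) *\<^sub>R simple p)"
    using assms by (simp add: root_refl_def form_bilin pair_self simple_in_real_roots)
  also have "c *\<^sub>R simple p + (pair v (simple p) - c * 2 - d * pair b (simple p)) *\<^sub>R simple p
    = (pair v (simple p) - c - d * pair b (simple p)) *\<^sub>R simple p"
    by (simp flip: scaleR_add_left)
  finally show ?thesis by (simp only: diff_diff_add add.commute)
qed

lemma srefl_diff_diff':
  "p \<in> {1..r} \<Longrightarrow> srefl p (v - d *\<^sub>R b - c *\<^sub>R simple p)
    = v - d *\<^sub>R b - (pair v (simple p) - c - d * pair b (simple p)) *\<^sub>R simple p"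
  using srefl_diff_diff[of p v c d b] by (simp only: diff_diff_add add.commute)

lemma srefl_comb:
  assumes "p \<in> {1..r}"
  shows "srefl p (x *\<^sub>R simple p + y *\<^sub>R b) = (- x - y * pair b (simple p)) *\<^sub>R simple p + y *\<^sub>R b"
    "srefl p (y *\<^sub>R b + x *\<^sub>R simple p) = y *\<^sub>R b + (- x - y * pair b (simple p)) *\<^sub>R simple p"
proof -
  show "srefl p (x *\<^sub>R simple p + y *\<^sub>R b) = (- x - y * pair b (simple p)) *\<^sub>R simple p + y *\<^sub>R b"
    using srefl_diff_diff[OF assms, of 0 "- x" "- y" b] by (simp only: form_zero) (simp add: algebra_simps)
  then show "srefl p (y *\<^sub>R b + x *\<^sub>R simple p) = y *\<^sub>R b + (- x - y * pair b (simple p)) *\<^sub>R simple p"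
    by (simp only: add.commute)
qed

lemma cartan_zero_sym:
  assumes "p \<in> {1..r}" "q \<in> {1..r}" "pair (simple p) (simple q) = 0"
  shows "pair (simple q) (simple p) = 0"
  using assms simple_nonisotropic form_sym[of "simple p" "simple q"] by (simp add: coroot_def form_bilin)

text \<open>The two entries are nonpositive integers that vanish together. A product below 4 leaves
  the finite dihedral types A1 x A1, A2, B2 and G2; from 4 on the two reflections generate an
  infinite dihedral group.\<close>

lemma cartan_cases:
  assumes "p \<in> {1..r}" "q \<in> {1..r}" "p \<noteq> q"
  obtains (fin) a b where "pair (simple q) (simple p) = - a" "pair (simple p) (simple q) = - b"
      "(a, b) \<in> {(0,0), (1,1), (1,2), (2,1), (1,3), (3,1)}"
  | (inf) a b where "pair (simple q) (simple p) = - a" "pair (simple p) (simple q) = - b"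
      "a > 0" "b > 0" "a * b \<ge> 4"
proof -
  obtain m where m: "pair (simple q) (simple p) = of_int m" using assms cartan_integer by (metis Ints_cases)
  obtain n where n: "pair (simple p) (simple q) = of_int n" using assms cartan_integer by (metis Ints_cases)
  have mn: "m \<le> 0" "n \<le> 0" using m n assms cartan_nonpos[of q p] cartan_nonpos[of p q] by auto
  have z: "m = 0 \<longleftrightarrow> n = 0" using cartan_zero_sym[of p q] cartan_zero_sym[of q p] assms m n by auto
  show ?thesis
  proof (cases "m = 0 \<or> m * n < 4")
    case True
    have "m > -4 \<and> n > -4" 
    proof (cases "m = 0")
      case False
      then have "m \<le> -1" "n \<le> -1" using z mn by auto
      then have "-m * 1 \<le> (-m) * (-n)" "1 * -n \<le> (-m) * (-n)" by (intro mult_mono; simp)+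
      then show ?thesis using True False by auto
    qed (use z in auto)
    then have "m \<in> {-3,-2,-1,0}" "n \<in> {-3,-2,-1,0}" using mn by auto
    then have "(m, n) \<in> {(0,0), (-1,-1), (-1,-2), (-2,-1), (-1,-3), (-3,-1)}"
      using True z by (elim insertE emptyE; simp)
    then have "(- real_of_int m, - real_of_int n) \<in> {(0,0), (1,1), (1,2), (2,1), (1,3), (3,1)}"
      by auto
    then show ?thesis using fin[of "- real_of_int m" "- real_of_int n"] m n by auto
  next
    case False
    then have "(- real_of_int m) * (- real_of_int n) \<ge> 4" by (simp flip: of_int_mult)
    then show ?thesis using inf[of "- real_of_int m" "- real_of_int n"] m n False mn z by auto
  qed
qed

text \<open>Coordinates of the image of \<alpha>_p under \<open>wd (altw p q k)\<close>. Growing the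
  word at its front applies s_q, which replaces y by bx - y, and s_p, which replaces x by ay - x, in
  turn.\<close>

fun dihedral_coords :: "real \<Rightarrow> real \<Rightarrow> nat \<Rightarrow> real \<times> real" where
  "dihedral_coords a b 0 = (1, 0)"
| "dihedral_coords a b (Suc k) =
    (let (x, y) = dihedral_coords a b k in if even k then (x, b * x - y) else (a * y - x, y))"

lemma wd_altw_simple:
  assumes "p \<in> {1..r}" "q \<in> {1..r}"
    and ab: "pair (simple q) (simple p) = - a" "pair (simple p) (simple q) = - b"
  shows "wd (altw p q k) (simple p) =
    fst (dihedral_coords a b k) *\<^sub>R simple p + snd (dihedral_coords a b k) *\<^sub>R simple q"
proof (induction k)
  case 0 then show ?case by simp
next
  case (Suc k)
  then show ?case using ab assms
    by (simp add: altw_Cons srefl_comb split_beta Let_def algebra_simps del: altw.simps)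
qed

text \<open>Nonnegativity alone is not inductive under y -> bx - y. The inequality bx >= 2y
  preserves it, and ab >= 4 yields the same inequality with the roles exchanged for the next
  step.\<close>

lemma dihedral_coords_inf:
  assumes ab: "a > 0" "b > 0" "a * b \<ge> 4"
  shows "fst (dihedral_coords a b k) \<ge> 0 \<and> snd (dihedral_coords a b k) \<ge> 0 \<and>
    (if even k then b * fst (dihedral_coords a b k) \<ge> 2 * snd (dihedral_coords a b k)
     else a * snd (dihedral_coords a b k) \<ge> 2 * fst (dihedral_coords a b k))"
proof (induction k)
  case 0
  show ?case using ab by auto
next
  case (Suc k)
  obtain x y where xy: "dihedral_coords a b k = (x, y)" by fastforce
  with Suc have h: "x \<ge> 0" "y \<ge> 0" "if even k then b * x \<ge> 2 * y else a * y \<ge> 2 * x" by auto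
  have 2: "4 * x \<le> (a * b) * x" "4 * y \<le> (a * b) * y" using h ab by (auto intro: mult_right_mono)
  show ?case
  proof (cases "even k")
    case True
    have "a * (2 * y) \<le> a * (b * x)" using True h ab by (intro mult_left_mono) auto
    then have "b * x - y \<ge> 0" "a * (b * x - y) \<ge> 2 * x"
      using 2 h True by (auto simp: algebra_simps)
    then show ?thesis using xy h True by simp
  next
    case False
    have "b * (2 * x) \<le> b * (a * y)" using False h ab by (intro mult_left_mono) auto
    then have "a * y - x \<ge> 0" "b * (a * y - x) \<ge> 2 * y"
      using 2 h False by (auto simp: algebra_simps)
    then show ?thesis using xy h False by simp
  qed
qed

text \<open>The order of s_p s_q in the finite types: 2, 3, 4 or 6. The numbers are spelled as
  successors so that the recursive functions unfold on them.\<close>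

definition cox :: "real \<times> real \<Rightarrow> nat" where
  "cox ab = (if ab = (0,0) then Suc (Suc 0) else if ab = (1,1) then Suc (Suc (Suc 0))
    else if ab \<in> {(1,2),(2,1)} then Suc (Suc (Suc (Suc 0))) else Suc (Suc (Suc (Suc (Suc (Suc 0))))))"

text \<open>Coefficients of \<alpha>_p and \<alpha>_q in the difference of v and its image, with X
  and Y the pairings of v with the two coroots. Keeping v arbitrary gives the braid relation on all
  of \<open>V\<close>, not merely on the plane of the two roots.\<close>

fun altw_diff :: "real \<Rightarrow> real \<Rightarrow> real \<Rightarrow> real \<Rightarrow> nat \<Rightarrow> real \<times> real" where
  "altw_diff a b X Y 0 = (0, 0)"
| "altw_diff a b X Y (Suc k) =
    (let (c, d) = altw_diff a b X Y k in if even k then (c, Y - d + c * b) else (X - c + d * a, d))"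

lemma wd_altw_diff:
  assumes "p \<in> {1..r}" "q \<in> {1..r}"
    and ab: "pair (simple q) (simple p) = - a" "pair (simple p) (simple q) = - b"
  shows "wd (altw p q k) v = v - fst (altw_diff a b (pair v (simple p)) (pair v (simple q)) k) *\<^sub>R simple p
    - snd (altw_diff a b (pair v (simple p)) (pair v (simple q)) k) *\<^sub>R simple q"
proof (induction k)
  case 0 then show ?case by simp
next
  case (Suc k)
  then show ?case using assms
    by (simp add: altw_Cons srefl_diff_diff srefl_diff_diff' split_beta Let_def del: altw.simps)
qed

lemma braid:
  assumes "p \<in> {1..r}" "q \<in> {1..r}" "p \<noteq> q"
    and ab: "pair (simple q) (simple p) = - a" "pair (simple p) (simple q) = - b"
      "(a, b) \<in> {(0,0), (1,1), (1,2), (2,1), (1,3), (3,1)}"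
  shows "wd (altw p q (cox (a, b))) = wd (altw q p (cox (a, b)))"
proof
  fix v
  have "fst (altw_diff a b X Y (cox (a, b))) = snd (altw_diff b a Y X (cox (a, b)))" for X Y
    using ab(3) by (elim insertE emptyE) (simp_all add: cox_def)
  moreover have "snd (altw_diff a b X Y (cox (a, b))) = fst (altw_diff b a Y X (cox (a, b)))" for X Y
    using ab(3) by (elim insertE emptyE) (simp_all add: cox_def)
  ultimately show "wd (altw p q (cox (a, b))) v = wd (altw q p (cox (a, b))) v"
    by (simp add: wd_altw_diff[OF assms(1,2) ab(1,2)] wd_altw_diff[OF assms(2,1) ab(2,1)] algebra_simps)
qed

lemma dihedral_coords_fin:
  assumes "(a, b) \<in> {(0,0), (1,1), (1,2), (2,1), (1,3), (3,1)}" "k < cox (a, b)"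
  shows "fst (dihedral_coords a b k) \<ge> 0 \<and> snd (dihedral_coords a b k) \<ge> 0"
  using assms by (elim insertE emptyE) (auto simp: cox_def less_Suc_eq)

text \<open>A shortest word in two letters alternates, and by \<open>noend\<close> it ends in q. In
  finite type a word of length \<open>cox (a, b)\<close> or more could be rewritten by the braid
  relation so as to end in p, so only the initial stretch with nonnegative coordinates is
  left.\<close>

lemma rank_two_nonneg:
  assumes pq: "p \<in> {1..r}" "q \<in> {1..r}" "p \<noteq> q"
    and us: "set us \<subseteq> {p, q}"
    and red: "\<And>vs. set vs \<subseteq> {p, q} \<Longrightarrow> wd vs = wd us \<Longrightarrow> length us \<le> length vs"
    and noend: "\<And>vs. set vs \<subseteq> {p, q} \<Longrightarrow> wd (vs @ [p]) = wd us \<Longrightarrow> length us \<le> length vs"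
  shows "\<exists>x y. x \<ge> 0 \<and> y \<ge> 0 \<and> wd us (simple p) = x *\<^sub>R simple p + y *\<^sub>R simple q"
proof -
  have "distinct_adj us"
  proof (rule ccontr)
    assume "\<not> distinct_adj us"
    then obtain xs x ys where d: "us = xs @ [x, x] @ ys" using not_distinct_adj by blast
    then have "x \<in> {1..r}" using us pq by auto
    then have "wd (xs @ ys) = wd us" by (simp add: d refl_prod_append)
    then show False using red[of "xs @ ys"] us d by auto
  qed
  moreover have "last us = q" if "us \<noteq> []"
  proof (rule ccontr)
    assume "last us \<noteq> q"
    then have "last us = p" using us last_in_set[OF that] by auto
    then have "us = butlast us @ [p]" using append_butlast_last_id[OF that] by simp
    then show False using noend[of "butlast us"] us that
      by (metis Suc_n_not_le_n append.right_neutral in_set_butlastD length_append_singleton subset_code(1))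
  qed
  ultimately have alt: "us = altw p q (length us)" using us alternating_word by blast
  show ?thesis using pq
  proof (cases rule: cartan_cases)
    case (fin a b)
    have "length us < cox (a, b)"
    proof (rule ccontr)
      assume "\<not> length us < cox (a, b)"
      then obtain k where k: "length us = k + cox (a, b)" by (metis add.commute le_iff_add not_less)
      obtain m where m: "cox (a, b) = Suc m" unfolding cox_def by (metis (full_types))
      obtain xs where xs: "set xs \<subseteq> {p, q}" "us = xs @ altw p q (Suc m)"
        using altw_add[of p q k "Suc m"] alt k m by metis
      have "wd ((xs @ altw p q m) @ [p]) = wd us"
        using braid[OF pq fin] unfolding m xs(2) by (simp add: refl_prod_append)
      then have "length us \<le> length (xs @ altw p q m)" using xs(1) set_altw[of p q m] by (intro noend) auto
      then show False using xs(2) by simp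
    qed
    then show ?thesis using dihedral_coords_fin[OF fin(3)] wd_altw_simple[OF pq(1,2) fin(1,2)] alt by metis
  next
    case (inf a b)
    then show ?thesis using dihedral_coords_inf[OF inf(3-5)] wd_altw_simple[OF pq(1,2) inf(1,2)] alt by metis
  qed
qed

subsection \<open>Length and positivity of roots\<close>

text \<open>Write \<open>w = v u\<close> with \<open>u\<close> a word in \<open>s\<^sub>p\<close> and a right descent \<open>s\<^sub>q\<close> of \<open>w\<close>, lengths adding up, and \<open>u\<close> as
  long as possible. Then \<open>v\<close> sends \<open>\<alpha>\<^sub>p\<close> and \<open>\<alpha>\<^sub>q\<close> to nonnegative vectors by induction, and \<open>u \<alpha>\<^sub>p\<close> is a
  nonnegative combination of the two by the analysis of rank two.\<close>

lemma nonneg_of_length: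
  assumes "w \<in> W" "p \<in> {1..r}" "len w \<le> len (w \<circ> srefl p)"
  shows "nonneg (w (simple p))"
  using assms
proof (induction "len w" arbitrary: w p rule: less_induct)
  case less
  show ?case
  proof (cases "w = id")
    case True then show ?thesis using less.prems nonneg_simple by simp
  next
    case False
    obtain ps where ps: "set ps \<subseteq> {1..r}" "length ps = len w" "w = wd ps"
      using reduced_word less.prems by blast
    have "ps \<noteq> []" using ps False by auto
    then obtain qs q where q: "ps = qs @ [q]" by (metis rev_exhaust)
    have qr: "q \<in> {1..r}" "set qs \<subseteq> {1..r}" using ps q by auto
    have "w \<circ> srefl q = wd qs" using ps(3) q qr by (simp add: refl_prod_append)
    then have wq: "len (w \<circ> srefl q) < len w" using len_wd_le[OF qr(2)] ps(2) q by simp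
    then have pq: "p \<noteq> q" using less.prems by auto
    have Vs: "wd us \<in> W" if "set us \<subseteq> {p, q}" for us
      using that qr less.prems by (intro wd_in_W) auto
    define P where "P k \<longleftrightarrow> (\<exists>v us. v \<in> W \<and> set us \<subseteq> {p, q} \<and> length us = k \<and> w = v \<circ> wd us \<and> len v + k = len w)" for k
    have "P 1"
    proof -
      have "len (w \<circ> srefl q) + 1 = len w" using wq len_right(2)[OF qr(1) less.prems(1)] by simp
      then show ?thesis unfolding P_def using qr less.prems weyl_group_comp simple_refl_in_weyl_group
        by (intro exI[of _ "w \<circ> srefl q"] exI[of _ "[q]"]) auto
    qed
    moreover have bound: "\<And>k. P k \<Longrightarrow> k \<le> len w" by (auto simp: P_def)
    ultimately obtain k where k: "P k" "\<And>k'. P k' \<Longrightarrow> k' \<le> k"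
      using Greatest_le_nat[of P _ "len w"] GreatestI_nat[of P 1 "len w"] by blast
    then have "k \<ge> 1" using \<open>P 1\<close> by blast
    obtain v us where v: "v \<in> W" "set us \<subseteq> {p, q}" "length us = k" "w = v \<circ> wd us" "len v + k = len w"
      using k(1) by (auto simp: P_def)
    \<comment> \<open>Maximality of k: a right descent of v in {p, q} could be moved into
      \<open>us\<close>.\<close>
    have up: "len v \<le> len (v \<circ> srefl x)" if "x \<in> {p, q}" for x
    proof (rule ccontr)
      assume c: "\<not> len v \<le> len (v \<circ> srefl x)"
      have x: "x \<in> {1..r}" using that qr less.prems by auto
      have "len (v \<circ> srefl x) + Suc k = len w" using c v(5) len_right(2)[OF x v(1)] by simp
      moreover have "w = (v \<circ> srefl x) \<circ> wd (x # us)"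
        using x v(4) by (simp add: comp_assoc)
      ultimately have "P (Suc k)" unfolding P_def
        using v that x weyl_group_comp simple_refl_in_weyl_group
        by (intro exI[of _ "v \<circ> srefl x"] exI[of _ "x # us"]) auto
      then show False using k(2) by force
    qed
    have vp: "nonneg (v (simple p))" "nonneg (v (simple q))"
      using less.hyps[of v] up v(1,5) \<open>k \<ge> 1\<close> less.prems qr by auto
    have "\<exists>x y. x \<ge> 0 \<and> y \<ge> 0 \<and> wd us (simple p) = x *\<^sub>R simple p + y *\<^sub>R simple q"
    proof (rule rank_two_nonneg[OF less.prems(2) qr(1) pq v(2)])
      fix vs assume vs: "set vs \<subseteq> {p, q}" 
      have le: "len (wd vs) \<le> length vs" using vs qr less.prems by (intro len_wd_le) auto
      { assume "wd vs = wd us"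
        then have "len w \<le> len v + length vs" using v(4) len_comp[OF v(1) Vs[OF vs]] le by simp
        then show "length us \<le> length vs" using v by simp }
      \<comment> \<open>A shorter \<open>vs\<close> would make w s_p shorter than w, against the
        hypothesis on p.\<close>
      { assume "wd (vs @ [p]) = wd us"
        then have "wd us \<circ> srefl p = wd vs \<circ> srefl p \<circ> srefl p" by (simp add: refl_prod_append)
        then have "w \<circ> srefl p = v \<circ> wd vs" using v(4) less.prems(2) by (simp add: comp_assoc)
        then have "len (w \<circ> srefl p) \<le> len v + length vs" using len_comp[OF v(1) Vs[OF vs]] le by simp
        then show "length us \<le> length vs" using v less.prems by simp }
    qed
    then obtain x y where "x \<ge> 0" "y \<ge> 0" "wd us (simple p) = x *\<^sub>R simple p + y *\<^sub>R simple q" by blast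
    then show ?thesis using vp v(1,4)
      by (simp add: W_linear linear_add linear_scale nonneg_add nonneg_scale)
  qed
qed

lemma srefl_in_W [simp]: "p \<in> {1..r} \<Longrightarrow> srefl p \<in> W"
  by (rule simple_refl_in_weyl_group)

lemma W_comp: "w \<in> W \<Longrightarrow> u \<in> W \<Longrightarrow> w \<circ> u \<in> W"
  by (rule weyl_group_comp)

text \<open>The second case is positivity applied to w s_p, which sends \<alpha>_p to -w \<alpha>_p.
  Equal lengths would make the nonzero vector w \<alpha>_p both nonnegative and nonpositive.\<close>

lemma length_right_cases:
  assumes "w \<in> W" "p \<in> {1..r}"
  obtains "len (w \<circ> srefl p) = len w + 1" "nonneg (w (simple p))"
  | "len w = len (w \<circ> srefl p) + 1" "nonneg (- w (simple p))"
proof -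
  note wp = W_comp[OF assms(1) srefl_in_W[OF assms(2)]]
  have eq: "(w \<circ> srefl p) (simple p) = - w (simple p)"
    using assms by (simp add: simple_in_real_roots W_uminus)
  have *: "nonneg (- w (simple p))" if "len (w \<circ> srefl p) \<le> len w"
    using nonneg_of_length[OF wp assms(2)] that assms(2) eq by simp
  have ne: "w (simple p) \<noteq> 0"
    using root_nonzero W_roots assms simple_in_real_roots by blast
  show ?thesis
  proof (cases "len w \<le> len (w \<circ> srefl p)")
    case True
    then have "nonneg (w (simple p))" using nonneg_of_length assms by blast
    moreover from this have "len (w \<circ> srefl p) \<noteq> len w" using * nonneg_antisym ne by fastforce
    ultimately show ?thesis using that(1) len_right(1)[OF assms(2,1)] True by linarith
  next
    case False
    then show ?thesis using that(2) * len_right(2)[OF assms(2,1)] by linarith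
  qed
qed

lemma root_cases: "a \<in> roots \<Longrightarrow> a \<in> proots \<or> - a \<in> proots"
proof -
  assume a: "a \<in> roots"
  then obtain w p where "w \<in> W" "p \<in> {1..r}" "a = w (simple p)" by (auto simp: real_roots_def)
  then show ?thesis using length_right_cases[of w p] a uminus_roots proots_iff by metis
qed

lemma proots_roots: "a \<in> proots \<Longrightarrow> a \<in> roots"
  by (simp add: proots_iff)

lemma proots_uminus: "a \<in> proots \<Longrightarrow> - a \<notin> proots"
  using nonneg_antisym root_nonzero proots_iff by blast

lemma not_proots_iff: "a \<in> roots \<Longrightarrow> a \<notin> proots \<longleftrightarrow> - a \<in> proots"
  using root_cases proots_uminus by blast

lemma proots_neq_uminus: "a \<in> proots \<Longrightarrow> b \<in> proots \<Longrightarrow> a \<noteq> - b"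
  using proots_uminus by fastforce

lemma simple_proots: "p \<in> {1..r} \<Longrightarrow> simple p \<in> proots"
  by (simp add: proots_iff simple_in_real_roots nonneg_simple)

lemma root_multiple_of_simple:
  assumes "a \<in> roots" "p \<in> {1..r}" "\<And>q. q \<in> {1..r} \<Longrightarrow> q \<noteq> p \<Longrightarrow> coord q a = 0"
  shows "a = simple p \<or> a = - simple p"
proof -
  have "a = coord p a *\<^sub>R simple p"
  proof (rule rspan_eqI)
    show "a \<in> rspan" using roots_lattice assms by (simp add: lattice_def)
    show "coord p a *\<^sub>R simple p \<in> rspan" using assms by (simp add: rspan_scale rspan_simple)
    show "coord q a = coord q (coord p a *\<^sub>R simple p)" if "q \<in> {1..r}" for q
      using assms(2,3) that by (simp add: coord_bilin coord_simple)
  qed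
  then have "coord p a = 1 \<or> coord p a = -1" using roots_multiple_simple assms by metis
  then show ?thesis using \<open>a = coord p a *\<^sub>R simple p\<close> by (metis scaleR_one scaleR_minus1_left)
qed

text \<open>Only the coordinate at p changes, and a positive root without any other nonzero
  coordinate is \<alpha>_p.\<close>

lemma srefl_proots:
  assumes "a \<in> proots" "p \<in> {1..r}" "a \<noteq> simple p"
  shows "srefl p a \<in> proots"
proof (rule ccontr)
  assume "srefl p a \<notin> proots"
  then have n: "- srefl p a \<in> proots"
    using assms W_roots not_proots_iff proots_roots srefl_in_W by blast
  have "coord q a = 0" if q: "q \<in> {1..r}" "q \<noteq> p" for q
  proof -
    have "coord q a \<ge> 0" using assms(1) q by (simp add: proots_iff nonneg_def)
    moreover have "coord q (- srefl p a) \<ge> 0" using n q by (simp add: proots_iff nonneg_def)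
    ultimately show ?thesis using q assms(2) by (simp add: coord_bilin coord_srefl)
  qed
  then have "a = - simple p" using root_multiple_of_simple assms proots_roots by blast
  then show False using proots_uminus[OF simple_proots[OF assms(2)]] assms(1) by simp
qed

subsection \<open>Exchange condition and Bruhat covers\<close>

text \<open>Reading the word from the right, the image of \<open>a\<close> becomes negative at some
  letter, just before which it must be the simple root of that letter. Carrying this reflection back
  to \<open>refl a\<close> cancels the letter.\<close>

lemma strong_exchange:
  assumes "set ps \<subseteq> {1..r}" "a \<in> proots" "- wd ps a \<in> proots"
  shows "\<exists>us x vs. ps = us @ [x] @ vs \<and> wd ps \<circ> refl a = wd (us @ vs)"
  using assms
proof (induction ps)
  case Nil
  then show ?case using proots_uminus by auto
next
  case (Cons p ps)
  have p: "p \<in> {1..r}" and ps: "set ps \<subseteq> {1..r}" using Cons.prems by auto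
  note w = wd_in_W[OF ps]
  show ?case
  proof (cases "wd ps a \<in> proots")
    case True
    have "srefl p (wd ps a) \<notin> proots" using Cons.prems(3) proots_uminus by fastforce
    then have "wd ps a = simple p" using srefl_proots True p by blast
    then have "srefl p \<circ> wd ps = wd ps \<circ> refl a" using refl_W_comp[OF w, of a] by simp
    then have "wd (p # ps) \<circ> refl a = wd ps" using p by (simp add: comp_assoc flip: \<open>srefl p \<circ> wd ps = _\<close>)
    then have "p # ps = [] @ [p] @ ps \<and> wd (p # ps) \<circ> refl a = wd ([] @ ps)" by simp
    then show ?thesis by blast
  next
    case False
    then have "- wd ps a \<in> proots"
      using Cons.prems(2) W_roots[OF w] not_proots_iff proots_roots by blast
    then obtain us x vs where "ps = us @ [x] @ vs" "wd ps \<circ> refl a = wd (us @ vs)"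
      using Cons.IH Cons.prems ps by blast
    then have "p # ps = (p # us) @ [x] @ vs \<and> wd (p # ps) \<circ> refl a = wd ((p # us) @ vs)"
      by (simp add: comp_assoc)
    then show ?thesis by blast
  qed
qed

lemma length_refl_less:
  assumes "w \<in> W" "a \<in> proots" "- w a \<in> proots"
  shows "len (w \<circ> refl a) < len w"
proof -
  obtain ps where ps: "set ps \<subseteq> {1..r}" "length ps = len w" "w = wd ps" using reduced_word assms by blast
  obtain us x vs where "ps = us @ [x] @ vs" "wd ps \<circ> refl a = wd (us @ vs)"
    using strong_exchange ps assms by blast
  then show ?thesis using len_wd_le[of "us @ vs"] ps by auto
qed

lemma length_refl_greater:
  assumes "w \<in> W" "a \<in> proots" "w a \<in> proots"
  shows "len w < len (w \<circ> refl a)"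
proof -
  have a: "a \<in> roots" using assms proots_roots by blast
  have "(w \<circ> refl a) a = - w a" using a assms(1) by (simp add: W_uminus)
  then have "len (w \<circ> refl a \<circ> refl a) < len (w \<circ> refl a)"
    using assms refl_in_weyl_group[OF a] by (intro length_refl_less) (auto simp: W_comp)
  then show ?thesis using a by (simp add: comp_assoc)
qed

lemma length_refl_greater_iff:
  assumes "w \<in> W" "a \<in> proots"
  shows "len w < len (w \<circ> refl a) \<longleftrightarrow> w a \<in> proots"
  using assms length_refl_less length_refl_greater W_roots not_proots_iff proots_roots
  by (meson less_asym)

lemma srefl_comp_W: "w \<in> W \<Longrightarrow> w a = simple p \<Longrightarrow> srefl p \<circ> w = w \<circ> refl a"
  by (metis refl_W_comp)

text \<open>Since s_p w = w s_a with a = w^-1 \<alpha>_p, the comparison of lengths under right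
  multiplication by a reflection excludes equality.\<close>

lemma length_left_cases:
  assumes "w \<in> W" "p \<in> {1..r}"
  shows "len (srefl p \<circ> w) = len w + 1 \<or> len w = len (srefl p \<circ> w) + 1"
proof -
  let ?a = "inv w (simple p)"
  have a: "?a \<in> roots" using assms W_roots inv_W simple_in_real_roots by blast
  have eq: "srefl p \<circ> w = w \<circ> refl ?a" using assms by (intro srefl_comp_W) auto
  have "len (w \<circ> refl ?a) \<noteq> len w"
  proof (cases "?a \<in> proots")
    case True
    then show ?thesis using length_refl_greater[OF assms(1) True] simple_proots assms by simp
  next
    case False
    then have "- ?a \<in> proots" using a not_proots_iff by blast
    moreover have "w (- ?a) = - simple p" using assms by (simp add: W_uminus)
    ultimately show ?thesis
      using length_refl_less[OF assms(1), of "- ?a"] simple_proots assms by (simp add: refl_minus_root)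
  qed
  then have "len (srefl p \<circ> w) \<noteq> len w" by (simp only: eq not_False_eq_True)
  then show ?thesis using len_left[OF assms(2,1)] by linarith
qed

lemma length_left_root:
  assumes "w \<in> W" "p \<in> {1..r}" "a \<in> proots"
  shows "w a = simple p \<Longrightarrow> len w < len (srefl p \<circ> w)"
    and "w a = - simple p \<Longrightarrow> len (srefl p \<circ> w) < len w"
proof -
  show "len w < len (srefl p \<circ> w)" if "w a = simple p"
    using length_refl_greater[OF assms(1,3)] that simple_proots[OF assms(2)] srefl_comp_W assms(1) by simp
  show "len (srefl p \<circ> w) < len w" if "w a = - simple p"
  proof -
    have "srefl p \<circ> w = w \<circ> refl (- a)"
      using that assms by (intro srefl_comp_W) (auto simp: W_uminus)
    then show ?thesis
      using length_refl_less[OF assms(1,3)] that simple_proots[OF assms(2)] by (simp add: refl_minus_root)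
  qed
qed

lemma refl_eq_srefl:
  assumes "a \<in> roots" "p \<in> {1..r}" "refl a = srefl p"
  shows "a = simple p \<or> a = - simple p"
proof -
  have "- a = a - pair a (simple p) *\<^sub>R simple p"
    using refl_self[OF assms(1)] assms(3) by (simp add: root_refl_def)
  then have "2 *\<^sub>R a = pair a (simple p) *\<^sub>R simple p" by (simp add: scaleR_2 algebra_simps)
  then have "(1 / 2) *\<^sub>R 2 *\<^sub>R a = (1 / 2) *\<^sub>R pair a (simple p) *\<^sub>R simple p" by (rule arg_cong)
  then have "a = (pair a (simple p) / 2) *\<^sub>R simple p" by simp
  then show ?thesis using root_multiple_of_simple[OF assms(1,2)]
    by (metis assms(2) coord_bilin(3) coord_simple mult_zero_right)
qed

text \<open>The lifting property of the Bruhat order, specialised to a cover.\<close>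

lemma cover_descent:
  assumes w: "w \<in> W" "a \<in> proots" "p \<in> {1..r}"
    and cov: "len (w \<circ> refl a) = len w + 1"
    and asc: "len w < len (srefl p \<circ> w)"
    and desc: "len (srefl p \<circ> (w \<circ> refl a)) < len (w \<circ> refl a)"
  shows "w a = simple p"
proof -
  define u where "u = w \<circ> refl a"
  have a: "a \<in> roots" using w proots_roots by blast
  have u: "u \<in> W" using w refl_in_weyl_group[OF a] by (simp add: u_def W_comp)
  have su: "srefl p \<circ> u \<in> W" using u w by (simp add: W_comp)
  obtain ps where ps: "set ps \<subseteq> {1..r}" "length ps = len (srefl p \<circ> u)" "srefl p \<circ> u = wd ps"
    using reduced_word su by blast
  have lps: "length ps = len w" using ps(2) desc cov length_left_cases[OF u w(3)] unfolding u_def by linarith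
  have u_wd: "u = wd (p # ps)" using ps(3) w(3) by (simp flip: ps(3))
  have wpos: "w a \<in> proots" using cov length_refl_greater_iff[OF w(1,2)] by linarith
  have "u a = - w a" using a w by (simp add: u_def W_uminus)
  then have "- wd (p # ps) a \<in> proots" using wpos u_wd by (metis minus_minus)
  then obtain us x vs where x: "p # ps = us @ [x] @ vs" "wd (p # ps) \<circ> refl a = wd (us @ vs)"
    using strong_exchange[of "p # ps" a] ps(1) w by (metis insert_subset list.simps(15))
  have uw: "wd (p # ps) \<circ> refl a = w" using a unfolding u_wd[symmetric] by (simp add: u_def comp_assoc)
  \<comment> \<open>If a letter other than the leading p were deleted, s_p w would have a word of
    length \<open>len w - 1\<close>, against \<open>asc\<close>.\<close>
  have "us = []"
  proof (rule ccontr)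
    assume "us \<noteq> []"
    then obtain us' where us': "us = p # us'" using x(1) by (cases us) auto
    then have "w = srefl p \<circ> wd (us' @ vs)" using x(2) uw by simp
    then have "srefl p \<circ> w = wd (us' @ vs)" using w(3) by simp
    then have "len (srefl p \<circ> w) \<le> length (us' @ vs)" using len_wd_le[of "us' @ vs"] ps(1) x(1) us' by auto
    then show False using lps x(1) us' asc by auto
  qed
  then have "wd ps = w" using x uw by auto
  then have "srefl p \<circ> w = w \<circ> refl a" using u_wd u_def by simp
  then have "refl (w a) \<circ> w = srefl p \<circ> w" using refl_W_comp w by metis
  then have "refl (w a) = srefl p" using bij_W[OF w(1)] by (metis bij_is_surj surj_fun_eq o_apply fun_eq_iff surj_def)
  then have "w a = simple p \<or> w a = - simple p" using refl_eq_srefl w wpos proots_roots by blast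
  then show ?thesis using wpos proots_uminus simple_proots w(3) by auto
qed

lemma left_descent_exists:
  assumes "w \<in> W" "w \<noteq> id"
  shows "\<exists>p\<in>{1..r}. len (srefl p \<circ> w) < len w"
proof -
  obtain ps where ps: "set ps \<subseteq> {1..r}" "length ps = len w" "w = wd ps" using reduced_word assms by blast
  then obtain p qs where q: "ps = p # qs" using assms by (cases ps) auto
  then have "srefl p \<circ> w = wd qs" using ps by simp
  then have "len (srefl p \<circ> w) < len w" using len_wd_le[of qs] ps(1,2) q by simp
  then show ?thesis using ps(1) q by auto
qed

subsection \<open>The sign character\<close>

abbreviation sg :: "('v \<Rightarrow> 'v) \<Rightarrow> int" where "sg w \<equiv> (-1) ^ len w"

lemma sg_srefl:
  assumes "w \<in> W" "p \<in> {1..r}"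
  shows "sg (srefl p \<circ> w) = - sg w"
proof -
  have "m = n + 1 \<or> n = m + 1 \<Longrightarrow> (-1) ^ m = - ((-1) ^ n :: int)" for m n :: nat
    by (auto simp: power_add)
  then show ?thesis using length_left_cases[OF assms] by blast
qed

lemma sg_wd: "set ps \<subseteq> {1..r} \<Longrightarrow> w \<in> W \<Longrightarrow> sg (wd ps \<circ> w) = (-1) ^ length ps * sg w"
proof (induction ps)
  case Nil then show ?case by simp
next
  case (Cons p ps)
  then have "sg (srefl p \<circ> (wd ps \<circ> w)) = - sg (wd ps \<circ> w)"
    by (intro sg_srefl W_comp wd_in_W) auto
  also have "sg (wd ps \<circ> w) = (-1) ^ length ps * sg w" using Cons.prems by (intro Cons.IH) auto
  finally show ?case unfolding list.map refl_prod_Cons comp_assoc by simp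
qed

lemma sg_inv: "w \<in> W \<Longrightarrow> sg (inv w) = sg w"
proof -
  assume w: "w \<in> W"
  obtain ps where ps: "set ps \<subseteq> {1..r}" "length ps = len w" "w = wd ps" using reduced_word w by blast
  have "w \<circ> inv w = id" using w by (simp add: fun_eq_iff)
  then have "1 = sg w * sg (inv w)" using sg_wd[OF ps(1) inv_W[OF w]] ps by simp
  then show ?thesis by (cases "even (len w)") auto
qed

end

section \<open>The character ring, the Weyl denominator and the cancellation argument\<close>

subsection \<open>Formal sums\<close>

lemma char_mult_formal_sum:
  assumes "finite {(x, y). x \<in> X \<and> y \<in> Y \<and> m x + n y = \<nu>}"
  shows "char_mult (formal_sum c m X) (formal_sum d n Y) \<nu> =
    (\<Sum>(x, y)\<in>{(x, y). x \<in> X \<and> y \<in> Y \<and> m x + n y = \<nu>}. c x * d y)"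
proof -
  define Z where "Z = {(x, y). x \<in> X \<and> y \<in> Y \<and> m x + n y = \<nu>}"
  define M where "M = (\<lambda>z. m (fst z)) ` Z"
  have Z: "finite Z" "finite M" using assms by (simp_all add: Z_def M_def)
  have fibre: "{z \<in> Z. m (fst z) = \<mu>} = {x \<in> X. m x = \<mu>} \<times> {y \<in> Y. n y = \<nu> - \<mu>}" for \<mu>
    by (auto simp: Z_def algebra_simps)
  have prod: "formal_sum c m X \<mu> * formal_sum d n Y (\<nu> - \<mu>) = (\<Sum>(x, y)\<in>{z \<in> Z. m (fst z) = \<mu>}. c x * d y)" for \<mu>
    unfolding fibre formal_sum_def by (simp add: sum_product sum.cartesian_product)
  have "char_mult (formal_sum c m X) (formal_sum d n Y) \<nu>
      = (\<Sum>\<mu>\<in>M. formal_sum c m X \<mu> * formal_sum d n Y (\<nu> - \<mu>))"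
    unfolding char_mult_def
  proof (rule sum.mono_neutral_left)
    show "{\<mu>. formal_sum c m X \<mu> \<noteq> 0 \<and> formal_sum d n Y (\<nu> - \<mu>) \<noteq> 0} \<subseteq> M"
    proof safe
      fix \<mu> assume "formal_sum c m X \<mu> \<noteq> 0" "formal_sum d n Y (\<nu> - \<mu>) \<noteq> 0"
      then have "(\<Sum>(x, y)\<in>{z \<in> Z. m (fst z) = \<mu>}. c x * d y) \<noteq> 0" by (simp flip: prod)
      then have "{z \<in> Z. m (fst z) = \<mu>} \<noteq> {}" by force
      then show "\<mu> \<in> M" unfolding M_def by blast
    qed
  qed (use Z in auto)
  also have "\<dots> = (\<Sum>\<mu>\<in>M. \<Sum>(x, y)\<in>{z \<in> Z. m (fst z) = \<mu>}. c x * d y)" by (simp only: prod)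
  also have "\<dots> = (\<Sum>(x, y)\<in>Z. c x * d y)" using Z by (intro sum.group) (auto simp: M_def)
  finally show ?thesis by (simp only: Z_def)
qed

text \<open>Uniqueness by leading terms: at a weight of maximal height among those where two
  quotients differ, the product with \<open>b\<close> sees nothing but this difference. Existence is
  provided by \<open>f\<close> itself.\<close>

lemma char_divide_eq:
  assumes f: "f \<in> char_ring form r simple ht" "char_mult f b = a"
    and b: "b 0 = 1" "\<And>\<nu>. b \<nu> \<noteq> 0 \<Longrightarrow> \<nu> = 0 \<or> ht \<nu> < 0" and ht: "linear ht"
  shows "char_divide form r simple ht a b = f"
  unfolding char_divide_def
proof (rule the_equality)
  show "f \<in> char_ring form r simple ht \<and> char_mult f b = a" using f by simp
next
  fix g assume g: "g \<in> char_ring form r simple ht \<and> char_mult g b = a"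
  show "g = f"
  proof (rule ccontr)
    assume "g \<noteq> f"
    then obtain \<nu>0 where \<nu>0: "f \<nu>0 \<noteq> g \<nu>0" by fastforce
    have fin: "finite {\<mu>. ht \<mu> > h \<and> f \<mu> \<noteq> 0}" "finite {\<mu>. ht \<mu> > h \<and> g \<mu> \<noteq> 0}" for h
      using f g by (auto simp: char_ring_def)
    define D where "D = {\<mu>. ht \<mu> > ht \<nu>0 - 1 \<and> f \<mu> \<noteq> g \<mu>}"
    have "finite D"
      by (rule finite_subset[OF _ finite_UnI[OF fin[of "ht \<nu>0 - 1"]]]) (auto simp: D_def)
    moreover have "\<nu>0 \<in> D" using \<nu>0 by (simp add: D_def)
    ultimately obtain \<nu> where \<nu>: "\<nu> \<in> D" "\<And>\<mu>. \<mu> \<in> D \<Longrightarrow> ht \<mu> \<le> ht \<nu>"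
      using Max_in[of "ht ` D"] Max_ge[of "ht ` D"] by (metis empty_iff finite_imageI imageE image_eqI)
    define A where "A = {\<mu>. (f \<mu> \<noteq> 0 \<or> g \<mu> \<noteq> 0) \<and> b (\<nu> - \<mu>) \<noteq> 0}"
    have high: "\<mu> = \<nu> \<or> ht \<mu> > ht \<nu>" if "b (\<nu> - \<mu>) \<noteq> 0" for \<mu>
      using b(2)[OF that] ht by (auto simp: linear_diff)
    have "finite A"
    proof (rule finite_subset[OF _ finite_UnI[OF fin[of "ht \<nu> - 1"]]], rule subsetI)
      fix \<mu> assume "\<mu> \<in> A"
      then show "\<mu> \<in> {\<mu>. ht \<mu> > ht \<nu> - 1 \<and> f \<mu> \<noteq> 0} \<union> {\<mu>. ht \<mu> > ht \<nu> - 1 \<and> g \<mu> \<noteq> 0}"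
        using high[of \<mu>] by (auto simp: A_def)
    qed
    then have "char_mult f b \<nu> = (\<Sum>\<mu>\<in>A. f \<mu> * b (\<nu> - \<mu>))" "char_mult g b \<nu> = (\<Sum>\<mu>\<in>A. g \<mu> * b (\<nu> - \<mu>))"
      unfolding char_mult_def by (auto intro!: sum.mono_neutral_left simp: A_def)
    then have "0 = (\<Sum>\<mu>\<in>A. (f \<mu> - g \<mu>) * b (\<nu> - \<mu>))"
      using f(2) g by (simp add: left_diff_distrib sum_subtractf)
    also have "\<dots> = (\<Sum>\<mu>\<in>A. if \<mu> = \<nu> then f \<nu> - g \<nu> else 0)"
    proof (rule sum.cong[OF refl])
      fix \<mu> assume "\<mu> \<in> A"
      then have "\<mu> = \<nu> \<or> ht \<mu> > ht \<nu>" using high by (auto simp: A_def)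
      moreover have "f \<mu> = g \<mu>" if "ht \<mu> > ht \<nu>"
        using \<nu>(2)[of \<mu>] that \<nu>(1) by (force simp: D_def)
      ultimately show "(f \<mu> - g \<mu>) * b (\<nu> - \<mu>) = (if \<mu> = \<nu> then f \<nu> - g \<nu> else 0)"
        using b(1) by auto
    qed
    also have "\<dots> = f \<nu> - g \<nu>"
    proof -
      have "\<nu> \<in> A" using \<nu>(1) b(1) by (auto simp: A_def D_def)
      then show ?thesis using \<open>finite A\<close> by simp
    qed
    finally show False using \<nu>(1) by (simp add: D_def)
  qed
qed

locale root_datum_height = symmetrizable_root_datum form r simple
  for form :: "'v::real_vector \<Rightarrow> 'v \<Rightarrow> real" and r simple +
  fixes ht :: "'v \<Rightarrow> real" and \<rho> :: 'v
  assumes ht_linear: "linear ht"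
    and ht_simple: "p \<in> {1..r} \<Longrightarrow> ht (simple p) = 1"
    and rho_pair: "p \<in> {1..r} \<Longrightarrow> form \<rho> (coroot form (simple p)) = 1"
begin

lemma ht_diff: "ht (x - y) = ht x - ht y" and ht_scale: "ht (c *\<^sub>R x) = c * ht x"
  and ht_zero [simp]: "ht 0 = 0"
  using ht_linear by (simp_all add: linear_diff linear_scale linear_0)

lemma ht_rspan:
  assumes "v \<in> rspan"
  shows "ht v = (\<Sum>p\<in>{1..r}. coord p v)"
proof -
  have "ht v = ht (\<Sum>p\<in>{1..r}. coord p v *\<^sub>R simple p)" using rspanD[OF assms] by (rule arg_cong)
  then show ?thesis by (simp add: linear_sum[OF ht_linear] ht_scale ht_simple)
qed

lemma coord_le_ht:
  assumes "a \<in> proots" "p \<in> {1..r}"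
  shows "coord p a \<le> ht a"
proof -
  have "a \<in> rspan" "\<forall>p\<in>{1..r}. coord p a \<ge> 0" using assms by (auto simp: proots_iff nonneg_def)
  then show ?thesis using assms(2) ht_rspan member_le_sum[of p "{1..r}" "\<lambda>p. coord p a"] by simp
qed

lemma ht_proots:
  assumes "a \<in> proots"
  shows "ht a \<ge> 1"
proof (rule ccontr)
  assume h: "\<not> ht a \<ge> 1"
  have "a \<in> rspan" using assms by (auto simp: proots_iff nonneg_def)
  have "coord p a = 0" if p: "p \<in> {1..r}" for p
  proof -
    have "coord p a < 1" "coord p a \<ge> 0" using coord_le_ht[OF assms p] h assms p by (auto simp: proots_iff nonneg_def)
    moreover have "coord p a \<in> \<int>" using roots_lattice proots_roots assms p by (auto simp: lattice_def)
    ultimately show ?thesis by (metis abs_of_nonneg Ints_nonzero_abs_less1)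
  qed
  then have "a = (\<Sum>p\<in>{1..r}. 0)" using rspanD[OF \<open>a \<in> rspan\<close>] by (metis (no_types, lifting) scaleR_zero_left sum.cong)
  then show False using root_nonzero proots_roots assms by simp
qed

lemma finite_proots_ht: "finite {a \<in> proots. ht a \<le> h}"
proof (rule finite_subset)
  let ?F = "\<lambda>c. \<Sum>p\<in>{1..r}. of_int (c p) *\<^sub>R simple p"
  show "{a \<in> proots. ht a \<le> h} \<subseteq> ?F ` (PiE {1..r} (\<lambda>_. {0..\<lfloor>h\<rfloor>}))"
  proof safe
    fix a assume a: "a \<in> proots" "ht a \<le> h"
    define c where "c = restrict (\<lambda>p. \<lfloor>coord p a\<rfloor>) {1..r}"
    have i: "of_int \<lfloor>coord p a\<rfloor> = coord p a" "coord p a \<ge> 0" "coord p a \<le> h" if "p \<in> {1..r}" for p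
      using roots_lattice[OF proots_roots[OF a(1)]] that coord_le_ht[OF a(1) that] a
      by (auto simp: lattice_def Ints_def proots_iff nonneg_def)
    have "a = (\<Sum>p\<in>{1..r}. coord p a *\<^sub>R simple p)" using a by (intro rspanD) (simp add: proots_iff nonneg_def)
    also have "\<dots> = ?F c" by (intro sum.cong refl) (simp add: c_def i(1))
    finally have "a = ?F c" .
    moreover have "c \<in> PiE {1..r} (\<lambda>_. {0..\<lfloor>h\<rfloor>})" using i by (auto simp: c_def floor_mono)
    ultimately show "a \<in> ?F ` (PiE {1..r} (\<lambda>_. {0..\<lfloor>h\<rfloor>}))" by blast
  qed
qed (simp add: finite_PiE)

lemma finite_length_le: "finite {w \<in> W. len w \<le> n}"
proof (rule finite_subset)
  show "{w \<in> W. len w \<le> n} \<subseteq> wd ` {ps. set ps \<subseteq> {1..r} \<and> length ps \<le> n}"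
    using reduced_word by (smt (verit, best) image_iff mem_Collect_eq subsetI)
qed (simp add: finite_lists_length_le)

text \<open>Write w = w' s_p with w' shorter. Then w v = w' v - <v, \<alpha>_p^v> w' \<alpha>_p with
  w' \<alpha>_p a positive root, so each letter costs height at least 1. For v = \<rho> this
  isolates the leading term of the denominator and bounds the lengths that contribute to one
  coefficient.\<close>

lemma ht_regular:
  assumes v: "\<And>p. p \<in> {1..r} \<Longrightarrow> pair v (simple p) \<ge> 1" and "w \<in> W"
  shows "ht (w v) \<le> ht v - len w"
  using \<open>w \<in> W\<close>
proof (induction "len w" arbitrary: w)
  case 0
  then have "w = id" using len_eq_0 by metis
  then show ?case unfolding len_id[folded \<open>w = id\<close>] by simp
next
  case (Suc n)
  obtain ps where ps: "set ps \<subseteq> {1..r}" "length ps = len w" "w = wd ps" using reduced_word Suc.prems by blast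
  then obtain qs p where q: "ps = qs @ [p]" using Suc.hyps(2) by (metis length_0_conv nat.distinct(1) rev_exhaust)
  have p: "p \<in> {1..r}" "wd qs \<in> W" using ps q wd_in_W by auto
  have wq: "w = wd qs \<circ> srefl p" using ps q by (simp add: refl_prod_append)
  have len: "len (wd qs) = n" using len_wd_le[of qs] ps q Suc.hyps(2) wq len_right(1)[OF p] by auto
  have "wd qs (simple p) \<in> proots"
  proof (cases rule: length_right_cases[OF p(2,1)])
    case 1
    then show ?thesis using W_roots[OF p(2)] simple_in_real_roots[OF p(1)] by (simp add: proots_iff)
  next
    case 2
    then show ?thesis using len Suc.hyps(2) unfolding wq by linarith
  qed
  then have "1 * 1 \<le> pair v (simple p) * ht (wd qs (simple p))"
    using v[OF p(1)] ht_proots by (intro mult_mono) auto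
  moreover have "w v = wd qs v - pair v (simple p) *\<^sub>R wd qs (simple p)"
    using p by (simp add: wq root_refl_def W_linear linear_diff linear_scale)
  ultimately have "ht (w v) \<le> ht (wd qs v) - 1" by (simp add: ht_diff ht_scale)
  then show ?case using Suc.hyps(1)[of "wd qs"] p len Suc.hyps(2) by simp
qed

lemma weights_srefl: "v \<in> weights form r simple \<Longrightarrow> p \<in> {1..r} \<Longrightarrow> srefl p v \<in> weights form r simple"
  by (auto simp: weights_def root_refl_def form_bilin intro!: Ints_diff Ints_mult pair_simple_Ints)

lemma weights_W: "v \<in> weights form r simple \<Longrightarrow> w \<in> W \<Longrightarrow> w v \<in> weights form r simple"
proof -
  assume v: "v \<in> weights form r simple" and "w \<in> W"
  then obtain ps where w: "w = wd ps" "set ps \<subseteq> {1..r}" by (auto simp: weyl_group_def)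
  show ?thesis using w(2) unfolding w(1) by (induction ps) (auto simp: v weights_srefl)
qed

lemma alternant_leading: "kac_weyl_alternant form r simple \<rho> \<rho> 0 = 1"
  and alternant_support: "kac_weyl_alternant form r simple \<rho> \<rho> \<nu> \<noteq> 0 \<Longrightarrow> \<nu> = 0 \<or> ht \<nu> < 0"
proof -
  have h: "ht (w \<rho> - \<rho>) \<le> - len w" if "w \<in> W" for w
    using ht_regular[of \<rho> w] that rho_pair by (simp add: ht_diff)
  have "{w \<in> W. w \<rho> - \<rho> = 0} = {id}"
  proof safe
    fix w assume "w \<in> W" "w \<rho> - \<rho> = 0"
    then show "w = id" using h[of w] len_eq_0 by simp
  qed (simp_all add: id_in_weyl_group)
  then show "kac_weyl_alternant form r simple \<rho> \<rho> 0 = 1"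
    by (simp add: kac_weyl_alternant_def formal_sum_def)
  assume "kac_weyl_alternant form r simple \<rho> \<rho> \<nu> \<noteq> 0"
  then have "{w \<in> W. w \<rho> - \<rho> = \<nu>} \<noteq> {}" unfolding kac_weyl_alternant_def formal_sum_def by force
  then obtain w where w: "w \<in> W" "\<nu> = w \<rho> - \<rho>" by auto
  show "\<nu> = 0 \<or> ht \<nu> < 0"
  proof (cases "w = id")
    case False
    then have "len w \<noteq> 0" using len_eq_0 w(1) by blast
    then show ?thesis using h[OF w(1)] w by simp
  qed (use w in simp)
qed

text \<open>By the invariance the product with the denominator is the sum of \<open>sg w\<close> over the pairs
  \<open>(w, x)\<close> with \<open>m x + \<rho> = w (\<nu> + \<rho>)\<close>, and \<open>D\<close> cancels all pairs but those with \<open>x = xtop\<close>.\<close>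

lemma character_by_cancellation:
  fixes X :: "'x set" and m :: "'x \<Rightarrow> 'v" and D :: "'x \<Rightarrow> 'x" and d :: "'x \<Rightarrow> nat"
  assumes summable: "formally_summable form r simple ht m X" and bound: "\<And>x. x \<in> X \<Longrightarrow> ht (m x) \<le> H"
    and inv: "\<And>p \<nu>. p \<in> {1..r} \<Longrightarrow> formal_sum (\<lambda>_. 1) m X (srefl p \<nu>) = formal_sum (\<lambda>_. 1) m X \<nu>"
    and xtop: "xtop \<in> X" "m xtop = lam"
    and D: "\<And>x. x \<in> X - {xtop} \<Longrightarrow> d x \<in> {1..r}"
      "\<And>x. x \<in> X - {xtop} \<Longrightarrow> D x \<in> X - {xtop} \<and> D (D x) = x \<and> d (D x) = d x"
      "\<And>x. x \<in> X - {xtop} \<Longrightarrow> m (D x) + \<rho> = srefl (d x) (m x + \<rho>)"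
  shows "irr_character form r simple ht \<rho> lam = formal_sum (\<lambda>_. 1) m X"
  unfolding irr_character_def
proof (rule char_divide_eq)
  show "formal_sum (\<lambda>_. 1) m X \<in> char_ring form r simple ht"
    by (rule formal_sum_in_char_ring[OF summable])
  show "kac_weyl_alternant form r simple \<rho> \<rho> 0 = 1" by (rule alternant_leading)
  show "\<nu> = 0 \<or> ht \<nu> < 0" if "kac_weyl_alternant form r simple \<rho> \<rho> \<nu> \<noteq> 0" for \<nu>
    using that by (rule alternant_support)
  show "linear ht" by (rule ht_linear)
next
  let ?C = "formal_sum (\<lambda>_. 1) m X"
  have fibre: "finite {x \<in> X. m x = \<nu>}" for \<nu>
  proof (rule finite_subset)
    show "finite {x \<in> X. ht (m x) > ht \<nu> - 1}" using summable by (simp add: formally_summable_def)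
  qed auto
  have C: "?C \<nu> = int (card {x \<in> X. m x = \<nu>})" for \<nu> by (simp add: formal_sum_def)
  have C_W: "?C (w \<nu>) = ?C \<nu>" if "w \<in> W" for w \<nu>
  proof -
    obtain ps where ps: "set ps \<subseteq> {1..r}" "w = wd ps" using reduced_word \<open>w \<in> W\<close> by metis
    show ?thesis using ps(1) unfolding ps(2) by (induction ps) (auto simp: inv)
  qed
  show "char_mult ?C (kac_weyl_alternant form r simple \<rho> \<rho>) = kac_weyl_alternant form r simple \<rho> (lam + \<rho>)"
  proof
    fix \<nu>
    \<comment> \<open>\<open>Z\<close> indexes the terms of the product at \<nu>; the sets
      \<open>U w\<close> for w in \<open>V\<close> index them after w has been replaced by its
      inverse.\<close>
    define Z where "Z = {(x, w). x \<in> X \<and> w \<in> W \<and> m x + (w \<rho> - \<rho>) = \<nu>}"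
    define U where "U w = {x \<in> X. m x = w (\<nu> + \<rho>) - \<rho>}" for w
    define V where "V = {w \<in> W. U w \<noteq> {}}"
    have h: "ht (w \<rho> - \<rho>) \<le> - len w" if "w \<in> W" for w
      using ht_regular[of \<rho> w] that rho_pair by (simp add: ht_diff)
    have finZ: "finite Z"
    proof (rule finite_subset)
      show "Z \<subseteq> {x \<in> X. ht (m x) > ht \<nu> - 1} \<times> {w \<in> W. len w \<le> nat \<lceil>H - ht \<nu>\<rceil>}"
      proof safe
        fix x w assume "(x, w) \<in> Z"
        then have z: "x \<in> X" "w \<in> W" "ht (m x) + ht (w \<rho> - \<rho>) = ht \<nu>"
          using linear_add[OF ht_linear] by (auto simp: Z_def)
        then show "x \<in> X" "w \<in> W" by auto
        show "ht (m x) > ht \<nu> - 1" using z h[OF z(2)] by linarith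
        show "len w \<le> nat \<lceil>H - ht \<nu>\<rceil>" using z h[OF z(2)] bound[OF z(1)] by linarith
      qed
      show "finite ({x \<in> X. ht (m x) > ht \<nu> - 1} \<times> {w \<in> W. len w \<le> nat \<lceil>H - ht \<nu>\<rceil>})"
        using summable finite_length_le by (auto simp: formally_summable_def)
    qed
    define V0 where "V0 = snd ` Z"
    \<comment> \<open>Since \<nu> + \<rho> need not be dominant, its image under w gives no direct
      bound on the length of w. Invariance of \<open>?C\<close> transfers the action to \<rho>,
      where \<open>finZ\<close> applies.\<close>
    have finV: "finite V"
    proof -
      have "V \<subseteq> Hilbert_Choice.inv ` V0"
      proof
        fix w assume "w \<in> V"
        then obtain x where x: "x \<in> X" "w \<in> W" "m x = w (\<nu> + \<rho>) - \<rho>" by (auto simp: V_def U_def)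
        have "?C (\<nu> + \<rho> - Hilbert_Choice.inv w \<rho>) = ?C (w (\<nu> + \<rho>) - \<rho>)"
          using C_W[OF x(2), of "\<nu> + \<rho> - Hilbert_Choice.inv w \<rho>"] x(2) by (simp add: W_linear linear_diff)
        moreover have "?C (w (\<nu> + \<rho>) - \<rho>) \<noteq> 0" using x fibre by (auto simp: C)
        ultimately have "{x \<in> X. m x = \<nu> + \<rho> - Hilbert_Choice.inv w \<rho>} \<noteq> {}" by (metis C card.empty of_nat_0)
        then have "Hilbert_Choice.inv w \<in> V0" using inv_W[OF x(2)] by (force simp: V0_def Z_def algebra_simps)
        then show "w \<in> Hilbert_Choice.inv ` V0" using inv_W_inv[OF x(2)] by force
      qed
      then show ?thesis using finZ by (auto simp: V0_def intro: finite_subset)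
    qed
    have finU: "finite (U w)" for w using fibre by (simp add: U_def)
    have SigmaVU: "Sigma V U = {(w, x). w \<in> W \<and> x \<in> X \<and> m x + \<rho> = w (\<nu> + \<rho>)}"
      by (auto simp: V_def U_def algebra_simps)
    have "char_mult ?C (kac_weyl_alternant form r simple \<rho> \<rho>) \<nu> = (\<Sum>(x, w)\<in>Z. 1 * sg w)"
      unfolding kac_weyl_alternant_def Z_def
      by (rule char_mult_formal_sum) (use finZ in \<open>simp add: Z_def\<close>)
    also have "\<dots> = (\<Sum>w\<in>V0. \<Sum>z\<in>{z \<in> Z. snd z = w}. sg (snd z))"
      using finZ by (subst sum.group) (auto simp: V0_def split_beta)
    also have "\<dots> = (\<Sum>w\<in>V0. sg w * ?C (\<nu> + \<rho> - w \<rho>))"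
    proof (rule sum.cong[OF refl])
      fix w assume "w \<in> V0"
      then have "w \<in> W" by (auto simp: V0_def Z_def)
      then have "{z \<in> Z. snd z = w} = (\<lambda>x. (x, w)) ` {x \<in> X. m x = \<nu> + \<rho> - w \<rho>}"
        by (auto simp: Z_def algebra_simps)
      then have "card {z \<in> Z. snd z = w} = card {x \<in> X. m x = \<nu> + \<rho> - w \<rho>}"
        by (simp add: card_image inj_on_def)
      then show "(\<Sum>z\<in>{z \<in> Z. snd z = w}. sg (snd z)) = sg w * ?C (\<nu> + \<rho> - w \<rho>)" by (simp add: C)
    qed
    \<comment> \<open>Invariance allows w^-1 to be applied to the argument of \<open>?C\<close>, and
      inversion keeps the sign. Now w acts on \<nu> + \<rho>, so that reflecting m x + \<rho>
      corresponds to left multiplication on w.\<close>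
    also have "\<dots> = (\<Sum>w\<in>V. sg w * ?C (w (\<nu> + \<rho>) - \<rho>))"
    proof -
      have eq: "?C (\<nu> + \<rho> - w \<rho>) = ?C (Hilbert_Choice.inv w (\<nu> + \<rho>) - \<rho>)" if "w \<in> W" for w
        using C_W[OF inv_W[OF that], of "\<nu> + \<rho> - w \<rho>"] that inv_W[OF that]
        by (simp add: W_linear linear_diff)
      have V0: "w \<in> V0 \<longleftrightarrow> w \<in> W \<and> ?C (\<nu> + \<rho> - w \<rho>) \<noteq> 0" for w
      proof -
        have "w \<in> V0 \<longleftrightarrow> w \<in> W \<and> {x \<in> X. m x = \<nu> + \<rho> - w \<rho>} \<noteq> {}"
          by (force simp: V0_def Z_def algebra_simps)
        then show ?thesis using fibre by (simp add: C)
      qed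
      have V: "w \<in> V \<longleftrightarrow> w \<in> W \<and> ?C (w (\<nu> + \<rho>) - \<rho>) \<noteq> 0" for w
        using fibre by (simp add: C V_def U_def)
      show ?thesis
        by (rule sum.reindex_bij_witness[of _ Hilbert_Choice.inv Hilbert_Choice.inv])
          (auto simp: V V0 eq inv_W inv_W_inv sg_inv)
    qed
    also have "\<dots> = (\<Sum>w\<in>V. \<Sum>x\<in>U w. sg w)" by (simp add: C U_def mult.commute)
    also have "\<dots> = (\<Sum>(w, x)\<in>Sigma V U. sg w)"
      using finV finU by (intro sum.Sigma) auto
    also have "\<dots> = kac_weyl_alternant form r simple \<rho> (lam + \<rho>) \<nu>"
    proof -
      define S where "S = {(w, x). w \<in> W \<and> x \<in> X - {xtop} \<and> m x + \<rho> = w (\<nu> + \<rho>)}"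
      have finS: "finite {(w, x). w \<in> W \<and> x \<in> X \<and> m x + \<rho> = w (\<nu> + \<rho>)}"
        using finV finU unfolding SigmaVU[symmetric] by auto
      \<comment> \<open>Applying s_(d x) to both sides of m x + \<rho> = w (\<nu> + \<rho>) replaces
        x by D x and w by s_(d x) w, which has the opposite sign.\<close>
      have S0: "(\<Sum>(w, x)\<in>S. sg w) = 0"
      proof -
        define \<phi> where "\<phi> z = (srefl (d (snd z)) \<circ> fst z, D (snd z))" for z :: "('v \<Rightarrow> 'v) \<times> 'x"
        have \<phi>: "\<phi> z \<in> S \<and> \<phi> (\<phi> z) = z \<and> sg (fst (\<phi> z)) = - sg (fst z)" if "z \<in> S" for z
        proof -
          obtain w x where z: "z = (w, x)" by fastforce
          with that have wx: "w \<in> W" "x \<in> X - {xtop}" "m x + \<rho> = w (\<nu> + \<rho>)" by (auto simp: S_def)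
          note dx = D(1)[OF wx(2)] D(2)[OF wx(2)]
          have "m (D x) + \<rho> = srefl (d x) (w (\<nu> + \<rho>))" using D(3)[OF wx(2)] wx(3) by simp
          then have "\<phi> z \<in> S" using dx wx W_comp[of "srefl (d x)" w] by (simp add: S_def \<phi>_def z)
          then show ?thesis using dx wx sg_srefl[of w "d x"] by (simp add: \<phi>_def z)
        qed
        have "(\<Sum>z\<in>S. sg (fst z)) = (\<Sum>z\<in>S. - sg (fst z))"
          by (rule sum.reindex_bij_witness[of _ \<phi> \<phi>]) (simp_all add: \<phi>)
        then show ?thesis by (simp add: split_beta sum_negf)
      qed
      have "{(w, x). w \<in> W \<and> x \<in> X \<and> m x + \<rho> = w (\<nu> + \<rho>)} = S \<union> (\<lambda>w. (w, xtop)) ` {w \<in> W. lam + \<rho> = w (\<nu> + \<rho>)}"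
        using xtop by (auto simp: S_def)
      moreover have "S \<inter> (\<lambda>w. (w, xtop)) ` {w \<in> W. lam + \<rho> = w (\<nu> + \<rho>)} = {}" by (auto simp: S_def)
      ultimately have "(\<Sum>(w, x)\<in>{(w, x). w \<in> W \<and> x \<in> X \<and> m x + \<rho> = w (\<nu> + \<rho>)}. sg w)
        = (\<Sum>(w, x)\<in>S. sg w) + (\<Sum>(w, x)\<in>(\<lambda>w. (w, xtop)) ` {w \<in> W. lam + \<rho> = w (\<nu> + \<rho>)}. sg w)"
        using finS by (simp add: sum.union_disjoint)
      also have "\<dots> = (\<Sum>w\<in>{w \<in> W. lam + \<rho> = w (\<nu> + \<rho>)}. sg w)"
        unfolding S0 by (subst sum.reindex) (auto simp: inj_on_def)
      also have "\<dots> = (\<Sum>w\<in>{w \<in> W. w (lam + \<rho>) - \<rho> = \<nu>}. sg w)"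
      proof (rule sum.reindex_bij_witness[of _ Hilbert_Choice.inv Hilbert_Choice.inv])
        fix w assume "w \<in> {w \<in> W. lam + \<rho> = w (\<nu> + \<rho>)}"
        then have w: "w \<in> W" "lam + \<rho> = w (\<nu> + \<rho>)" by auto
        show "Hilbert_Choice.inv w \<in> {w \<in> W. w (lam + \<rho>) - \<rho> = \<nu>}" using w inv_W by simp
        show "Hilbert_Choice.inv (Hilbert_Choice.inv w) = w" "sg (Hilbert_Choice.inv w) = sg w"
          using w inv_W_inv sg_inv by auto
      next
        fix w assume "w \<in> {w \<in> W. w (lam + \<rho>) - \<rho> = \<nu>}"
        then have w: "w \<in> W" "\<nu> + \<rho> = w (lam + \<rho>)" by (auto simp: algebra_simps)
        then show "Hilbert_Choice.inv w \<in> {w \<in> W. lam + \<rho> = w (\<nu> + \<rho>)}" using inv_W by simp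
        show "Hilbert_Choice.inv (Hilbert_Choice.inv w) = w" using w inv_W_inv by auto
      qed
      also have "\<dots> = kac_weyl_alternant form r simple \<rho> (lam + \<rho>) \<nu>"
        by (simp add: kac_weyl_alternant_def formal_sum_def)
      finally show ?thesis unfolding SigmaVU .
    qed
    finally show "char_mult ?C (kac_weyl_alternant form r simple \<rho> \<rho>) \<nu> = kac_weyl_alternant form r simple \<rho> (lam + \<rho>) \<nu>" .
  qed
qed

end

section \<open>Folded paths along a chain: induction over folds, finiteness, heights\<close>

subsection \<open>Finite subsets of a linear order, cut at a time\<close>

lemma sorted_list_of_set_insert_greatest:
  assumes "finite S" "\<And>i. i \<in> S \<Longrightarrow> i < j"
  shows "sorted_list_of_set (insert j S) = sorted_list_of_set S @ [j]"
proof -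
  have "sorted (sorted_list_of_set S @ [j])" "distinct (sorted_list_of_set S @ [j])"
    using assms by (auto simp: sorted_append less_imp_le)
  moreover have "set (sorted_list_of_set S @ [j]) = insert j S" using assms by auto
  ultimately show ?thesis
    by (metis finite_insert assms(1) sorted_list_of_set.idem_if_sorted_distinct)
qed

lemma take_sorted_list_of_set:
  assumes "finite J" "m < card J"
  shows "take m (sorted_list_of_set J) = sorted_list_of_set {i \<in> J. i < sorted_list_of_set J ! m}"
proof -
  let ?js = "sorted_list_of_set J"
  have js: "sorted ?js" "distinct ?js" "set ?js = J" "m < length ?js" using assms by auto
  have sw: "sorted_wrt (<) ?js" using js strict_sorted_iff by blast
  have "set (take m ?js) = {i \<in> J. i < ?js ! m}"
  proof (intro equalityI subsetI)
    fix x assume "x \<in> set (take m ?js)"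
    then obtain k where "k < m" "x = ?js ! k" using js(4) by (auto simp: in_set_conv_nth)
    then show "x \<in> {i \<in> J. i < ?js ! m}"
      using sorted_wrt_nth_less[OF sw, of k m] js by (metis (mono_tags) less_trans mem_Collect_eq nth_mem)
  next
    fix x assume x: "x \<in> {i \<in> J. i < ?js ! m}"
    then obtain k where k: "k < length ?js" "x = ?js ! k" using js(3) by (metis (mono_tags, lifting) in_set_conv_nth mem_Collect_eq)
    have "k < m"
    proof (rule ccontr)
      assume "\<not> k < m"
      then have "?js ! m \<le> ?js ! k" using sorted_nth_mono[OF js(1)] k by simp
      then show False using x k by auto
    qed
    then show "x \<in> set (take m ?js)" using k by (auto simp: in_set_conv_nth)
  qed
  then show ?thesis
    using sorted_list_of_set.idem_if_sorted_distinct[of "take m ?js"] js by (simp add: sorted_wrt_take)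
qed

text \<open>The time \<open>Fin i\<close> is the moment just before the index \<open>i\<close>, and \<open>Pinf\<close> is the end of the chain.\<close>

definition cut :: "'i::linorder set \<Rightarrow> 'i extended \<Rightarrow> 'i set" where
  "cut S t = {j \<in> S. Fin j < t}"

lemma cut_subset: "cut S t \<subseteq> S"
  by (auto simp: cut_def)

lemma finite_cut [simp]: "finite S \<Longrightarrow> finite (cut S t)"
  by (simp add: cut_def)

lemma cut_infinity [simp]: "cut S Pinf = S"
  by (simp add: cut_def)

lemma gap_before:
  fixes S :: "'i::linorder set"
  assumes "Fin j < t" "\<And>i. i \<in> S \<Longrightarrow> j < i \<Longrightarrow> \<not> Fin i < t" "i \<in> S"
  shows "Fin i < t \<longleftrightarrow> i = j \<or> i < j"
  using assms(2)[OF assms(3)] assms(1) by (metis less_extended_simps(1) less_trans not_less_iff_gr_or_eq)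

lemma cut_last:
  assumes "Fin j < t" "\<And>i. i \<in> S \<Longrightarrow> j < i \<Longrightarrow> \<not> Fin i < t"
  shows "cut S t = (if j \<in> S then insert j (cut S (Fin j)) else cut S (Fin j))"
proof -
  have "Fin i < t \<longleftrightarrow> i = j \<or> i < j" if "i \<in> S" for i
    using gap_before[OF assms(1) _ that] assms(2) by blast
  then show ?thesis using assms(1) by (auto simp: cut_def)
qed

text \<open>Times cannot be inducted over in an arbitrary order. The step therefore jumps from a
  time back to the last element of the finite set \<open>S\<close> before it; strictly between the
  two, no element of \<open>S\<close> occurs.\<close>

lemma cut_induct [consumes 1, case_names empty last]:
  fixes S :: "'i::linorder set"
  assumes "finite S"
    and empty: "\<And>t. (\<And>i. i \<in> S \<Longrightarrow> \<not> Fin i < t) \<Longrightarrow> Q t"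
    and last: "\<And>t j. j \<in> S \<Longrightarrow> Fin j < t \<Longrightarrow> (\<And>i. i \<in> S \<Longrightarrow> j < i \<Longrightarrow> \<not> Fin i < t) \<Longrightarrow> Q (Fin j) \<Longrightarrow> Q t"
  shows "Q t"
proof (induction "card (cut S t)" arbitrary: t rule: less_induct)
  case less
  show ?case
  proof (cases "cut S t = {}")
    case True
    then show ?thesis by (intro empty) (auto simp: cut_def)
  next
    case False
    define j where "j = Max (cut S t)"
    have j: "j \<in> S" "Fin j < t" "\<And>i. i \<in> S \<Longrightarrow> Fin i < t \<Longrightarrow> i \<le> j"
      using Max_in[of "cut S t"] Max_ge[of "cut S t"] False assms(1) by (auto simp: j_def cut_def)
    have "Fin i < t" if "i < j" for i using that j(2) by (metis less_extended_simps(1) less_trans)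
    then have "cut S (Fin j) \<subset> cut S t" using j(1,2) by (auto simp: cut_def)
    then have "Q (Fin j)" using assms(1) by (intro less.hyps psubset_card_mono) auto
    then show ?thesis using last[of j t] j by fastforce
  qed
qed

subsection \<open>Folded paths of a chain\<close>

locale chain_datum = root_datum_height form r simple ht \<rho>
  for form :: "'v::real_vector \<Rightarrow> 'v \<Rightarrow> real" and r simple ht \<rho> +
  fixes lam :: 'v and I :: "'i::linorder set" and \<beta> :: "'i \<Rightarrow> 'v"
  assumes lam_dominant: "dominant form r simple lam"
    and chain: "lambda_chain form r simple lam I \<beta>"
begin

abbreviation level where "level \<equiv> chain_level I \<beta>"
abbreviation adm where "adm \<equiv> admissible form r simple I \<beta>"
abbreviation wt where "wt \<equiv> subset_weight form lam I \<beta>"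

definition wfold :: "'i set \<Rightarrow> 'i extended \<Rightarrow> 'v \<Rightarrow> 'v" where
  "wfold J t = refl_prod form (map \<beta> (sorted_list_of_set (cut J t)))"

text \<open>The affine companion of \<open>wfold\<close>, which is its linear part
  (\<open>afold_affine\<close>). The value at 0 is the displacement accumulated by the
  folds.\<close>

definition afold :: "'i set \<Rightarrow> 'i extended \<Rightarrow> 'v \<Rightarrow> 'v" where
  "afold J t = foldr (\<lambda>j. aff_refl form (\<beta> j) (level j)) (sorted_list_of_set (cut J t))"

lemma beta_proots: "i \<in> I \<Longrightarrow> \<beta> i \<in> proots"
  using chain by (auto simp: lambda_chain_def)

lemma beta_roots: "i \<in> I \<Longrightarrow> \<beta> i \<in> roots"
  using beta_proots proots_roots by blast

lemma finite_beta: "finite {i \<in> I. \<beta> i = a}"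
proof (cases "a \<in> proots")
  case True then show ?thesis using chain by (auto simp: lambda_chain_def)
next
  case False
  then have "{i \<in> I. \<beta> i = a} = {}" using beta_proots by auto
  then show ?thesis by (simp only: finite.emptyI)
qed

lemma card_beta: "a \<in> proots \<Longrightarrow> real (card {i \<in> I. \<beta> i = a}) = pair lam a"
  using chain by (auto simp: lambda_chain_def)

lemma wfold_empty: "(\<And>i. i \<in> J \<Longrightarrow> \<not> Fin i < t) \<Longrightarrow> wfold J t = id"
  and afold_empty: "(\<And>i. i \<in> J \<Longrightarrow> \<not> Fin i < t) \<Longrightarrow> afold J t = id"
proof -
  assume "\<And>i. i \<in> J \<Longrightarrow> \<not> Fin i < t"
  then have "cut J t = {}" by (auto simp: cut_def)
  then show "wfold J t = id" "afold J t = id" by (simp_all add: wfold_def afold_def)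
qed

lemma wfold_last:
  assumes "finite J" "Fin j < t" "\<And>i. i \<in> J \<Longrightarrow> j < i \<Longrightarrow> \<not> Fin i < t"
  shows "wfold J t = (if j \<in> J then wfold J (Fin j) \<circ> refl (\<beta> j) else wfold J (Fin j))"
proof -
  have "sorted_list_of_set (insert j (cut J (Fin j))) = sorted_list_of_set (cut J (Fin j)) @ [j]"
    using assms(1) by (intro sorted_list_of_set_insert_greatest) (auto simp: cut_def)
  then show ?thesis using cut_last[OF assms(2,3)] by (simp add: wfold_def refl_prod_append)
qed

lemma afold_last:
  assumes "finite J" "Fin j < t" "\<And>i. i \<in> J \<Longrightarrow> j < i \<Longrightarrow> \<not> Fin i < t"
  shows "afold J t = (if j \<in> J then afold J (Fin j) \<circ> aff_refl form (\<beta> j) (level j) else afold J (Fin j))"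
proof -
  have "sorted_list_of_set (insert j (cut J (Fin j))) = sorted_list_of_set (cut J (Fin j)) @ [j]"
    using assms(1) by (intro sorted_list_of_set_insert_greatest) (auto simp: cut_def)
  then show ?thesis using cut_last[OF assms(2,3)] by (simp add: afold_def fun_eq_iff)
qed

lemma wt_afold: "wt J = afold J Pinf lam"
  by (simp add: subset_weight_def afold_def)

lemma refl_W_root: "a \<in> roots \<Longrightarrow> refl a \<in> W"
  by (rule refl_in_weyl_group)

lemma wfold_W:
  assumes "finite J" "J \<subseteq> I"
  shows "wfold J t \<in> W"
  using assms(1)
proof (induction t rule: cut_induct)
  case (empty t)
  then show ?case by (simp add: wfold_empty id_in_weyl_group del: id_apply)
next
  case (last t j)
  then have "wfold J t = wfold J (Fin j) \<circ> refl (\<beta> j)" "refl (\<beta> j) \<in> W"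
    using wfold_last[OF assms(1) last.hyps(2,3)] assms refl_W_root beta_roots by auto
  then show ?case using W_comp[OF last.IH] by metis
qed

lemma afold_affine:
  assumes "finite J" "J \<subseteq> I"
  shows "afold J t v = wfold J t v + afold J t 0"
  using assms(1)
proof (induction t arbitrary: v rule: cut_induct)
  case (empty t)
  then show ?case by (simp add: wfold_empty afold_empty)
next
  case (last t j)
  let ?k = "of_int (level j) *\<^sub>R \<beta> j" and ?w = "wfold J (Fin j)"
  have w: "linear ?w" using wfold_W[OF assms] W_linear by blast
  have "afold J t v = ?w (refl (\<beta> j) v + ?k) + afold J (Fin j) 0" for v
    using afold_last[OF assms(1) last.hyps(2,3)] last.hyps(1) last.IH[of "refl (\<beta> j) v + ?k"]
    by (simp add: aff_refl_def)
  moreover have "refl (\<beta> j) 0 = 0" by (simp add: root_refl_def)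
  ultimately show ?case using wfold_last[OF assms(1) last.hyps(2,3)] last.hyps(1) w
    by (simp add: linear_add linear_0)
qed

text \<open>Turns the condition on the sorted list into one at each fold separately, stated through
  the path before it; this is what \<open>cut_induct\<close> can handle.\<close>

lemma admissible_iff:
  "adm J \<longleftrightarrow> finite J \<and> J \<subseteq> I \<and>
    (\<forall>j\<in>J. len (wfold J (Fin j) \<circ> refl (\<beta> j)) = len (wfold J (Fin j)) + 1)"
proof (cases "finite J \<and> J \<subseteq> I")
  case True
  then have fin: "finite J" and sub: "J \<subseteq> I" by auto
  let ?js = "sorted_list_of_set J"
  let ?P = "\<lambda>j. len (wfold J (Fin j) \<circ> refl (\<beta> j)) = len (wfold J (Fin j)) + 1"
  have len: "length ?js = card J" using fin by simp
  have cover: "bruhat_cover form r simple (refl_prod form (map \<beta> (take m ?js)))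
      (refl_prod form (map \<beta> (take (Suc m) ?js))) \<longleftrightarrow> ?P (?js ! m)" if m: "m < card J" for m
  proof -
    let ?j = "?js ! m"
    have jJ: "?j \<in> J" using m len fin nth_mem[of m ?js] by auto
    have tk: "refl_prod form (map \<beta> (take m ?js)) = wfold J (Fin ?j)"
      using take_sorted_list_of_set[OF fin m] by (simp add: wfold_def cut_def)
    have tk': "refl_prod form (map \<beta> (take (Suc m) ?js)) = wfold J (Fin ?j) \<circ> refl (\<beta> ?j)"
      using m len by (simp add: take_Suc_conv_app_nth refl_prod_append flip: tk)
    show ?thesis unfolding tk tk' bruhat_cover_def
      using wfold_W[OF fin sub] beta_proots jJ sub by blast
  qed
  have "adm J \<longleftrightarrow> (\<forall>m<card J. ?P (?js ! m))"
    using True cover by (simp add: admissible_def Let_def)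
  also have "\<dots> \<longleftrightarrow> (\<forall>j\<in>set ?js. ?P j)" by (simp only: all_set_conv_all_nth len)
  finally show ?thesis using True by simp
qed (auto simp: admissible_def)

lemma adm_finite: "adm J \<Longrightarrow> finite J" and adm_subset: "adm J \<Longrightarrow> J \<subseteq> I"
  and adm_cover: "adm J \<Longrightarrow> j \<in> J \<Longrightarrow> len (wfold J (Fin j) \<circ> refl (\<beta> j)) = len (wfold J (Fin j)) + 1"
  by (auto simp: admissible_iff)

lemma adm_fold_positive: "adm J \<Longrightarrow> j \<in> J \<Longrightarrow> wfold J (Fin j) (\<beta> j) \<in> proots"
  using length_refl_greater_iff[of "wfold J (Fin j)" "\<beta> j"] wfold_W beta_proots
    adm_finite adm_subset adm_cover by (metis less_add_one subsetD)

lemma adm_length: "adm J \<Longrightarrow> len (wfold J t) = card (cut J t)"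
proof -
  assume a: "adm J"
  show ?thesis using adm_finite[OF a]
  proof (induction t rule: cut_induct)
    case (empty t)
    then have "cut J t = {}" by (auto simp: cut_def)
    then show ?case by (simp add: wfold_def del: id_apply)
  next
    case (last t j)
    have "len (wfold J t) = len (wfold J (Fin j) \<circ> refl (\<beta> j))"
      using wfold_last[OF adm_finite[OF a] last.hyps(2,3)] last.hyps(1) by simp
    also have "\<dots> = card (cut J (Fin j)) + 1" using adm_cover[OF a last.hyps(1)] last.IH by simp
    also have "\<dots> = card (insert j (cut J (Fin j)))"
      using adm_finite[OF a] by (subst card_insert_disjoint) (auto simp: cut_def)
    also have "insert j (cut J (Fin j)) = cut J t"
      using cut_last[of j t J] last.hyps by simp
    finally show ?case .
  qed
qed

subsection \<open>Summability of the admissible subsets\<close>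

text \<open>The index i counts towards the total <\<lambda>, \<beta>_i^v> but not towards its own
  level. This difference of 1 makes each fold subtract a positive root at least once
  (\<open>afold_step\<close>).\<close>

lemma level_less: "i \<in> I \<Longrightarrow> of_int (level i) + 1 \<le> pair lam (\<beta> i)"
proof -
  assume i: "i \<in> I"
  have "{j \<in> I. j < i \<and> \<beta> j = \<beta> i} \<subset> {j \<in> I. \<beta> j = \<beta> i}" using i by auto
  then have "card {j \<in> I. j < i \<and> \<beta> j = \<beta> i} < card {j \<in> I. \<beta> j = \<beta> i}"
    using finite_beta by (intro psubset_card_mono)
  then show ?thesis using card_beta[OF beta_proots[OF i]] by (simp add: chain_level_def)
qed

lemma afold_step:
  assumes "adm J" "j \<in> J" "Fin j < t" "\<And>i. i \<in> J \<Longrightarrow> j < i \<Longrightarrow> \<not> Fin i < t"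
  shows "ht (afold J t lam) + ht (wfold J (Fin j) (\<beta> j)) \<le> ht (afold J (Fin j) lam)"
proof -
  note J = adm_finite[OF assms(1)] adm_subset[OF assms(1)]
  let ?w = "wfold J (Fin j)" and ?c = "pair lam (\<beta> j) - of_int (level j)"
  have w: "linear ?w" using wfold_W[OF J] W_linear by blast
  have "afold J t lam = afold J (Fin j) (lam - ?c *\<^sub>R \<beta> j)"
    using afold_last[OF J(1) assms(3,4)] assms(2) by (simp add: aff_refl_def root_refl_def algebra_simps)
  also have "\<dots> = ?w lam - ?c *\<^sub>R ?w (\<beta> j) + afold J (Fin j) 0"
    using w by (subst afold_affine[OF J]) (simp add: linear_diff linear_scale)
  also have "\<dots> = afold J (Fin j) lam - ?c *\<^sub>R ?w (\<beta> j)"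
    by (subst (2) afold_affine[OF J]) simp
  finally have "ht (afold J t lam) = ht (afold J (Fin j) lam) - ?c * ht (?w (\<beta> j))"
    by (simp add: ht_diff ht_scale)
  moreover have "1 * ht (?w (\<beta> j)) \<le> ?c * ht (?w (\<beta> j))"
    using level_less[of j] assms(2) J(2) ht_proots[OF adm_fold_positive[OF assms(1,2)]]
    by (intro mult_right_mono) auto
  ultimately show ?thesis by simp
qed

lemma adm_ht_le: "adm J \<Longrightarrow> ht (wt J) \<le> ht lam"
proof -
  assume a: "adm J"
  have "ht (afold J t lam) \<le> ht lam" for t using adm_finite[OF a]
  proof (induction t rule: cut_induct)
    case (empty t)
    then show ?case by (simp add: afold_empty)
  next
    case (last t j)
    then show ?case using afold_step[OF a last.hyps] ht_proots[OF adm_fold_positive[OF a last.hyps(1)]] by simp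
  qed
  then show ?thesis by (simp add: wt_afold)
qed

lemma wfold_remove_Max:
  assumes "finite J" "J \<noteq> {}" "t \<le> Fin (Max J)"
  shows "wfold (J - {Max J}) t = wfold J t" "afold (J - {Max J}) t = afold J t"
proof -
  have "cut (J - {Max J}) t = cut J t" using assms(3) by (auto simp: cut_def)
  then show "wfold (J - {Max J}) t = wfold J t" "afold (J - {Max J}) t = afold J t"
    by (simp_all add: wfold_def afold_def)
qed

text \<open>Deleting the last fold raises the height by at least 1, which gives the induction. Only
  finitely many indices can have been deleted: the root there is the preimage of a positive root of
  bounded height, and each root occurs finitely often in the chain.\<close>

lemma finite_adm_bounded: "finite {J. adm J \<and> ht lam - real n \<le> ht (wt J)}"
proof (induction n)
  define E where "E n J = (\<Union>g\<in>{a \<in> proots. ht a \<le> real n}. (\<lambda>j. insert j J) ` {i \<in> I. \<beta> i = inv (wfold J Pinf) g})" for n J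
  have decomp: "J = {} \<or> (\<exists>J'. adm J' \<and> ht (wt J) + 1 \<le> ht (wt J') \<and> J \<in> E n J')"
    if J: "adm J" "ht lam - real n \<le> ht (wt J)" for J n
  proof (cases "J = {}")
    case False
    define j where "j = Max J"
    let ?J = "J - {j}"
    note fin = adm_finite[OF J(1)]
    have j: "j \<in> J" "\<And>i. i \<in> J \<Longrightarrow> i \<le> j" using Max_in Max_ge fin False by (auto simp: j_def)
    have eq: "wfold ?J t = wfold J t" "afold ?J t = afold J t" if "t \<le> Fin j" for t
      using wfold_remove_Max[OF fin False] that by (auto simp: j_def)
    have "cut ?J Pinf = cut ?J (Fin j)" using j by (auto simp: cut_def order_less_le)
    then have inf: "wfold ?J Pinf = wfold J (Fin j)" "afold ?J Pinf = afold J (Fin j)"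
      using eq[of "Fin j"] by (auto simp: wfold_def afold_def)
    have adm: "adm ?J" unfolding admissible_iff
    proof (intro conjI ballI)
      fix i assume i: "i \<in> ?J"
      then have "Fin i \<le> Fin j" using j by auto
      then show "len (wfold ?J (Fin i) \<circ> refl (\<beta> i)) = len (wfold ?J (Fin i)) + 1"
        using eq adm_cover[OF J(1)] i by auto
    qed (use fin adm_subset[OF J(1)] in auto)
    have st: "ht (wt J) + ht (wfold J (Fin j) (\<beta> j)) \<le> ht (wt ?J)"
      using afold_step[OF J(1) j(1), of Pinf] j by (force simp: wt_afold inf)
    note pos = adm_fold_positive[OF J(1) j(1)]
    have "ht (wfold J (Fin j) (\<beta> j)) \<le> real n" using st adm_ht_le[OF adm] J(2) by simp
    moreover have "\<beta> j = inv (wfold ?J Pinf) (wfold J (Fin j) (\<beta> j))"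
      using wfold_W[OF fin adm_subset[OF J(1)]] by (simp add: inf)
    moreover have "J = insert j ?J" using j by auto
    ultimately have "J \<in> E n ?J" using pos j(1) adm_subset[OF J(1)] unfolding E_def by blast
    then show ?thesis using adm st ht_proots[OF pos] by (intro disjI2 exI[of _ ?J]) auto
  qed simp
  {
    case 0
    have "{J. adm J \<and> ht lam - real 0 \<le> ht (wt J)} \<subseteq> {{}}"
      using decomp[of _ 0] adm_ht_le by force
    then show ?case using finite_subset by blast
  next
    case (Suc n)
    have sub: "{J. adm J \<and> ht lam - real (Suc n) \<le> ht (wt J)} \<subseteq>
        {{}} \<union> (\<Union>J\<in>{J. adm J \<and> ht lam - real n \<le> ht (wt J)}. E (Suc n) J)"
      using decomp[of _ "Suc n"] by fastforce
    have "finite (E (Suc n) J)" for J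
      unfolding E_def using finite_proots_ht finite_beta by blast
    then show ?case using Suc by (intro finite_subset[OF sub] finite_UnI finite_UN_I) auto
  }
qed

lemma weights_add:
  "u \<in> weights form r simple \<Longrightarrow> v \<in> weights form r simple \<Longrightarrow> u + v \<in> weights form r simple"
  by (auto simp: weights_def form_bilin)

lemma wt_weights: "adm J \<Longrightarrow> wt J \<in> weights form r simple"
proof -
  assume a: "adm J"
  note J = adm_finite[OF a] adm_subset[OF a]
  have "v \<in> weights form r simple \<Longrightarrow> afold J t v \<in> weights form r simple" for v t using J(1)
  proof (induction t arbitrary: v rule: cut_induct)
    case (empty t)
    then show ?case by (simp add: afold_empty)
  next
    case (last t j)
    have b: "\<beta> j \<in> roots" using beta_roots last.hyps J by blast
    have "of_int k *\<^sub>R \<beta> j \<in> weights form r simple" for k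
      using pair_lattice_simple[OF roots_lattice[OF b]] by (auto simp: weights_def form_bilin)
    then have "aff_refl form (\<beta> j) (level j) v \<in> weights form r simple"
      unfolding aff_refl_def using last.prems weights_W refl_W_root[OF b] weights_add by blast
    then show ?case using afold_last[OF J(1) last.hyps(2,3)] last.hyps(1) last.IH by simp
  qed
  then show ?thesis using lam_dominant by (simp add: wt_afold dominant_def)
qed

lemma adm_summable: "formally_summable form r simple ht wt {J. adm J}"
proof -
  have "finite {J. adm J \<and> h < ht (wt J)}" for h
    by (rule finite_subset[OF _ finite_adm_bounded[of "nat \<lceil>ht lam - h\<rceil>"]]) (auto, linarith)
  then show ?thesis using wt_weights by (simp add: formally_summable_def)
qed

subsection \<open>Heights of folded paths\<close>

text \<open>Extends \<open>chain_count\<close> to all times, in particular to the end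
  \<open>Pinf\<close>, where the first chain condition evaluates it.\<close>

definition N :: "'i extended \<Rightarrow> 'v \<Rightarrow> real" where
  "N t a = (if a \<in> proots then real (card {j \<in> I. Fin j < t \<and> \<beta> j = a})
     else 1 - real (card {j \<in> I. Fin j < t \<and> \<beta> j = - a}))"

lemma N_chain_count: "N (Fin i) a = of_int (chain_count form r simple I \<beta> i a)"
  by (simp add: N_def chain_count_def)

lemma N_beta: "i \<in> I \<Longrightarrow> N (Fin i) (\<beta> i) = of_int (level i)"
  by (simp add: N_def chain_level_def beta_proots)

lemma N_beta_minus: "i \<in> I \<Longrightarrow> N (Fin i) (- \<beta> i) = 1 - of_int (level i)"
  using beta_proots proots_uminus by (simp add: N_def chain_level_def)

lemma coroot_refl:
  assumes "a \<in> roots" "b \<in> roots"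
  shows "coroot form (refl b a) = coroot form a - pair b a *\<^sub>R coroot form b"
proof -
  have "coroot form (refl b a) = refl b (coroot form a)" using coroot_W refl_W_root assms by blast
  then show ?thesis by (simp add: root_refl_def coroot_def form_bilin form_sym[of b a])
qed

text \<open>The second chain condition with \<gamma> the reflection of \<open>a\<close> in
  \<beta>_i, for which k = -<\<beta>_i, a^v>.\<close>

lemma N_refl:
  assumes "i \<in> I" "a \<in> roots" "a \<noteq> \<beta> i" "a \<noteq> - \<beta> i"
  shows "N (Fin i) (refl (\<beta> i) a) = N (Fin i) a - pair (\<beta> i) a * of_int (level i)"
proof -
  have b: "\<beta> i \<in> roots" using assms beta_roots by blast
  obtain k where k: "pair (\<beta> i) a = of_int k" using pair_roots_Ints[OF b assms(2)] by (metis Ints_cases)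
  have "coroot form (refl (\<beta> i) a) = coroot form a + of_int (- k) *\<^sub>R coroot form (\<beta> i)"
    using coroot_refl[OF assms(2) b] k by simp
  moreover have "refl (\<beta> i) a \<in> roots" using W_roots refl_W_root b assms by blast
  ultimately have "chain_count form r simple I \<beta> i (refl (\<beta> i) a) =
      chain_count form r simple I \<beta> i a + (- k) * chain_count form r simple I \<beta> i (\<beta> i)"
    using chain assms b unfolding lambda_chain_def by blast
  then have "N (Fin i) (refl (\<beta> i) a) = N (Fin i) a + of_int (- k) * N (Fin i) (\<beta> i)"
    unfolding N_chain_count by simp
  then show ?thesis using k assms by (simp add: N_beta)
qed

lemma N_diff:
  assumes "a \<in> roots" "s \<le> t"
  shows "N t a = N s a + real (card {j \<in> I. s \<le> Fin j \<and> Fin j < t \<and> \<beta> j = a})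
    - real (card {j \<in> I. s \<le> Fin j \<and> Fin j < t \<and> \<beta> j = - a})"
proof -
  have card: "card {j \<in> I. Fin j < t \<and> \<beta> j = b} =
      card {j \<in> I. Fin j < s \<and> \<beta> j = b} + card {j \<in> I. s \<le> Fin j \<and> Fin j < t \<and> \<beta> j = b}" for b
  proof -
    have fin: "finite {j \<in> I. P j \<and> \<beta> j = b}" for P
      by (rule finite_subset[OF _ finite_beta[of b]]) auto
    have "{j \<in> I. Fin j < t \<and> \<beta> j = b} = {j \<in> I. Fin j < s \<and> \<beta> j = b} \<union> {j \<in> I. s \<le> Fin j \<and> Fin j < t \<and> \<beta> j = b}"
      using assms(2) by auto
    then show ?thesis using fin[of "\<lambda>j. Fin j < s"] fin[of "\<lambda>j. s \<le> Fin j \<and> Fin j < t"]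
      by (simp only: conj_assoc) (intro card_Un_disjoint; auto)
  qed
  have emp: "card {j \<in> I. s \<le> Fin j \<and> Fin j < t \<and> \<beta> j = b} = 0" if "b \<notin> proots" for b
  proof -
    have "{j \<in> I. s \<le> Fin j \<and> Fin j < t \<and> \<beta> j = b} = {}" using that beta_proots by blast
    then show ?thesis by (simp only: card.empty)
  qed
  show ?thesis
  proof (cases "a \<in> proots")
    case True
    then have "- a \<notin> proots" using proots_uminus by blast
    then show ?thesis using True card[of a] emp[of "- a"] by (simp add: N_def)
  next
    case False
    then show ?thesis using card[of "- a"] emp[of a] by (simp add: N_def)
  qed
qed

lemma N_infinity: "a \<in> roots \<Longrightarrow> N Pinf a = pair lam a + (if a \<in> proots then 0 else 1)"
  using card_beta[of a] card_beta[of "- a"] not_proots_iff[of a]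
  by (cases "a \<in> proots") (simp_all add: N_def pair_minus)

text \<open>\<open>N t\<close> is invariant under folding at \<open>j\<close>; for \<open>c \<noteq> \<plusminus>\<beta> j\<close> this is the defining
  condition on a chain, otherwise it is the choice of \<open>N\<close> on negative roots.\<close>

lemma N_fold:
  assumes "j \<in> I" "c \<in> roots"
  shows "N (Fin j) (refl (\<beta> j) c) + (if \<beta> j = refl (\<beta> j) c then 1 else 0)
    - (if \<beta> j = - refl (\<beta> j) c then 1 else 0) + of_int (level j) * pair (\<beta> j) c = N (Fin j) c"
proof -
  have b: "\<beta> j \<in> roots" "\<beta> j \<noteq> - \<beta> j" using assms beta_roots beta_proots proots_neq_uminus by blast+
  consider "c = \<beta> j" | "c = - \<beta> j" | "c \<noteq> \<beta> j" "c \<noteq> - \<beta> j" by blast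
  then show ?thesis
  proof cases
    case 1
    then show ?thesis using b assms by (simp add: N_beta N_beta_minus)
  next
    case 2
    have "refl (\<beta> j) (- \<beta> j) = \<beta> j" using b W_uminus[OF refl_W_root] by simp
    then show ?thesis using 2 b assms by (simp add: N_beta N_beta_minus pair_minus)
  next
    case 3
    have "\<beta> j \<noteq> refl (\<beta> j) c" "\<beta> j \<noteq> - refl (\<beta> j) c"
      using 3 b by (metis refl_refl refl_self minus_minus W_uminus refl_W_root)+
    then show ?thesis using N_refl[OF assms 3] by simp
  qed
qed

end

section \<open>Segments, their reversal, and the events of a path\<close>

subsection \<open>Order reversal within classes\<close>

lemma ex_reversal_set:
  fixes S :: "'a::linorder set"
  assumes "finite S"
  shows "\<exists>\<pi>. \<forall>e\<in>S. \<pi> e \<in> S \<and> \<pi> (\<pi> e) = e \<and> (\<forall>e'\<in>S. \<pi> e < \<pi> e' \<longleftrightarrow> e' < e)"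
proof -
  define xs n where "xs = sorted_list_of_set S" and "n = length xs"
  have xs: "sorted_wrt (<) xs" "set xs = S" "distinct xs" using assms by (simp_all add: xs_def)
  define q where "q e = (THE k. k < n \<and> xs ! k = e)" for e
  have q_nth: "q (xs ! k) = k" if "k < n" for k
    using that xs(3) unfolding q_def by (intro the_equality) (auto simp: n_def nth_eq_iff_index_eq)
  have q: "q e < n \<and> xs ! q e = e" if "e \<in> S" for e
  proof -
    obtain k where "k < n" "xs ! k = e" using \<open>e \<in> S\<close> xs(2) by (metis in_set_conv_nth n_def)
    then show ?thesis using q_nth by auto
  qed
  have less: "xs ! i < xs ! j \<longleftrightarrow> i < j" if "i < n" "j < n" for i j
    using that sorted_wrt_nth_less[OF xs(1), of i j] sorted_wrt_nth_less[OF xs(1), of j i]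
    by (metis less_asym n_def not_less_iff_gr_or_eq)
  define \<pi> where "\<pi> e = xs ! (n - Suc (q e))" for e
  have "\<pi> e \<in> S \<and> \<pi> (\<pi> e) = e \<and> (\<forall>e'\<in>S. \<pi> e < \<pi> e' \<longleftrightarrow> e' < e)" if e: "e \<in> S" for e
  proof (intro conjI ballI)
    have "n - Suc (q e) < n" using q[OF e] by linarith
    then show "\<pi> e \<in> S" using xs(2) nth_mem unfolding \<pi>_def n_def by blast
    show "\<pi> (\<pi> e) = e" using q[OF e] q_nth[of "n - Suc (q e)"] by (simp add: \<pi>_def)
    fix e' assume e': "e' \<in> S"
    have "\<pi> e < \<pi> e' \<longleftrightarrow> n - Suc (q e) < n - Suc (q e')"
      unfolding \<pi>_def using q[OF e] q[OF e'] by (intro less) auto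
    also have "\<dots> \<longleftrightarrow> q e' < q e" using q[OF e] q[OF e'] by auto
    also have "\<dots> \<longleftrightarrow> e' < e" using q[OF e] q[OF e'] less[of "q e'" "q e"] by simp
    finally show "\<pi> e < \<pi> e' \<longleftrightarrow> e' < e" .
  qed
  then show ?thesis by blast
qed

definition is_reversal :: "'a::linorder set \<Rightarrow> ('a \<Rightarrow> 'b) \<Rightarrow> ('a \<Rightarrow> 'a) \<Rightarrow> bool" where
  "is_reversal E g \<pi> \<longleftrightarrow> (\<forall>e\<in>E. \<pi> e \<in> E \<and> g (\<pi> e) = g e \<and> \<pi> (\<pi> e) = e \<and>
     (\<forall>e'\<in>E. g e = g e' \<longrightarrow> (\<pi> e < \<pi> e' \<longleftrightarrow> e' < e)))"

text \<open>The choice depends on \<open>E\<close> and \<open>g\<close> alone. A flip leaves both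
  unchanged, so the second flip uses the same map and undoes the first.\<close>

definition reversal :: "'a::linorder set \<Rightarrow> ('a \<Rightarrow> 'b) \<Rightarrow> 'a \<Rightarrow> 'a" where
  "reversal E g = (SOME \<pi>. is_reversal E g \<pi>)"

lemma is_reversal_reversal:
  assumes "finite E"
  shows "is_reversal E g (reversal E g)"
proof -
  have "\<forall>c. \<exists>\<pi>. \<forall>e\<in>{e \<in> E. g e = c}. \<pi> e \<in> {e \<in> E. g e = c} \<and> \<pi> (\<pi> e) = e \<and>
      (\<forall>e'\<in>{e \<in> E. g e = c}. \<pi> e < \<pi> e' \<longleftrightarrow> e' < e)"
    using assms by (intro allI ex_reversal_set) auto
  from choice[OF this] obtain Q where Q: "\<forall>e\<in>{e \<in> E. g e = c}. Q c e \<in> {e \<in> E. g e = c} \<and> Q c (Q c e) = e \<and>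
      (\<forall>e'\<in>{e \<in> E. g e = c}. Q c e < Q c e' \<longleftrightarrow> e' < e)" for c
    by blast
  have "is_reversal E g (\<lambda>e. Q (g e) e)" unfolding is_reversal_def
  proof (rule ballI)
    fix e assume "e \<in> E"
    then have "e \<in> {e' \<in> E. g e' = g e}" by simp
    note Qe = bspec[OF Q this]
    then show "Q (g e) e \<in> E \<and> g (Q (g e) e) = g e \<and> Q (g (Q (g e) e)) (Q (g e) e) = e \<and>
      (\<forall>e'\<in>E. g e = g e' \<longrightarrow> (Q (g e) e < Q (g e') e' \<longleftrightarrow> e' < e))" by auto
  qed
  then show ?thesis unfolding reversal_def by (rule someI[where P = "is_reversal E g"])
qed

text \<open>\<open>T\<close> divides the times into segments (fibres of \<open>cut T\<close>); \<open>F\<close> contains exactly one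
  element of \<open>E\<close> from every segment that meets \<open>E\<close> or is followed by an element of \<open>T\<close>.\<close>

definition transversal :: "'i::linorder extended set \<Rightarrow> 'i set \<Rightarrow> 'i extended set \<Rightarrow> bool" where
  "transversal E T F \<longleftrightarrow> F \<subseteq> E \<and> (\<forall>f\<in>F. \<forall>f'\<in>F. cut T f = cut T f' \<longrightarrow> f = f') \<and>
     (\<forall>e\<in>E. \<exists>f\<in>F. cut T f = cut T e) \<and> (\<forall>s\<in>T. \<exists>f\<in>F. cut T f = cut T (Fin s))"

text \<open>If \<open>F\<close> consists of the marks of a path, this says that the path is on the
  negative side at time \<open>t\<close> (\<open>neg_iff_passed\<close>).\<close>

definition passed :: "'i::linorder set \<Rightarrow> 'i extended set \<Rightarrow> 'i extended \<Rightarrow> bool" where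
  "passed T F t \<longleftrightarrow> (\<exists>f\<in>F. f < t \<and> cut T f = cut T t)"

lemma transversal_reversal:
  assumes "is_reversal E (cut T) \<pi>" "transversal E T F"
  shows "transversal E T (\<pi> ` F)"
  unfolding transversal_def
proof (intro conjI ballI impI)
  have F: "f \<in> E" if "f \<in> F" for f using that assms(2) by (auto simp: transversal_def)
  have c: "cut T (\<pi> f) = cut T f" if "f \<in> F" for f using F[OF that] assms(1) by (auto simp: is_reversal_def)
  show "\<pi> ` F \<subseteq> E" using F assms(1) by (auto simp: is_reversal_def)
  show "x = y" if xy: "x \<in> \<pi> ` F" "y \<in> \<pi> ` F" "cut T x = cut T y" for x y
  proof -
    obtain f f' where f: "f \<in> F" "x = \<pi> f" "f' \<in> F" "y = \<pi> f'" using xy by blast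
    then have "cut T f = cut T f'" using c xy(3) by simp
    then have "f = f'" using f assms(2) unfolding transversal_def by blast
    then show "x = y" using f by simp
  qed
  show "\<exists>f\<in>\<pi> ` F. cut T f = cut T e" if "e \<in> E" for e
    using that c assms(2) unfolding transversal_def by (metis imageI)
  show "\<exists>f\<in>\<pi> ` F. cut T f = cut T (Fin s)" if "s \<in> T" for s
    using that c assms(2) unfolding transversal_def by (metis imageI)
qed

text \<open>Reversal exchanges before and after the unique element of \<open>F\<close> in a segment.
  The sign of an unfolded event depends only on this, so all these signs are negated.\<close>

lemma passed_reversal:
  assumes rv: "is_reversal E (cut T) \<pi>" and tr: "transversal E T F" and e: "e \<in> E" "e \<notin> F"
  shows "passed T (\<pi> ` F) (\<pi> e) \<longleftrightarrow> \<not> passed T F e"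
proof -
  obtain f where f: "f \<in> F" "cut T f = cut T e" "\<And>f'. f' \<in> F \<Longrightarrow> cut T f' = cut T e \<Longrightarrow> f' = f"
    using tr e unfolding transversal_def by metis
  have F: "f' \<in> E" if "f' \<in> F" for f' using that tr by (auto simp: transversal_def)
  have "passed T F e \<longleftrightarrow> f < e" using f unfolding passed_def by metis
  moreover have "passed T (\<pi> ` F) (\<pi> e) \<longleftrightarrow> \<pi> f < \<pi> e"
    using f F rv e(1) unfolding passed_def is_reversal_def by (smt (verit, best) image_iff)
  moreover have "\<pi> f < \<pi> e \<longleftrightarrow> e < f" using rv f F e(1) unfolding is_reversal_def by blast
  moreover have "e \<noteq> f" using f e by blast
  ultimately show ?thesis by auto
qed

subsection \<open>Events of a folded path in the direction of a simple root\<close>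

context chain_datum
begin

context
  fixes p :: nat
  assumes p: "p \<in> {1..r}"
begin

text \<open>Equivalently, u^-1 \<alpha>_p is a negative root (\<open>neg_iff_root\<close>): the path
  with linear part u moves down with respect to \<alpha>_p.\<close>

definition neg :: "('v \<Rightarrow> 'v) \<Rightarrow> bool" where
  "neg u \<longleftrightarrow> len (srefl p \<circ> u) < len u"

lemma neg_id [simp]: "\<not> neg id"
  by (simp add: neg_def del: id_apply)

lemma neg_srefl: "u \<in> W \<Longrightarrow> neg (srefl p \<circ> u) \<longleftrightarrow> \<not> neg u"
  using length_left_cases[of u p] p unfolding neg_def srefl_left_cancel[OF p] by force

lemma len_srefl_neg: "u \<in> W \<Longrightarrow> int (len (srefl p \<circ> u)) = int (len u) + (if neg u then -1 else 1)"
  using length_left_cases[of u p] p unfolding neg_def by (auto simp del: comp_apply)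

definition event :: "('v \<Rightarrow> 'v) \<Rightarrow> 'v \<Rightarrow> bool" where
  "event u b \<longleftrightarrow> u b = simple p \<or> u b = - simple p"

text \<open>s_p exchanges \<alpha>_p and -\<alpha>_p. Hence mirroring part of a path creates and
  destroys no events.\<close>

lemma event_srefl: "event (srefl p \<circ> u) b \<longleftrightarrow> event u b"
proof -
  have s: "srefl p (simple p) = - simple p" "srefl p (- simple p) = simple p"
    using p refl_self simple_in_real_roots W_uminus[of "srefl p"] by simp_all
  have "srefl p x = simple p \<longleftrightarrow> x = - simple p" "srefl p x = - simple p \<longleftrightarrow> x = simple p" for x
    using s p by (metis srefl_srefl(1))+
  then show ?thesis by (auto simp: event_def)
qed

lemma event_fold:
  assumes "u \<in> W" "event u b"
  shows "u \<circ> refl b = srefl p \<circ> u"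
  using assms refl_W_comp[of u b] by (metis event_def refl_minus_root)

lemma event_neg:
  assumes "u \<in> W" "b \<in> proots" "event u b"
  shows "u b = (if neg u then - simple p else simple p)"
  using assms length_left_root[OF assms(1) p assms(2)] by (auto simp: neg_def event_def)

lemma neg_iff_root:
  assumes "u \<in> W" "c \<in> roots" "u c = simple p"
  shows "c \<in> proots \<longleftrightarrow> \<not> neg u"
proof (cases "c \<in> proots")
  case True
  then show ?thesis using length_left_root(1)[OF assms(1) p True assms(3)] by (simp add: neg_def)
next
  case False
  then have "- c \<in> proots" using assms not_proots_iff by blast
  moreover have "u (- c) = - simple p" using assms(3) W_uminus[OF assms(1)] by simp
  ultimately show ?thesis using length_left_root(2)[OF assms(1) p, of "- c"] False by (simp add: neg_def)
qed

definition events :: "'i set \<Rightarrow> 'i set" where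
  "events J = {i \<in> I. event (wfold J (Fin i)) (\<beta> i)}"

definition turns :: "'i set \<Rightarrow> 'i set" where
  "turns J = {j \<in> J - events J. neg (wfold J (Fin j)) \<and> \<not> neg (wfold J (Fin j) \<circ> refl (\<beta> j))}"

text \<open>A finite \<open>J\<close> produces finitely many linear parts even if the chain is
  infinite, and each preimage of +-\<alpha>_p under one of them occurs finitely often in the
  chain.\<close>

lemma finite_events:
  assumes "finite J" "J \<subseteq> I"
  shows "finite (events J)"
proof (rule finite_subset)
  define P where "P S = refl_prod form (map \<beta> (sorted_list_of_set S))" for S
  let ?A = "\<lambda>S. {i \<in> I. \<beta> i = inv (P S) (simple p)} \<union> {i \<in> I. \<beta> i = inv (P S) (- simple p)}"
  show "events J \<subseteq> (\<Union>S\<in>Pow J. ?A S)"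
  proof
    fix i assume i: "i \<in> events J"
    let ?w = "wfold J (Fin i)"
    have "\<beta> i = inv ?w (?w (\<beta> i))" using wfold_W[OF assms] by simp
    then have "\<beta> i = inv ?w (simple p) \<or> \<beta> i = inv ?w (- simple p)"
      using i unfolding events_def event_def by auto
    moreover have "?w = P (cut J (Fin i))" by (simp add: P_def wfold_def)
    ultimately have "i \<in> ?A (cut J (Fin i))" using i by (auto simp: events_def)
    then show "i \<in> (\<Union>S\<in>Pow J. ?A S)" using cut_subset[of J "Fin i"] by blast
  qed
  show "finite (\<Union>S\<in>Pow J. ?A S)" using assms(1) finite_beta by simp
qed

text \<open>The left-hand side is the index of the strip between hyperplanes of \<open>\<alpha>\<^sub>p\<close> that contains the
  folded path at time \<open>t\<close>.\<close>

lemma height_formula: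
  assumes J: "finite J" "J \<subseteq> I" and c: "c \<in> roots" "wfold J t c = simple p"
  shows "N t c + pair (afold J t 0) (simple p) =
    (\<Sum>e\<in>{e \<in> events J. Fin e < t \<and> e \<notin> J}. if neg (wfold J (Fin e)) then -1 else 1)"
  using J(1) c
proof (induction t arbitrary: c rule: cut_induct)
  case (empty t)
  have w: "wfold J t = id" "afold J t 0 = 0" using empty by (simp_all add: wfold_empty afold_empty)
  have we: "wfold J (Fin e) = id" if "Fin e < t" for e
    using empty(1) that by (intro wfold_empty) (meson less_trans)
  have c: "c = simple p" using w empty by simp
  have "{e \<in> events J. Fin e < t \<and> e \<notin> J} = {e \<in> I. Fin e < t \<and> \<beta> e = c}"
    using empty(1) we beta_proots simple_proots[OF p] proots_neq_uminus
    by (auto simp: events_def event_def c)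
  moreover have "(\<Sum>e\<in>{e \<in> I. Fin e < t \<and> \<beta> e = c}. if neg (wfold J (Fin e)) then -1 else 1 :: real) =
      (\<Sum>e\<in>{e \<in> I. Fin e < t \<and> \<beta> e = c}. 1)"
    using we by (intro sum.cong) (auto simp del: id_apply)
  ultimately show ?case using simple_proots[OF p] w c by (simp add: N_def)
next
  case (last t j)
  let ?b = "\<beta> j" and ?u = "wfold J (Fin j)"
  \<comment> \<open>The root that the linear part before the fold sends to \<alpha>_p.\<close>
  define c' where "c' = refl ?b c"
  have jI: "j \<in> I" using last.hyps J by blast
  have b: "?b \<in> proots" "?b \<in> roots" using jI beta_proots beta_roots by auto
  have u: "?u \<in> W" using wfold_W[OF J] .
  have wt: "wfold J t = ?u \<circ> refl ?b" using wfold_last[OF J(1) last.hyps(2,3)] last.hyps(1) by simp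
  have c': "c' \<in> roots" "?u c' = simple p" "refl ?b c' = c"
    using last.prems(2) W_roots[OF refl_W_root[OF b(2)] last.prems(1)] refl_refl[OF b(2)]
    by (simp_all add: c'_def wt)
  have af: "afold J t 0 = ?u (of_int (level j) *\<^sub>R ?b) + afold J (Fin j) 0"
    using afold_last[OF J(1) last.hyps(2,3)] last.hyps(1) afold_affine[OF J, of "Fin j" "of_int (level j) *\<^sub>R ?b"]
    by (simp add: aff_refl_def root_refl_def)
  have "pair (?u ?b) (simple p) = pair ?b c'" using pair_W[OF u, of ?b c'] c'(2) by simp
  then have pr: "pair (afold J t 0) (simple p) = of_int (level j) * pair ?b c' + pair (afold J (Fin j) 0) (simple p)"
    using u by (simp add: af W_linear linear_scale form_bilin)
  \<comment> \<open>After the last fold \<open>j\<close> the linear part is constant up to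
    \<open>t\<close>, so the events in between are the indices with root c or -c.\<close>
  define M where "M a = {i \<in> I. Fin j < Fin i \<and> Fin i < t \<and> \<beta> i = a}" for a
  have finM: "finite (M a)" for a by (rule finite_subset[OF _ finite_beta[of a]]) (auto simp: M_def)
  have card: "real (card {i \<in> I. Fin j \<le> Fin i \<and> Fin i < t \<and> \<beta> i = a}) = (if ?b = a then 1 else 0) + real (card (M a))" for a
  proof -
    have "{i \<in> I. Fin j \<le> Fin i \<and> Fin i < t \<and> \<beta> i = a} = (if ?b = a then insert j (M a) else M a)"
      using jI last.hyps(2) by (auto simp: M_def order_le_less)
    moreover have "j \<notin> M a" by (simp add: M_def)
    ultimately show ?thesis using finM by simp
  qed
  have N: "N t c = N (Fin j) c + (if ?b = c then 1 else 0) + real (card (M c)) - (if ?b = - c then 1 else 0) - real (card (M (- c)))"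
    using N_diff[OF last.prems(1), of "Fin j" t] last.hyps(2) card[of c] card[of "- c"] by simp
  have mid: "wfold J (Fin e) = wfold J t" if "j < e" "Fin e < t" for e
  proof -
    have "cut J (Fin e) = cut J t"
      using cut_last[of j "Fin e" J] cut_last[of j t J] last.hyps that
      by (metis less_extended_simps(1) less_trans)
    then show ?thesis by (simp add: wfold_def)
  qed
  have ev: "{e \<in> events J. Fin e < t \<and> e \<notin> J} = {e \<in> events J. Fin e < Fin j \<and> e \<notin> J} \<union> (M c \<union> M (- c))"
  proof -
    have inj: "wfold J t x = simple p \<longleftrightarrow> x = c" "wfold J t x = - simple p \<longleftrightarrow> x = - c" for x
      using last.prems(2) W_inj[OF wfold_W[OF J, of t]] W_uminus[OF wfold_W[OF J, of t]] by metis+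
    have "e \<in> events J \<and> e \<notin> J \<longleftrightarrow> e \<in> M c \<union> M (- c)" if e: "j < e" "Fin e < t" for e
      using last.hyps(3)[of e] e mid[OF e] inj by (auto simp: events_def event_def M_def)
    moreover have "Fin e < t" if "e < j" for e using that last.hyps(2) by (metis less_extended_simps(1) less_trans)
    ultimately have "e \<in> events J \<and> Fin e < t \<and> e \<notin> J \<longleftrightarrow>
        e \<in> events J \<and> Fin e < Fin j \<and> e \<notin> J \<or> e \<in> M c \<union> M (- c)" for e
      using last.hyps(1) by (cases e j rule: linorder_cases) (auto simp: M_def)
    then show ?thesis by blast
  qed
  let ?s = "\<lambda>e. if neg (wfold J (Fin e)) then -1 else 1 :: real"
  have cpos: "c \<in> proots \<longleftrightarrow> \<not> neg (wfold J t)"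
    using neg_iff_root[OF wfold_W[OF J]] last.prems by simp
  have Mne: "M a = {}" if "a \<notin> proots" for a using that beta_proots by (auto simp: M_def)
  have Msum: "sum ?s (M c \<union> M (- c)) = real (card (M c)) - real (card (M (- c)))"
  proof (cases "c \<in> proots")
    case True
    then have "M (- c) = {}" using Mne proots_uminus by blast
    moreover have "sum ?s (M c) = (\<Sum>e\<in>M c. 1)"
      using True cpos mid by (intro sum.cong) (auto simp: M_def)
    ultimately show ?thesis by simp
  next
    case False
    then have "M c = {}" using Mne by blast
    moreover have "sum ?s (M (- c)) = (\<Sum>e\<in>M (- c). -1)"
      using False cpos mid by (intro sum.cong) (auto simp: M_def)
    ultimately show ?thesis by simp
  qed
  have "sum ?s {e \<in> events J. Fin e < t \<and> e \<notin> J} =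
      sum ?s {e \<in> events J. Fin e < Fin j \<and> e \<notin> J} + sum ?s (M c \<union> M (- c))"
    unfolding ev by (rule sum.union_disjoint) (use finite_events[OF J] finM in \<open>auto simp: M_def\<close>)
  also have "\<dots> = N (Fin j) c' + pair (afold J (Fin j) 0) (simple p) + real (card (M c)) - real (card (M (- c)))"
    using last.IH[OF c'(1,2)] Msum by simp
  \<comment> \<open>\<open>N\<close> counts \<open>j\<close> itself if its root is +-c, whereas the
    sum omits \<open>j\<close> as a fold; \<open>N_fold\<close> balances this against the
    translation part of the affine reflection.\<close>
  finally show ?case using N_fold[OF jI c'(1)] N pr unfolding c'(3) by simp
qed

text \<open>The height formula at the end of the chain. The last term is the 1 by which
  \<open>N Pinf c\<close> exceeds <\<lambda>, c^v> for a negative root c.\<close>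

lemma pair_wt:
  assumes J: "finite J" "J \<subseteq> I"
  shows "pair (wt J) (simple p) = (\<Sum>e\<in>events J - J. if neg (wfold J (Fin e)) then -1 else 1)
    - (if neg (wfold J Pinf) then 1 else 0)"
proof -
  let ?w = "wfold J Pinf"
  define c where "c = inv ?w (simple p)"
  have w: "?w \<in> W" by (rule wfold_W[OF J])
  have c: "c \<in> roots" "?w c = simple p"
    using w W_roots[OF inv_W[OF w] simple_in_real_roots[OF p]] by (simp_all add: c_def)
  have cpos: "c \<in> proots \<longleftrightarrow> \<not> neg ?w" by (rule neg_iff_root[OF w c])
  have "pair (wt J) (simple p) = pair (?w lam) (?w c) + pair (afold J Pinf 0) (simple p)"
    unfolding wt_afold by (subst afold_affine[OF J]) (simp add: form_bilin c)
  also have "pair (?w lam) (?w c) = pair lam c" by (rule pair_W[OF w])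
  finally show ?thesis using height_formula[OF J c] N_infinity[OF c(1)] cpos
    by (cases "neg ?w") (simp_all add: set_diff_eq)
qed

text \<open>At an event the affine reflection moves its argument along \<beta>_j, which the linear
  part sends to +-\<alpha>_p. Modulo \<alpha>_p the weight thus depends only on the folds that a
  flip keeps.\<close>

lemma afold_mod_root:
  assumes J: "finite J" "J \<subseteq> I"
  shows "\<exists>x. afold J t v = afold (J - events J) t v + x *\<^sub>R simple p"
  using J(1)
proof (induction t arbitrary: v rule: cut_induct)
  case (empty t)
  then have "afold J t = id" "afold (J - events J) t = id" by (auto intro: afold_empty)
  then show ?case by (intro exI[of _ 0]) simp
next
  case (last t j)
  let ?K = "J - events J" and ?u = "wfold J (Fin j)"
  let ?v = "aff_refl form (\<beta> j) (level j) v"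
  have u: "?u \<in> W" by (rule wfold_W[OF J])
  have J1: "afold J t v = afold J (Fin j) ?v"
    using afold_last[OF J(1) last.hyps(2,3)] last.hyps(1) by simp
  have K1: "afold ?K t = (if j \<in> ?K then afold ?K (Fin j) \<circ> aff_refl form (\<beta> j) (level j) else afold ?K (Fin j))"
    using J(1) last.hyps by (intro afold_last) auto
  show ?case
  proof (cases "j \<in> events J")
    case False
    then show ?thesis using J1 K1 last.IH[of ?v] last.hyps(1) by simp
  next
    case True
    define z where "z = of_int (level j) - pair v (\<beta> j)"
    have z: "?v = v + z *\<^sub>R \<beta> j" by (simp add: z_def aff_refl_def root_refl_def scaleR_diff_left)
    obtain y where y: "?u (\<beta> j) = y *\<^sub>R simple p"
      using True unfolding events_def event_def by (metis (mono_tags, lifting) mem_Collect_eq scaleR_minus1_left scaleR_one)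
    have "afold J (Fin j) ?v = afold J (Fin j) v + (z * y) *\<^sub>R simple p"
      using u afold_affine[OF J, of "Fin j" "v + z *\<^sub>R \<beta> j"] afold_affine[OF J, of "Fin j" v]
      by (simp add: z W_linear linear_add linear_scale y)
    moreover obtain x where "afold J (Fin j) v = afold ?K (Fin j) v + x *\<^sub>R simple p" using last.IH by blast
    ultimately show ?thesis using J1 K1 True by (intro exI[of _ "x + z * y"]) (simp add: scaleR_add_left)
  qed
qed

section \<open>Moving the folds within their segments\<close>

definition stops :: "'i extended set \<Rightarrow> 'i set \<Rightarrow> 'i extended set" where
  "stops B J = Fin ` events J \<union> B"

definition marks :: "'i extended set \<Rightarrow> 'i set \<Rightarrow> 'i extended set" where
  "marks B J = Fin ` (J \<inter> events J) \<union> (if neg (wfold J Pinf) then {} else B)"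

definition rebuild :: "'i set \<Rightarrow> 'i extended set \<Rightarrow> 'i set" where
  "rebuild J F = (J - events J) \<union> {j. Fin j \<in> F}"

text \<open>With \<open>B = {}\<close> the flip is only used for paths ending in the negative half space of
  \<open>\<alpha>\<^sub>p\<close>; with \<open>B = {Pinf}\<close> the end point counts as an additional event, at which
  paths ending in the positive half space are folded.\<close>

definition closing :: "'i extended set \<Rightarrow> 'i set \<Rightarrow> bool" where
  "closing B J \<longleftrightarrow> B = {} \<and> neg (wfold J Pinf) \<or> B = {Pinf}"

definition flip :: "'i extended set \<Rightarrow> 'i set \<Rightarrow> 'i set" where
  "flip B J = rebuild J (reversal (stops B J) (cut (turns J)) ` marks B J)"

lemma turns_subset: "turns J \<subseteq> J - events J"
  by (auto simp: turns_def)

text \<open>On the negative side the root of an event is sent to -\<alpha>_p, and folding there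
  would go down in the Bruhat order.\<close>

lemma fold_event:
  assumes "adm J" "j \<in> J" "j \<in> events J"
  shows "\<not> neg (wfold J (Fin j))"
proof
  assume n: "neg (wfold J (Fin j))"
  note w = wfold_W[OF adm_finite[OF assms(1)] adm_subset[OF assms(1)]]
  have "wfold J (Fin j) (\<beta> j) = - simple p"
    using event_neg[OF w beta_proots, of j "Fin j"] n assms(3) by (simp add: events_def)
  then show False using adm_fold_positive[OF assms(1,2)] simple_proots[OF p] proots_uminus by auto
qed

text \<open>By \<open>cover_descent\<close> a cover leads from the positive to the negative side
  only at an event; the opposite change is a turn by definition.\<close>

lemma fold_nonevent:
  assumes "adm J" "j \<in> J" "j \<notin> events J" "j \<notin> turns J"
  shows "neg (wfold J (Fin j) \<circ> refl (\<beta> j)) \<longleftrightarrow> neg (wfold J (Fin j))"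
proof -
  note w = wfold_W[OF adm_finite[OF assms(1)] adm_subset[OF assms(1)]]
  have j: "j \<in> I" using assms adm_subset by blast
  have ne: "wfold J (Fin j) (\<beta> j) \<noteq> simple p" using assms(3) j by (auto simp: events_def event_def)
  have "\<not> neg (wfold J (Fin j) \<circ> refl (\<beta> j))" if "\<not> neg (wfold J (Fin j))"
  proof
    assume "neg (wfold J (Fin j) \<circ> refl (\<beta> j))"
    moreover have "len (wfold J (Fin j)) < len (srefl p \<circ> wfold J (Fin j))"
      using that length_left_cases[OF w p, of "Fin j"] unfolding neg_def by linarith
    ultimately show False
      using cover_descent[OF w beta_proots[OF j] p adm_cover[OF assms(1,2)]] ne unfolding neg_def by blast
  qed
  then show ?thesis using assms by (auto simp: turns_def simp del: comp_apply)
qed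

text \<open>A turn opens a new segment and resets \<open>passed\<close>, an element of
  \<open>F\<close> sets it, and any other index leaves it alone. \<open>neg\<close> follows the same
  rule, which is the proof of \<open>neg_iff_passed\<close>.\<close>

lemma passed_last:
  assumes gap: "Fin j < t" "\<And>i. i \<in> S \<Longrightarrow> j < i \<Longrightarrow> \<not> Fin i < t"
    and T: "T \<subseteq> S" and F: "\<And>i. Fin i \<in> F \<Longrightarrow> i \<in> S - T" "Minf \<notin> F"
  shows "passed T F t \<longleftrightarrow> j \<notin> T \<and> (Fin j \<in> F \<or> passed T F (Fin j))"
proof -
  have cutT: "cut T t = (if j \<in> T then insert j (cut T (Fin j)) else cut T (Fin j))"
    using gap T by (intro cut_last) auto
  have less: "f < t \<longleftrightarrow> f = Fin j \<or> f < Fin j" if "f \<in> F" for f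
  proof (cases f)
    case (Fin i)
    then have "i \<in> S" using F(1) that by blast
    then have "Fin i < t \<longleftrightarrow> i = j \<or> i < j" using gap_before[of j t S i] gap by blast
    then show ?thesis using Fin by simp
  qed (use that F(2) in simp_all)
  show ?thesis
  proof (cases "j \<in> T")
    case True
    have "\<not> passed T F t"
    proof
      assume "passed T F t"
      then obtain f where f: "f \<in> F" "f < t" "cut T f = cut T t" by (auto simp: passed_def)
      have "j \<in> cut T f" using f(3) True gap(1) by (simp add: cut_def)
      then show False using less[OF f(1)] f(2) F(1)[of j] f(1) True by (auto simp: cut_def)
    qed
    then show ?thesis using True by simp
  next
    case False
    then show ?thesis using less cutT unfolding passed_def by auto
  qed
qed

lemma marks_Fin: "Fin i \<in> marks B J \<longleftrightarrow> i \<in> J \<and> i \<in> events J" if "closing B J"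
  using that by (auto simp: marks_def closing_def)

lemma neg_iff_passed:
  assumes "adm J" "closing B J"
  shows "neg (wfold J t) \<longleftrightarrow> passed (turns J) (marks B J) t"
  using adm_finite[OF assms(1)]
proof (induction t rule: cut_induct)
  case (empty t)
  have "\<not> passed (turns J) (marks B J) t"
  proof
    assume "passed (turns J) (marks B J) t"
    then obtain f where f: "f \<in> marks B J" "f < t" by (auto simp: passed_def)
    then show False using empty assms(2) by (cases f) (auto simp: marks_Fin marks_def closing_def split: if_splits)
  qed
  then show ?case using empty by (simp add: wfold_empty del: id_apply)
next
  case (last t j)
  let ?u = "wfold J (Fin j)"
  have w: "?u \<in> W" by (rule wfold_W[OF adm_finite[OF assms(1)] adm_subset[OF assms(1)]])
  have wt: "wfold J t = ?u \<circ> refl (\<beta> j)"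
    using wfold_last[OF adm_finite[OF assms(1)] last.hyps(2,3)] last.hyps(1) by simp
  have ps: "passed (turns J) (marks B J) t \<longleftrightarrow>
      j \<notin> turns J \<and> (Fin j \<in> marks B J \<or> passed (turns J) (marks B J) (Fin j))"
    using assms(2) turns_subset[of J] last.hyps
    by (intro passed_last[where S = J]) (auto simp: marks_Fin marks_def closing_def split: if_splits)
  consider "j \<in> events J" | "j \<in> turns J" | "j \<notin> events J" "j \<notin> turns J" by blast
  then show ?case
  proof cases
    case 1
    then have "?u \<circ> refl (\<beta> j) = srefl p \<circ> ?u" using event_fold[OF w] by (simp add: events_def)
    then have "neg (wfold J t)" using wt neg_srefl[OF w] fold_event[OF assms(1) last.hyps(1) 1] by metis
    then show ?thesis using ps 1 last.hyps(1) turns_subset[of J] marks_Fin[OF assms(2)] by auto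
  next
    case 2
    then have "\<not> neg (wfold J t)" unfolding wt by (simp add: turns_def)
    then show ?thesis using ps 2 by simp
  next
    case 3
    then have "neg (wfold J t) \<longleftrightarrow> neg ?u" unfolding wt by (rule fold_nonevent[OF assms(1) last.hyps(1)])
    then show ?thesis using ps 3 last.IH marks_Fin[OF assms(2)] by simp
  qed
qed

text \<open>Of two marks in a segment the later one would be made on the negative side, which is
  impossible. A turn starts on the negative side, so a mark precedes it in its segment; in the last
  segment either the path ends negative or the end is itself a mark.\<close>

lemma transversal_marks:
  assumes J: "adm J" "closing B J"
  shows "transversal (stops B J) (turns J) (marks B J)"
proof -
  let ?T = "turns J" and ?F = "marks B J"
  have F_neg: "\<not> passed ?T ?F f" if "f \<in> ?F" for f
    using that fold_event[OF J(1)] J(2) unfolding neg_iff_passed[OF J, symmetric]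
    by (auto simp: marks_def closing_def split: if_splits)
  have turn: "\<exists>f\<in>?F. cut ?T f = cut ?T (Fin s)" if "s \<in> ?T" for s
  proof -
    have "passed ?T ?F (Fin s)" using that unfolding neg_iff_passed[OF J, symmetric] by (simp add: turns_def)
    then show ?thesis by (auto simp: passed_def)
  qed
  have stop: "\<exists>f\<in>?F. cut ?T f = cut ?T e" if e: "e \<in> stops B J" for e
  proof (cases "\<exists>s\<in>?T. e < Fin s")
    case True
    have fin: "finite {s \<in> ?T. e < Fin s}"
      by (rule finite_subset[OF _ adm_finite[OF J(1)]]) (auto simp: turns_def)
    \<comment> \<open>The first turn after \<open>e\<close> ends the segment of
      \<open>e\<close>.\<close>
    define s where "s = Min {s \<in> ?T. e < Fin s}"
    have s: "s \<in> ?T" "e < Fin s" "\<And>s'. s' \<in> ?T \<Longrightarrow> e < Fin s' \<Longrightarrow> s \<le> s'"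
      using True Min_in[OF fin] Min_le[OF fin] unfolding s_def by blast+
    have ne: "e \<noteq> Fin s'" if "s' \<in> ?T" for s'
      using that e J(2) turns_subset[of J] by (auto simp: stops_def closing_def)
    have "cut ?T e = cut ?T (Fin s)"
      using s ne unfolding cut_def by (auto dest: less_trans) (metis linorder_neqE not_less)
    then show ?thesis using turn[OF s(1)] by simp
  next
    case False
    have ne: "e \<noteq> Fin s'" if "s' \<in> ?T" for s'
      using that e J(2) turns_subset[of J] by (auto simp: stops_def closing_def)
    have cute: "cut ?T e = cut ?T Pinf"
      using False ne unfolding cut_def by (auto) (metis linorder_neqE)
    show ?thesis
    proof (cases "neg (wfold J Pinf)")
      case True
      then have "passed ?T ?F Pinf" by (simp add: neg_iff_passed[OF J])
      then show ?thesis using cute by (auto simp: passed_def)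
    next
      case False
      then have "Pinf \<in> ?F" using J(2) by (auto simp: marks_def closing_def)
      then show ?thesis using cute by metis
    qed
  qed
  have unique: "f = f'" if f: "f \<in> ?F" "f' \<in> ?F" "cut ?T f = cut ?T f'" for f f'
  proof (rule ccontr)
    assume "f \<noteq> f'"
    then consider "f < f'" | "f' < f" by (metis linorder_neqE)
    then show False using F_neg f unfolding passed_def by cases metis+
  qed
  have "?F \<subseteq> stops B J" by (auto simp: marks_def stops_def)
  then show ?thesis unfolding transversal_def using turn stop unique by blast
qed

text \<open>At every time the new path is the old one or its mirror image, whichever lies on the
  side prescribed by \<open>F\<close>. Folding at an event toggles between the two, and at turns
  they have to agree.\<close>

lemma wfold_rebuild:
  assumes J: "adm J" "closing B J" and F: "transversal (stops B J) (turns J) F"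
  shows "wfold (rebuild J F) t =
    (if passed (turns J) F t = neg (wfold J t) then wfold J t else srefl p \<circ> wfold J t)"
proof -
  let ?J = "rebuild J F" and ?T = "turns J"
  note fin = adm_finite[OF J(1)] and sub = adm_subset[OF J(1)]
  have F_ev: "i \<in> events J" if "Fin i \<in> F" for i
    using that F J(2) by (auto simp: transversal_def stops_def closing_def)
  have F_Minf: "Minf \<notin> F" using F J(2) by (auto simp: transversal_def stops_def closing_def)
  have F_uniq: "f = f'" if "f \<in> F" "f' \<in> F" "cut ?T f = cut ?T f'" for f f'
    using that F by (auto simp: transversal_def)
  have fin': "finite ?J"
    using fin finite_subset[of "{j. Fin j \<in> F}" "events J"] F_ev finite_events[OF fin sub] by (auto simp: rebuild_def)
  have "finite (J \<union> ?J)" using fin fin' by simp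
  then show ?thesis
  proof (induction t rule: cut_induct)
    case (empty t)
    have "\<not> passed ?T F t"
    proof
      assume "passed ?T F t"
      then obtain f where "f \<in> F" "f < t" by (auto simp: passed_def)
      then show False using empty F_Minf by (cases f) (auto simp: rebuild_def)
    qed
    moreover have "wfold J t = id" "wfold ?J t = id" using empty by (auto intro: wfold_empty)
    ultimately show ?case by (simp del: id_apply)
  next
    case (last t j)
    let ?u = "wfold J (Fin j)" and ?u' = "wfold ?J (Fin j)"
    have w: "?u \<in> W" by (rule wfold_W[OF fin sub])
    have wt: "wfold J t = (if j \<in> J then ?u \<circ> refl (\<beta> j) else ?u)"
      using last.hyps by (intro wfold_last[OF fin]) auto
    have wt': "wfold ?J t = (if j \<in> ?J then ?u' \<circ> refl (\<beta> j) else ?u')"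
      using last.hyps by (intro wfold_last[OF fin']) auto
    have ps: "passed ?T F t \<longleftrightarrow> j \<notin> ?T \<and> (Fin j \<in> F \<or> passed ?T F (Fin j))"
      using turns_subset[of J] last.hyps F_Minf F_ev
      by (intro passed_last[where S = "J \<union> ?J"]) (auto simp: rebuild_def)
    consider "j \<in> events J" | "j \<in> ?T" | "j \<notin> events J" "j \<notin> ?T" by blast
    then show ?case
    proof cases
      case 1
      have jT: "j \<notin> ?T" using 1 turns_subset[of J] by blast
      have fold: "?u \<circ> refl (\<beta> j) = srefl p \<circ> ?u" using 1 event_fold[OF w] by (simp add: events_def)
      have fold': "srefl p \<circ> ?u \<circ> refl (\<beta> j) = ?u" using fold p by (simp only: comp_assoc srefl_left_cancel)
      have jJ: "j \<in> ?J \<longleftrightarrow> Fin j \<in> F" using 1 by (auto simp: rebuild_def)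
      have n: "neg (wfold J t) \<longleftrightarrow> j \<in> J \<or> neg ?u"
        using wt fold neg_srefl[OF w] fold_event[OF J(1) _ 1] by (cases "j \<in> J") auto
      have nF: "\<not> passed ?T F (Fin j)" if "Fin j \<in> F"
        using that F_uniq unfolding passed_def by (metis less_irrefl)
      have nJ: "\<not> neg ?u" if "j \<in> J" using fold_event[OF J(1) that 1] .
      show ?thesis
        using wt wt' fold fold' n nF nJ last.IH jJ jT ps p by (cases "j \<in> J"; cases "Fin j \<in> F") (auto split: if_splits simp del: comp_apply)
    next
      case 2
      have "neg ?u" "\<not> neg (?u \<circ> refl (\<beta> j))" "j \<in> J" "j \<in> ?J"
        using 2 by (auto simp: turns_def rebuild_def)
      \<comment> \<open>\<open>F\<close> meets the segment that ends at this turn, hence before it,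
        so the new path is on the negative side as well and equals the old one.\<close>
      moreover have "passed ?T F (Fin j)"
      proof -
        obtain f where f: "f \<in> F" "cut ?T f = cut ?T (Fin j)" using F 2 by (auto simp: transversal_def)
        have "\<not> Fin j < f" using f(2) 2 by (auto simp: cut_def)
        moreover have "f \<noteq> Fin j" using f(1) F_ev 2 turns_subset[of J] by blast
        ultimately show ?thesis using f unfolding passed_def by (metis linorder_neqE)
      qed
      ultimately show ?thesis using wt wt' last.IH ps 2 by (simp del: comp_apply)
    next
      case 3
      have "j \<in> J \<longleftrightarrow> j \<in> ?J" "Fin j \<notin> F" using 3 F_ev by (auto simp: rebuild_def)
      then have jJ: "j \<in> J" "j \<in> ?J" "Fin j \<notin> F" using last.hyps(1) by auto
      then have "neg (wfold J t) \<longleftrightarrow> neg ?u" using fold_nonevent[OF J(1) _ 3] wt by simp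
      moreover have "passed ?T F t \<longleftrightarrow> passed ?T F (Fin j)" using ps 3 jJ by simp
      ultimately show ?thesis using wt wt' jJ last.IH by (simp add: comp_assoc del: comp_apply)
    qed
  qed
qed

lemma rebuild_props:
  assumes J: "adm J" "closing B J" and F: "transversal (stops B J) (turns J) F"
  shows neg_rebuild: "neg (wfold (rebuild J F) t) \<longleftrightarrow> passed (turns J) F t"
    and adm_rebuild: "adm (rebuild J F)"
    and events_rebuild: "events (rebuild J F) = events J"
    and turns_rebuild: "turns (rebuild J F) = turns J"
    and marks_rebuild: "B = {Pinf} \<or> neg (wfold (rebuild J F) Pinf) \<Longrightarrow> marks B (rebuild J F) = F"
proof -
  let ?J = "rebuild J F" and ?T = "turns J"
  note fin = adm_finite[OF J(1)] and sub = adm_subset[OF J(1)]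
  note wr = wfold_rebuild[OF J F]
  have w: "wfold J t \<in> W" for t by (rule wfold_W[OF fin sub])
  have F_ev: "i \<in> events J" if "Fin i \<in> F" for i
    using that F J(2) by (auto simp: transversal_def stops_def closing_def)
  have neg': "neg (wfold ?J t) \<longleftrightarrow> passed ?T F t" for t
    using wr[of t] neg_srefl[OF w, of t] by (auto simp del: comp_apply)
  show "neg (wfold ?J t) \<longleftrightarrow> passed ?T F t" by (rule neg')
  have ev: "event (wfold ?J t) b \<longleftrightarrow> event (wfold J t) b" for t b
    unfolding wr by (simp add: event_srefl del: comp_apply)
  then show events: "events ?J = events J" by (simp add: events_def)
  have fin': "finite ?J" and sub': "?J \<subseteq> I"
    using fin sub finite_subset[of "{j. Fin j \<in> F}" "events J"] F_ev finite_events[OF fin sub]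
    by (auto simp: rebuild_def events_def)
  have w': "wfold ?J t \<in> W" for t by (rule wfold_W[OF fin' sub'])
  have K: "j \<in> ?J \<and> j \<notin> events J \<longleftrightarrow> j \<in> J \<and> j \<notin> events J" for j
    using F_ev by (auto simp: rebuild_def)
  have turn: "wfold ?J (Fin j) = wfold J (Fin j)" if j: "j \<in> ?T" for j
  proof -
    obtain f where f: "f \<in> F" "cut ?T f = cut ?T (Fin j)" using F j by (auto simp: transversal_def)
    have "\<not> Fin j < f" using f(2) j by (auto simp: cut_def)
    moreover have "f \<noteq> Fin j" using f(1) F_ev j turns_subset[of J] by blast
    ultimately have "passed ?T F (Fin j)" using f unfolding passed_def by (metis linorder_neqE)
    then show ?thesis using j by (simp add: wr turns_def)
  qed
  \<comment> \<open>Such a fold stays on one side of \<alpha>_p, so mirroring shifts the lengths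
    before and after it by the same amount and the cover survives.\<close>
  have nonturn: "neg (wfold ?J (Fin j) \<circ> refl (\<beta> j)) \<longleftrightarrow> neg (wfold ?J (Fin j))"
    "len (wfold ?J (Fin j) \<circ> refl (\<beta> j)) = len (wfold ?J (Fin j)) + 1"
    if j: "j \<in> J" "j \<notin> events J" "j \<notin> ?T" for j
  proof -
    let ?u = "wfold J (Fin j)"
    have r: "?u \<circ> refl (\<beta> j) \<in> W" using j(1) sub by (intro W_comp w refl_W_root beta_roots) auto
    note n = fold_nonevent[OF J(1) j] and c = adm_cover[OF J(1) j(1)]
    have "int (len (srefl p \<circ> ?u \<circ> refl (\<beta> j))) = int (len (srefl p \<circ> ?u)) + 1"
      using len_srefl_neg[OF r] len_srefl_neg[OF w, of "Fin j"] n c by (simp add: comp_assoc del: comp_apply)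
    moreover have "neg (srefl p \<circ> ?u \<circ> refl (\<beta> j)) \<longleftrightarrow> neg (srefl p \<circ> ?u)"
      using neg_srefl[OF r] neg_srefl[OF w, of "Fin j"] n by (simp add: comp_assoc del: comp_apply)
    ultimately show "neg (wfold ?J (Fin j) \<circ> refl (\<beta> j)) \<longleftrightarrow> neg (wfold ?J (Fin j))"
      "len (wfold ?J (Fin j) \<circ> refl (\<beta> j)) = len (wfold ?J (Fin j)) + 1"
      using wr[of "Fin j"] n c by (auto simp del: comp_apply split: if_splits)
  qed
  show "turns ?J = turns J"
  proof (intro equalityI subsetI)
    fix j assume j: "j \<in> turns ?J"
    then have "j \<in> J" "j \<notin> events J" using K[of j] by (auto simp: turns_def events)
    then show "j \<in> turns J" using nonturn(1)[of j] j unfolding turns_def by blast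
  next
    fix j assume j: "j \<in> turns J"
    then have "j \<in> ?J" "j \<notin> events ?J" using K[of j] turns_subset[of J] by (auto simp: events)
    then show "j \<in> turns ?J" using turn[OF j] j by (simp add: turns_def del: comp_apply)
  qed
  show "adm ?J" unfolding admissible_iff
  proof (intro conjI ballI)
    fix j assume j: "j \<in> ?J"
    consider "Fin j \<in> F" | "j \<in> ?T" | "j \<in> J" "j \<notin> events J" "j \<notin> ?T"
      using j by (auto simp: rebuild_def)
    then show "len (wfold ?J (Fin j) \<circ> refl (\<beta> j)) = len (wfold ?J (Fin j)) + 1"
    proof cases
      case 1
      \<comment> \<open>\<open>F\<close> has no second element in this segment, so the new fold
        starts on the positive side and goes up by one.\<close>
      have "\<not> passed ?T F (Fin j)" using F 1 unfolding transversal_def passed_def by (metis less_irrefl)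
      then have n: "\<not> neg (wfold ?J (Fin j))" using neg' by simp
      have "event (wfold ?J (Fin j)) (\<beta> j)" using F_ev[OF 1] ev by (simp add: events_def)
      then have "wfold ?J (Fin j) \<circ> refl (\<beta> j) = srefl p \<circ> wfold ?J (Fin j)" by (rule event_fold[OF w'])
      then show ?thesis using len_srefl_neg[OF w', of "Fin j"] n by (simp del: comp_apply)
    next
      case 2
      then show ?thesis using turn[OF 2] adm_cover[OF J(1), of j] turns_subset[of J] by auto
    next
      case 3
      then show ?thesis by (rule nonturn(2))
    qed
  qed (use fin' sub' in auto)
  have uniq: "f = f'" if "f \<in> F" "f' \<in> F" "cut ?T f = cut ?T f'" for f f'
    using that F by (auto simp: transversal_def)
  have Finmarks: "Fin ` (?J \<inter> events ?J) = F - {Pinf}"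
  proof -
    have "f = Pinf \<or> (\<exists>i. f = Fin i)" if "f \<in> F" for f
      using that F J(2) by (auto simp: transversal_def stops_def closing_def)
    then show ?thesis unfolding events using F_ev by (auto simp: rebuild_def)
  qed
  show "marks B ?J = F" if B: "B = {Pinf} \<or> neg (wfold ?J Pinf)"
  proof (cases "neg (wfold ?J Pinf)")
    case True
    then obtain f where f: "f \<in> F" "f < Pinf" "cut ?T f = cut ?T Pinf"
      unfolding neg' passed_def by blast
    then have "Pinf \<notin> F" using uniq by (metis less_irrefl)
    then show ?thesis using True Finmarks by (simp add: marks_def)
  next
    case False
    then have B: "B = {Pinf}" using B by simp
    then have "Pinf \<in> stops B J" by (simp add: stops_def)
    then obtain f where f: "f \<in> F" "cut ?T f = cut ?T Pinf" using F unfolding transversal_def by blast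
    have "\<not> f < Pinf" using False f unfolding neg' passed_def by blast
    then have "Pinf \<in> F" using f(1) by (cases f) auto
    then show ?thesis using False Finmarks B by (auto simp: marks_def)
  qed
qed

context
  fixes B :: "'i extended set" and J :: "'i set"
  assumes J: "adm J" "closing B J"
begin

lemma reversal_stops: "is_reversal (stops B J) (cut (turns J)) (reversal (stops B J) (cut (turns J)))"
proof -
  have "finite B" using J(2) by (auto simp: closing_def)
  then have "finite (stops B J)" using finite_events adm_finite[OF J(1)] adm_subset[OF J(1)] by (simp add: stops_def)
  then show ?thesis by (rule is_reversal_reversal)
qed

lemma transversal_flip:
  "transversal (stops B J) (turns J) (reversal (stops B J) (cut (turns J)) ` marks B J)"
  by (rule transversal_reversal[OF reversal_stops transversal_marks[OF J]])

lemma adm_flip: "adm (flip B J)"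
  unfolding flip_def by (rule adm_rebuild[OF J transversal_flip])

text \<open>Without the additional event the fold of the last segment stays before the end. The new
  path also ends on the negative side, so it is not mirrored there.\<close>

lemma wfold_flip_Pinf: "B = {} \<Longrightarrow> wfold (flip B J) Pinf = wfold J Pinf"
proof -
  assume B: "B = {}"
  let ?\<pi> = "reversal (stops B J) (cut (turns J))"
  have n: "neg (wfold J Pinf)" using B J(2) by (simp add: closing_def)
  then obtain f where f: "f \<in> marks B J" "cut (turns J) f = cut (turns J) Pinf"
    unfolding neg_iff_passed[OF J] passed_def by blast
  have "f \<in> stops B J" using f(1) transversal_marks[OF J] by (auto simp: transversal_def)
  then have "?\<pi> f \<in> stops B J" "cut (turns J) (?\<pi> f) = cut (turns J) Pinf"
    using reversal_stops f(2) by (auto simp: is_reversal_def)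
  moreover from this have "?\<pi> f < Pinf" using B by (auto simp: stops_def)
  ultimately have "passed (turns J) (?\<pi> ` marks B J) Pinf" using f(1) unfolding passed_def by blast
  then show ?thesis using n unfolding flip_def wfold_rebuild[OF J transversal_flip] by simp
qed

lemma closing_flip: "closing B (flip B J)"
  using J(2) wfold_flip_Pinf by (auto simp: closing_def)

lemma flip_same:
  "events (flip B J) = events J" "turns (flip B J) = turns J" "stops B (flip B J) = stops B J"
  "flip B J - events J = J - events J"
  "marks B (flip B J) = reversal (stops B J) (cut (turns J)) ` marks B J"
proof -
  show 1: "events (flip B J) = events J" unfolding flip_def by (rule events_rebuild[OF J transversal_flip])
  show "turns (flip B J) = turns J" unfolding flip_def by (rule turns_rebuild[OF J transversal_flip])
  show "stops B (flip B J) = stops B J" by (simp add: stops_def 1)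
  have "i \<in> events J" if "Fin i \<in> reversal (stops B J) (cut (turns J)) ` marks B J" for i
    using that transversal_flip J(2) by (auto simp: transversal_def stops_def closing_def)
  then show "flip B J - events J = J - events J" by (auto simp: flip_def rebuild_def)
  show "marks B (flip B J) = reversal (stops B J) (cut (turns J)) ` marks B J"
    unfolding flip_def using closing_flip
    by (intro marks_rebuild[OF J transversal_flip]) (auto simp: closing_def flip_def)
qed

lemma flip_flip: "flip B (flip B J) = J"
proof -
  let ?\<pi> = "reversal (stops B J) (cut (turns J))"
  have "?\<pi> (?\<pi> f) = f" if "f \<in> marks B J" for f
    using that reversal_stops transversal_marks[OF J] by (auto simp: transversal_def is_reversal_def)
  then have "?\<pi> ` ?\<pi> ` marks B J = marks B J" by (force simp: image_image)
  then have "flip B (flip B J) = (J - events J) \<union> {j. Fin j \<in> marks B J}"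
    unfolding flip_def[of B "flip B J"] rebuild_def by (simp add: flip_same)
  also have "\<dots> = J" using marks_Fin[OF J(2)] by auto
  finally show ?thesis .
qed

text \<open>The correction for a negative end in \<open>pair_wt\<close> is the sign of the
  additional event if \<open>B = {Pinf}\<close>. If \<open>B = {}\<close> it is always present, and
  the 1 moved to the right is <\<rho>, \<alpha>_p^v>.\<close>

lemma pair_wt_stops:
  "(\<Sum>e\<in>stops B J - marks B J. if passed (turns J) (marks B J) e then -1 else 1) =
    pair (wt J) (simple p) + (if B = {} then 1 else 0)"
proof -
  note JI = adm_finite[OF J(1)] adm_subset[OF J(1)]
  let ?s = "\<lambda>e. if neg (wfold J e) then -1 else 1 :: real"
  let ?E = "if B = {Pinf} \<and> neg (wfold J Pinf) then {Pinf} else {}"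
  have "stops B J - marks B J = Fin ` (events J - J) \<union> ?E"
    using J(2) by (auto simp: stops_def marks_def closing_def)
  then have "sum ?s (stops B J - marks B J) = sum ?s (Fin ` (events J - J)) + sum ?s ?E"
    using finite_events[OF JI] by (simp only:) (rule sum.union_disjoint; auto)
  also have "sum ?s (Fin ` (events J - J)) = (\<Sum>e\<in>events J - J. ?s (Fin e))"
    by (subst sum.reindex) (auto simp: inj_on_def)
  finally show ?thesis using pair_wt[OF JI] J(2)
    by (auto simp: neg_iff_passed[OF J, symmetric] closing_def)
qed

end

lemma pair_wt_flip:
  assumes J: "adm J" "closing B J"
  shows "pair (wt (flip B J)) (simple p) + (if B = {} then 1 else 0) =
    - (pair (wt J) (simple p) + (if B = {} then 1 else 0))"
proof -
  let ?\<pi> = "reversal (stops B J) (cut (turns J))" and ?T = "turns J" and ?F = "marks B J" and ?E = "stops B J"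
  note rv = reversal_stops[OF J] and tr = transversal_marks[OF J]
  have inv: "?\<pi> e \<in> ?E" "?\<pi> (?\<pi> e) = e" if "e \<in> ?E" for e using rv that by (auto simp: is_reversal_def)
  have FE: "?F \<subseteq> ?E" using tr by (simp add: transversal_def)
  have "pair (wt (flip B J)) (simple p) + (if B = {} then 1 else 0) =
      (\<Sum>e\<in>?E - ?\<pi> ` ?F. if passed ?T (?\<pi> ` ?F) e then -1 else 1)"
    using pair_wt_stops[OF adm_flip[OF J] closing_flip[OF J]] by (simp add: flip_same[OF J])
  also have "\<dots> = (\<Sum>e\<in>?E - ?F. - (if passed ?T ?F e then -1 else 1))"
  proof (rule sum.reindex_bij_witness[of _ ?\<pi> ?\<pi>])
    fix e assume e: "e \<in> ?E - ?\<pi> ` ?F"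
    show 1: "?\<pi> (?\<pi> e) = e" using inv e by blast
    show "?\<pi> e \<in> ?E - ?F" using e inv 1 by force
    then show "- (if passed ?T ?F (?\<pi> e) then - 1 else 1) = (if passed ?T (?\<pi> ` ?F) e then - 1 else (1::real))"
      using passed_reversal[OF rv tr, of "?\<pi> e"] 1 by auto
  next
    fix e assume e: "e \<in> ?E - ?F"
    show "?\<pi> (?\<pi> e) = e" using inv e by blast
    have "?\<pi> e \<notin> ?\<pi> ` ?F"
    proof
      assume "?\<pi> e \<in> ?\<pi> ` ?F"
      then obtain f where "f \<in> ?F" "?\<pi> e = ?\<pi> f" by blast
      then have "e = f" using inv e FE by (metis DiffD1 subsetD)
      then show False using e \<open>f \<in> ?F\<close> by simp
    qed
    then show "?\<pi> e \<in> ?E - ?\<pi> ` ?F" using e inv by blast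
  qed
  also have "\<dots> = - (\<Sum>e\<in>?E - ?F. if passed ?T ?F e then -1 else 1)" by (rule sum_negf)
  finally show ?thesis unfolding pair_wt_stops[OF J] .
qed

text \<open>The two weights differ by a multiple of \<alpha>_p (\<open>afold_mod_root\<close>), and
  the pairing with its coroot determines which. For \<open>B = {}\<close> this is the dot action of
  s_p.\<close>

lemma wt_flip:
  assumes J: "adm J" "closing B J"
  shows "wt (flip B J) = srefl p (wt J) - (if B = {} then 1 else 0) *\<^sub>R simple p"
proof -
  note f = adm_flip[OF J]
  obtain x where x: "wt J = afold (J - events J) Pinf lam + x *\<^sub>R simple p"
    using afold_mod_root[OF adm_finite[OF J(1)] adm_subset[OF J(1)]] by (auto simp: wt_afold)
  obtain y where y: "wt (flip B J) = afold (J - events J) Pinf lam + y *\<^sub>R simple p"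
    using afold_mod_root[OF adm_finite[OF f] adm_subset[OF f], of Pinf lam] flip_same[OF J] by (auto simp: wt_afold)
  have eq: "wt (flip B J) = wt J + (y - x) *\<^sub>R simple p" using x y by (simp add: scaleR_diff_left)
  have "pair (wt (flip B J)) (simple p) = pair (wt J) (simple p) + (y - x) * 2"
    using pair_self[OF simple_in_real_roots[OF p]] unfolding eq by (simp add: form_bilin)
  then have "y - x = - pair (wt J) (simple p) - (if B = {} then 1 else 0)"
    using pair_wt_flip[OF J] by (simp split: if_splits)
  then show ?thesis unfolding eq by (simp add: root_refl_def scaleR_diff_left)
qed

lemma formal_sum_wt_invariant:
  "formal_sum (\<lambda>_. 1) wt {J. adm J} (srefl p \<nu>) = formal_sum (\<lambda>_. 1) wt {J. adm J} \<nu>"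
  unfolding formal_sum_def
proof (rule sum.reindex_bij_witness[of _ "flip {Pinf}" "flip {Pinf}"])
  have c: "closing {Pinf} J" for J by (simp add: closing_def)
  have wt: "wt (flip {Pinf} J) = srefl p (wt J)" if "adm J" for J using wt_flip[OF that c] by simp
  show "flip {Pinf} (flip {Pinf} J) = J" if "J \<in> {J \<in> {J. adm J}. wt J = \<nu>}" for J
    using that flip_flip[OF _ c] by simp
  show "flip {Pinf} (flip {Pinf} J) = J" if "J \<in> {J \<in> {J. adm J}. wt J = srefl p \<nu>}" for J
    using that flip_flip[OF _ c] by simp
  show "flip {Pinf} J \<in> {J \<in> {J. adm J}. wt J = srefl p \<nu>}" if "J \<in> {J \<in> {J. adm J}. wt J = \<nu>}" for J
    using that adm_flip[OF _ c] wt by simp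
  show "flip {Pinf} J \<in> {J \<in> {J. adm J}. wt J = \<nu>}" if "J \<in> {J \<in> {J. adm J}. wt J = srefl p \<nu>}" for J
    using that adm_flip[OF _ c] wt p by simp
qed simp

end

section \<open>The cancelling involution and the character formula\<close>

text \<open>Chosen from the final element alone, so that a flip preserving this element makes the
  same choice again.\<close>

definition descent :: "'i set \<Rightarrow> nat" where
  "descent J = (SOME p. p \<in> {1..r} \<and> len (srefl p \<circ> wfold J Pinf) < len (wfold J Pinf))"

lemma descent:
  assumes "adm J" "J \<noteq> {}"
  shows "descent J \<in> {1..r}" "neg (descent J) (wfold J Pinf)"
proof -
  have "len (wfold J Pinf) = card J" using adm_length[OF assms(1), of Pinf] by simp
  then have "wfold J Pinf \<noteq> id" using assms adm_finite by (auto simp del: id_apply)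
  then have "\<exists>p. p \<in> {1..r} \<and> len (srefl p \<circ> wfold J Pinf) < len (wfold J Pinf)"
    using left_descent_exists[OF wfold_W[OF adm_finite[OF assms(1)] adm_subset[OF assms(1)]]] by blast
  then have d: "descent J \<in> {1..r} \<and> len (srefl (descent J) \<circ> wfold J Pinf) < len (wfold J Pinf)"
    unfolding descent_def by (rule someI_ex)
  then show "descent J \<in> {1..r}" by blast
  from neg_def[OF this] show "neg (descent J) (wfold J Pinf)" using d by blast
qed

lemma adm_empty: "adm {}"
  by (simp add: admissible_def)

theorem character_admissible:
  "irr_character form r simple ht \<rho> lam = formal_sum (\<lambda>_. 1) wt {J. adm J}"
proof (rule character_by_cancellation[where xtop = "{}" and d = descent and D = "\<lambda>J. flip (descent J) {} J"])
  show "formally_summable form r simple ht wt {J. adm J}" by (rule adm_summable)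
  show "ht (wt J) \<le> ht lam" if "J \<in> {J. adm J}" for J using that adm_ht_le by simp
  show "formal_sum (\<lambda>_. 1) wt {J. adm J} (srefl p \<nu>) = formal_sum (\<lambda>_. 1) wt {J. adm J} \<nu>" if "p \<in> {1..r}" for p \<nu>
    using that by (rule formal_sum_wt_invariant)
  show "{} \<in> {J. adm J}" using adm_empty by simp
  show "wt {} = lam" by (simp add: subset_weight_def)
  fix J assume J: "J \<in> {J. adm J} - {{}}"
  let ?p = "descent J"
  have a: "adm J" "J \<noteq> {}" using J by auto
  note p = descent(1)[OF a]
  have c: "closing ?p {} J" using descent[OF a] by (simp add: closing_def[OF p])
  show "?p \<in> {1..r}" by (rule p)
  let ?J = "flip ?p {} J"
  have end_eq: "wfold ?J Pinf = wfold J Pinf" by (rule wfold_flip_Pinf[OF p a(1) c]) simp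
  have adm': "adm ?J" by (rule adm_flip[OF p a(1) c])
  \<comment> \<open>The number of folds is the length of the final element, which the flip
    keeps.\<close>
  have "?J \<noteq> {}"
    using adm_length[OF a(1), of Pinf] adm_length[OF adm', of Pinf] end_eq a adm_finite[OF a(1)] by auto
  moreover have "descent ?J = ?p" unfolding descent_def[of ?J] end_eq descent_def[of J, symmetric] ..
  ultimately show "?J \<in> {J. adm J} - {{}} \<and> flip (descent ?J) {} ?J = J \<and> descent ?J = ?p"
    using adm' flip_flip[OF p a(1) c] by simp
  have "srefl ?p \<rho> = \<rho> - simple ?p" using rho_pair[OF p] by (simp add: root_refl_def)
  then show "wt ?J + \<rho> = srefl ?p (wt J + \<rho>)"
    using wt_flip[OF p a(1) c] by (simp add: linear_add[OF refl_linear])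
qed

end

theorem theorem1p2:
  fixes form :: "'v::real_vector \<Rightarrow> 'v \<Rightarrow> real"
    and r :: nat
    and simple :: "nat \<Rightarrow> 'v"
    and ht :: "'v \<Rightarrow> real"
    and \<rho> lam :: 'v
    and I :: "'i::linorder set"
    and \<beta> :: "'i \<Rightarrow> 'v"
  assumes "symmetrizable_root_datum form r simple"
    and "linear ht" and "\<And>p. p \<in> {1..r} \<Longrightarrow> ht (simple p) = 1"
    and "\<rho> \<in> weights form r simple"
    and "\<And>p. p \<in> {1..r} \<Longrightarrow> form \<rho> (coroot form (simple p)) = 1"
    and "dominant form r simple lam"
    and "lambda_chain form r simple lam I \<beta>"
  shows "formally_summable form r simple ht (subset_weight form lam I \<beta>)
           {J. admissible form r simple I \<beta> J} \<and>
         irr_character form r simple ht \<rho> lam =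
           formal_sum (\<lambda>J. 1) (subset_weight form lam I \<beta>) {J. admissible form r simple I \<beta> J}"
proof -
  interpret chain_datum form r simple ht \<rho> lam I \<beta>
    using assms by (simp add: chain_datum_def chain_datum_axioms_def root_datum_height_def root_datum_height_axioms_def)
  show ?thesis using adm_summable character_admissible by blast
qed

end
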